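(* Let $n\ge 3$, $p,q>1$, and let $D_1,D_2,V_1,V_2$ satisfy the standing assumptions (A). Consider the Cauchy problem (S) with nonlinearities $N_1(v,v_t)=|v_t|^p$ and $N_2(u,u_t)=|u_t|^q$, with initial data as in (D). Assume $\Gamma_{GG}(n,p,q)\ge0$. Then every weak solution $(u,v)$ of (S) (in the sense defined in the context, with $u_t\in L^q_{loc}((0,T)\times\mathbb{R}^n)$, $v_t\in L^p_{loc}((0,T)\times\mathbb{R}^n)$) satisfying $\operatorname{supp}(u,v)\subset\{(t,x):|x|\le t+R\}$ blows up in finite time. Moreover, there exist $\varepsilon_0>0$ and $C>0$ independent of $\varepsilon$ such that for all $\varepsilon\in(0,\varepsilon_0)$, $$T_\varepsilon\le\begin{cases} C\,\varepsilon^{-\Gamma_{GG}(n,p,q)^{-1}}, & \Gamma_{GG}(n,p,q)>0,\\ \exp\big(C\varepsilon^{-(pq-1)}\big), & \Gamma_{GG}(n,p,q)=0,\ p\ne q,\\ \exp\big(C\varepsilon^{-(p-1)}\big), & \Gamma_{GG}(n,p,q)=0,\ p=q.\end{cases}$$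
   Context: System (S): for $(t,x)\in(0,T)\times\mathbb{R}^n$, $u_{tt}-\Delta u+D_1(x)u_t+V_1(x)u=N_1(v,v_t)$, $v_{tt}-\Delta v+D_2(x)v_t+V_2(x)v=N_2(u,u_t)$, with $u(0,x)=\varepsilon u_0(x)$, $u_t(0,x)=\varepsilon u_1(x)$, $v(0,x)=\varepsilon v_0(x)$, $v_t(0,x)=\varepsilon v_1(x)$, where $\varepsilon>0$ is a small parameter. (D): $u_0,u_1,v_0,v_1\in C_c^\infty(\mathbb{R}^n)$ are nonnegative, $(u_0,u_1)$ and $(v_0,v_1)$ are each nontrivial, and all are supported in $B_R=\{x:|x|\le R\}$ for some $R>0$. (A): for $i=1,2$, $D_i,V_i\in C(\mathbb{R}^n)\cap C^\delta(B_\delta)$ for some $\delta>0$, are radial, and $0\le D_i(x)\le \alpha_1(1+|x|)^{-\beta}$, $0\le V_i(x)\le\alpha_2(1+|x|)^{-\omega}$ with constants $\alpha_1,\alpha_2\ge0$, $\beta>1$, $\omega>2$. Weak solution on $[0,T)$: $u,v\in C([0,T),H^1(\mathbb{R}^n))\cap C^1([0,T),L^2(\mathbb{R}^n))$ with the stated local integrability, such that for every $\Psi\in C_0^\infty([0,T)\times\mathbb{R}^n)$, $\varepsilon\int u_1\Psi(0,x)dx+\varepsilon\int u_0D_1\Psi(0,x)dx+\int_0^T\!\!\int N_1(v,v_t)\Psi\,dxdt=-\int_0^T\!\!\int u_t\Psi_t\,dxdt+\int_0^T\!\!\int\nabla u\cdot\nabla\Psi\,dxdt-\int_0^T\!\!\int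 uD_1\Psi_t\,dxdt+\int_0^T\!\!\int V_1u\Psi\,dxdt$, and the analogous identity with $(u,u_0,u_1,D_1,V_1,N_1(v,v_t))$ replaced by $(v,v_0,v_1,D_2,V_2,N_2(u,u_t))$. The lifespan $T_\varepsilon$ is the supremum of all $T$ for which such a weak solution exists. $\Gamma_{GG}(n,p,q)=\max\Big\{\frac{p+1}{pq-1},\frac{q+1}{pq-1}\Big\}-\frac{n-1}{2}$. *)

theory Defs
  imports "HOL-Analysis.Analysis"
begin

fun iter_dd :: "('b::real_normed_vector \<Rightarrow> real) \<Rightarrow> 'b list \<Rightarrow> 'b \<Rightarrow> real" where
  "iter_dd f [] = f"
| "iter_dd f (v # vs) = (\<lambda>x. frechet_derivative (iter_dd f vs) (at x) v)"

definition smooth_fun :: "('b::real_normed_vector \<Rightarrow> real) \<Rightarrow> bool" where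
  "smooth_fun f \<longleftrightarrow> (\<forall>vs x. iter_dd f vs differentiable (at x))"

definition Cc_inf :: "('b::real_normed_vector \<Rightarrow> real) \<Rightarrow> bool" where
  "Cc_inf f \<longleftrightarrow> smooth_fun f \<and> (\<exists>K. compact K \<and> (\<forall>x. x \<notin> K \<longrightarrow> f x = 0))"

text \<open>Test functions in C_0^infinity([0,T) x R^n): smooth on R x R^n, vanishing outside
  a compact subset of (-infinity,T) x R^n.\<close>
definition test_fun :: "real \<Rightarrow> (real \<times> 'a::euclidean_space \<Rightarrow> real) \<Rightarrow> bool" where
  "test_fun T \<Psi> \<longleftrightarrow> smooth_fun \<Psi> \<and>
     (\<exists>K. compact K \<and> K \<subseteq> {z. fst z < T} \<and> (\<forall>z. z \<notin> K \<longrightarrow> \<Psi> z = 0))"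

definition radial :: "('a::real_normed_vector \<Rightarrow> real) \<Rightarrow> bool" where
  "radial f \<longleftrightarrow> (\<forall>x y. norm x = norm y \<longrightarrow> f x = f y)"

definition hoelder_ball :: "real \<Rightarrow> ('a::real_normed_vector \<Rightarrow> real) \<Rightarrow> bool" where
  "hoelder_ball \<delta> f \<longleftrightarrow> (\<exists>L. \<forall>x\<in>cball 0 \<delta>. \<forall>y\<in>cball 0 \<delta>.
      \<bar>f x - f y\<bar> \<le> L * norm (x - y) powr \<delta>)"

definition is_L2 :: "('a::euclidean_space \<Rightarrow> 'c::{real_normed_vector, second_countable_topology}) \<Rightarrow> bool" where
  "is_L2 f \<longleftrightarrow> f \<in> borel_measurable lborel \<and> integrable lborel (\<lambda>x. (norm (f x))\<^sup>2)"

definition L2norm :: "('a::euclidean_space \<Rightarrow> 'c::real_normed_vector) \<Rightarrow> real" where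
  "L2norm f = sqrt (\<integral>x. (norm (f x))\<^sup>2 \<partial>lborel)"

definition weak_grad :: "('a::euclidean_space \<Rightarrow> real) \<Rightarrow> ('a \<Rightarrow> 'a) \<Rightarrow> bool" where
  "weak_grad f g \<longleftrightarrow> (\<forall>\<phi>. Cc_inf \<phi> \<longrightarrow> (\<forall>e\<in>Basis.
      (\<integral>x. f x * frechet_derivative \<phi> (at x) e \<partial>lborel) = - (\<integral>x. (g x \<bullet> e) * \<phi> x \<partial>lborel)))"

definition is_H1 :: "('a::euclidean_space \<Rightarrow> real) \<Rightarrow> ('a \<Rightarrow> 'a) \<Rightarrow> bool" where
  "is_H1 f g \<longleftrightarrow> is_L2 f \<and> is_L2 g \<and> weak_grad f g"

definition C_H1 :: "real \<Rightarrow> (real \<Rightarrow> 'a::euclidean_space \<Rightarrow> real) \<Rightarrow> (real \<Rightarrow> 'a \<Rightarrow> 'a) \<Rightarrow> bool" where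
  "C_H1 T w gw \<longleftrightarrow> (\<forall>t\<in>{0..<T}. is_H1 (w t) (gw t)) \<and>
     (\<forall>t\<in>{0..<T}. ((\<lambda>s. L2norm (\<lambda>x. w s x - w t x) + L2norm (\<lambda>x. gw s x - gw t x))
        \<longlongrightarrow> 0) (at t within {0..<T}))"

definition C1_L2 :: "real \<Rightarrow> (real \<Rightarrow> 'a::euclidean_space \<Rightarrow> real) \<Rightarrow> (real \<Rightarrow> 'a \<Rightarrow> real) \<Rightarrow> bool" where
  "C1_L2 T w wt \<longleftrightarrow> (\<forall>t\<in>{0..<T}. is_L2 (w t) \<and> is_L2 (wt t)) \<and>
     (\<forall>t\<in>{0..<T}. ((\<lambda>s. L2norm (\<lambda>x. (w s x - w t x) / (s - t) - wt t x)) \<longlongrightarrow> 0)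
        (at t within {0..<T})) \<and>
     (\<forall>t\<in>{0..<T}. ((\<lambda>s. L2norm (\<lambda>x. wt s x - wt t x)) \<longlongrightarrow> 0) (at t within {0..<T}))"

definition Lp_loc :: "real \<Rightarrow> real \<Rightarrow> (real \<Rightarrow> 'a::euclidean_space \<Rightarrow> real) \<Rightarrow> bool" where
  "Lp_loc T r f \<longleftrightarrow> (\<lambda>z. f (fst z) (snd z)) \<in> borel_measurable lborel \<and>
     (\<forall>K. compact K \<and> K \<subseteq> {0<..<T} \<times> UNIV \<longrightarrow>
        set_integrable lborel K (\<lambda>z. \<bar>f (fst z) (snd z)\<bar> powr r))"

text \<open>Weak identity for  w_tt - Lap w + D w_t + V w = N, w(0)=eps w0, w_t(0)=eps w1,
  where N is the (already evaluated) nonlinear term; all integrals are required to exist.\<close>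
definition weak_eq :: "real \<Rightarrow> real \<Rightarrow> ('a::euclidean_space \<Rightarrow> real) \<Rightarrow> ('a \<Rightarrow> real)
    \<Rightarrow> ('a \<Rightarrow> real) \<Rightarrow> ('a \<Rightarrow> real) \<Rightarrow> (real \<Rightarrow> 'a \<Rightarrow> real)
    \<Rightarrow> (real \<Rightarrow> 'a \<Rightarrow> real) \<Rightarrow> (real \<Rightarrow> 'a \<Rightarrow> real) \<Rightarrow> (real \<Rightarrow> 'a \<Rightarrow> 'a) \<Rightarrow> bool" where
  "weak_eq T \<epsilon> D V w0 w1 N w wt gw \<longleftrightarrow> (\<forall>\<Psi>. test_fun T \<Psi> \<longrightarrow>
     set_integrable lborel ({0<..<T} \<times> UNIV) (\<lambda>(t,x). N t x * \<Psi> (t,x)) \<and>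
     set_integrable lborel ({0<..<T} \<times> UNIV) (\<lambda>(t,x). wt t x * frechet_derivative \<Psi> (at (t,x)) (1,0)) \<and>
     set_integrable lborel ({0<..<T} \<times> UNIV) (\<lambda>(t,x). frechet_derivative \<Psi> (at (t,x)) (0, gw t x)) \<and>
     set_integrable lborel ({0<..<T} \<times> UNIV) (\<lambda>(t,x). w t x * D x * frechet_derivative \<Psi> (at (t,x)) (1,0)) \<and>
     set_integrable lborel ({0<..<T} \<times> UNIV) (\<lambda>(t,x). V x * w t x * \<Psi> (t,x)) \<and>
     \<epsilon> * (\<integral>x. w1 x * \<Psi> (0,x) \<partial>lborel) + \<epsilon> * (\<integral>x. w0 x * D x * \<Psi> (0,x) \<partial>lborel)
       + (LINT z:{0<..<T} \<times> UNIV|lborel. (\<lambda>(t,x). N t x * \<Psi> (t,x)) z)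
     = - (LINT z:{0<..<T} \<times> UNIV|lborel. (\<lambda>(t,x). wt t x * frechet_derivative \<Psi> (at (t,x)) (1,0)) z)
       + (LINT z:{0<..<T} \<times> UNIV|lborel. (\<lambda>(t,x). frechet_derivative \<Psi> (at (t,x)) (0, gw t x)) z)
       - (LINT z:{0<..<T} \<times> UNIV|lborel. (\<lambda>(t,x). w t x * D x * frechet_derivative \<Psi> (at (t,x)) (1,0)) z)
       + (LINT z:{0<..<T} \<times> UNIV|lborel. (\<lambda>(t,x). V x * w t x * \<Psi> (t,x)) z))"

definition weak_solution :: "real \<Rightarrow> real \<Rightarrow> ('a::euclidean_space \<Rightarrow> real) \<Rightarrow> ('a \<Rightarrow> real)
    \<Rightarrow> ('a \<Rightarrow> real) \<Rightarrow> ('a \<Rightarrow> real) \<Rightarrow> ('a \<Rightarrow> real) \<Rightarrow> ('a \<Rightarrow> real) \<Rightarrow> ('a \<Rightarrow> real) \<Rightarrow> ('a \<Rightarrow> real)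
    \<Rightarrow> real \<Rightarrow> real
    \<Rightarrow> (real \<Rightarrow> 'a \<Rightarrow> real) \<Rightarrow> (real \<Rightarrow> 'a \<Rightarrow> real) \<Rightarrow> (real \<Rightarrow> 'a \<Rightarrow> 'a)
    \<Rightarrow> (real \<Rightarrow> 'a \<Rightarrow> real) \<Rightarrow> (real \<Rightarrow> 'a \<Rightarrow> real) \<Rightarrow> (real \<Rightarrow> 'a \<Rightarrow> 'a) \<Rightarrow> bool" where
  "weak_solution p q D1 D2 V1 V2 u0 u1 v0 v1 \<epsilon> T u ut gu v vt gv \<longleftrightarrow>
     0 < T \<and>
     C_H1 T u gu \<and> C1_L2 T u ut \<and> C_H1 T v gv \<and> C1_L2 T v vt \<and>
     Lp_loc T q ut \<and> Lp_loc T p vt \<and>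
     (AE x in lborel. u 0 x = \<epsilon> * u0 x) \<and> (AE x in lborel. v 0 x = \<epsilon> * v0 x) \<and>
     weak_eq T \<epsilon> D1 V1 u0 u1 (\<lambda>t x. \<bar>vt t x\<bar> powr p) u ut gu \<and>
     weak_eq T \<epsilon> D2 V2 v0 v1 (\<lambda>t x. \<bar>ut t x\<bar> powr q) v vt gv"

definition supp_in_cone :: "real \<Rightarrow> real \<Rightarrow> (real \<Rightarrow> 'a::euclidean_space \<Rightarrow> real) \<Rightarrow> (real \<Rightarrow> 'a \<Rightarrow> real) \<Rightarrow> bool" where
  "supp_in_cone R T u v \<longleftrightarrow> (\<forall>t\<in>{0..<T}. AE x in lborel. norm x > t + R \<longrightarrow> u t x = 0 \<and> v t x = 0)"

definition lifespan :: "real \<Rightarrow> real \<Rightarrow> ('a::euclidean_space \<Rightarrow> real) \<Rightarrow> ('a \<Rightarrow> real)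
    \<Rightarrow> ('a \<Rightarrow> real) \<Rightarrow> ('a \<Rightarrow> real) \<Rightarrow> ('a \<Rightarrow> real) \<Rightarrow> ('a \<Rightarrow> real) \<Rightarrow> ('a \<Rightarrow> real) \<Rightarrow> ('a \<Rightarrow> real)
    \<Rightarrow> real \<Rightarrow> real \<Rightarrow> ereal" where
  "lifespan p q D1 D2 V1 V2 u0 u1 v0 v1 R \<epsilon> =
     (SUP T \<in> {T. \<exists>(u::real \<Rightarrow> 'a \<Rightarrow> real) ut gu v vt gv.
        weak_solution p q D1 D2 V1 V2 u0 u1 v0 v1 \<epsilon> T u ut gu v vt gv \<and> supp_in_cone R T u v}.
      ereal T)"

definition GammaGG :: "nat \<Rightarrow> real \<Rightarrow> real \<Rightarrow> real" where
  "GammaGG n p q = max ((p + 1) / (p * q - 1)) ((q + 1) / (p * q - 1)) - (real n - 1) / 2"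

end

theory Submission
  imports Defs
begin

text \<open>
  Write \<open>n\<close> for the dimension and \<open>s = (n - 1) / 2\<close>.  For each equation let \<open>\<phi>\<close> be the radial
  solution of \<open>\<Delta>\<phi> = (1 + D + V) \<phi>\<close> with \<open>\<phi> 0 = 1\<close>.  Since \<open>D + V\<close> is integrable along rays, \<open>\<phi>\<close> is
  comparable to \<open>(1 + r) powr (- s) * exp r\<close>.  Testing the weak equation with \<open>\<theta>(t) \<phi>(x)\<close> and moving
  the undifferentiated \<open>u\<close> onto \<open>u_t\<close> by integrating by parts in time gives an identity whose kernel
  for \<open>\<theta> = \<eta> * exp (- t)\<close>, with \<open>\<eta>\<close> decreasing and convex, is bounded by \<open>- \<eta>' * exp (- t) * \<phi>\<close>.

  With \<open>\<eta> = ((\<sigma> - t) / (1 + \<sigma>)) ^ k\<close>, the two equations become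
  \<open>c \<epsilon> + X \<le> C / (1 + \<sigma>) * \<integral>|u_t| W \<eta>\<^sub>1\<close> and \<open>c \<epsilon> + Y \<le> C / (1 + \<sigma>) * \<integral>|v_t| W \<eta>\<^sub>1\<close>, where \<open>X\<close> and \<open>Y\<close> are the
  integrals of \<open>|v_t| powr p\<close> and \<open>|u_t| powr q\<close> against \<open>W \<eta>\<close>, \<open>W\<close> is the exponential weight on the
  light cone and \<open>\<eta>\<^sub>1\<close> is the same profile with exponent \<open>k - 1\<close>.  Hoelder's inequality closes the
  subcritical case.  In the critical case the Hoelder weight \<open>\<tau> = (1 + t) / (1 + \<sigma>)\<close> produces the
  increment of \<open>X\<close> between \<open>\<sigma>\<close> and the next dyadic time, so \<open>z = c \<epsilon> + X\<close> satisfies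
  \<open>z' \<ge> z + c z powr (p q)\<close> along dyadic times (or exponent \<open>p\<close> if \<open>p = q\<close>) while staying bounded, which
  limits the number of dyadic times.
\<close>


section \<open>Smooth test functions\<close>

text \<open>The function \<open>exp (- t) * \<phi> x\<close> solves the adjoint equation \<psi>_tt -
  \<Delta>\<psi> - D \<psi>_t + V \<psi> = 0 exactly, so for a pure exponential in time the kernel
  in front of u_t would vanish. Only the derivative of \<eta> survives, and this is the source of
  the factor \<open>1 / (1 + \<sigma>)\<close>. The undifferentiated u must be eliminated because
  the nonlinearities control only the time derivatives.

  The coefficients are merely continuous, so \<phi> is no test function: the identity is first
  proved for smooth products \<theta>(t) \<zeta>(x) and then carried to the limit, which works
  because u_t is integrable up to time 0 and vanishes off the cone.

  In the critical case the power of \<open>1 + \<sigma>\<close> vanishes in each inequality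
  separately if p = q, so each closes with exponent p. If p and q differ, these powers cancel only
  after composing the two inequalities, which gives the exponent pq. The Hoelder weight \<tau>
  leaves the dual weight \<open>\<tau> powr (- (1 / (p - 1)))\<close>; the requirement
  \<open>1 / (p - 1) \<le> s\<close> holds for the larger of the two exponents, so that is where the
  weight is inserted.\<close>

definition flat :: "nat \<Rightarrow> real \<Rightarrow> real" where
  "flat m t = (if t > 0 then exp (- inverse t) * inverse t ^ m else 0)"

lemma flat_nonneg: "0 \<le> flat m t"
  by (simp add: flat_def)

lemma flat_pos: "0 < t \<Longrightarrow> 0 < flat m t"
  by (simp add: flat_def)

lemma flat_eq_0: "t \<le> 0 \<Longrightarrow> flat m t = 0"
  by (simp add: flat_def)

lemma flat_tendsto_0: "(flat m \<longlongrightarrow> 0) (at 0)"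
proof -
  have "((\<lambda>t. exp (- inverse t) * inverse t ^ m) \<longlongrightarrow> 0) (at_right (0::real))"
    using filterlim_compose[OF tendsto_power_div_exp_0[of m] filterlim_inverse_at_top_right]
    by (simp add: exp_minus field_simps)
  then have r: "(flat m \<longlongrightarrow> 0) (at_right 0)"
    by (rule Lim_transform_eventually)
      (auto simp: flat_def eventually_at_right_field intro!: exI[of _ 1])
  have "(flat m \<longlongrightarrow> 0) (at_left 0)"
    by (rule tendsto_eventually)
      (auto simp: flat_def eventually_at_left_field intro!: exI[of _ "-1"])
  with r show ?thesis
    by (simp add: filterlim_split_at)
qed

text \<open>The parameter \<open>m\<close> is there to close the family under differentiation. At 0
  the difference quotient of \<open>flat m\<close> is \<open>flat (m + 1)\<close> itself, so
  \<open>flat_tendsto_0\<close> yields the derivative.\<close>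

lemma DERIV_flat: "(flat m has_real_derivative (flat (m + 2) t - of_nat m * flat (m + 1) t)) (at t)"
proof -
  consider "t > 0" | "t < 0" | "t = 0" by linarith
  then show ?thesis
  proof cases
    case 1
    have "((\<lambda>t. exp (- inverse t) * inverse t ^ m) has_real_derivative
        (flat (m + 2) t - of_nat m * flat (m + 1) t)) (at t)"
    proof -
      have "((\<lambda>t. exp (- inverse t) * inverse t ^ m) has_real_derivative
        exp (- inverse t) * (inverse t * inverse t) * inverse t ^ m +
        of_nat m * inverse t ^ (m - 1) * (- (inverse t * inverse t)) * exp (- inverse t)) (at t)"
        using 1 by (auto intro!: derivative_eq_intros)
      then show ?thesis
        using 1 by (cases m) (simp_all add: flat_def algebra_simps)
    qed
    then show ?thesis
      by (rule has_field_derivative_transform_within_open[where S = "{0<..}"])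
        (use 1 in \<open>auto simp: flat_def\<close>)
  next
    case 2
    have "((\<lambda>_. 0) has_real_derivative (flat (m + 2) t - of_nat m * flat (m + 1) t)) (at t)"
      using 2 by (simp add: flat_eq_0)
    then show ?thesis
      by (rule has_field_derivative_transform_within_open[where S = "{..<0}"])
        (use 2 in \<open>auto simp: flat_def\<close>)
  next
    case 3
    have eq: "(flat m (0 + h) - flat m 0) / h = flat (m + 1) h" for h
      by (auto simp: flat_def divide_simps)
    show ?thesis
      unfolding 3 DERIV_def eq using flat_tendsto_0[of "m + 1"] by (simp add: flat_eq_0)
  qed
qed

text \<open>A class of explicitly given smooth functions, closed under directional derivatives by
  construction; it is rich enough to contain all cutoffs and test functions that are needed.\<close>

inductive esm :: "('b::real_normed_vector \<Rightarrow> real) \<Rightarrow> bool" where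
  esm_const: "esm (\<lambda>_. c)"
| esm_linear: "bounded_linear f \<Longrightarrow> esm f"
| esm_add: "esm f \<Longrightarrow> esm g \<Longrightarrow> esm (\<lambda>x. f x + g x)"
| esm_mult: "esm f \<Longrightarrow> esm g \<Longrightarrow> esm (\<lambda>x. f x * g x)"
| esm_inverse: "esm f \<Longrightarrow> (\<And>x. f x \<noteq> 0) \<Longrightarrow> esm (\<lambda>x. inverse (f x))"
| esm_flat: "esm f \<Longrightarrow> esm (\<lambda>x. flat m (f x))"

lemma esm_minus: "esm f \<Longrightarrow> esm (\<lambda>x. - f x)"
  using esm_mult[OF esm_const[of "-1"]] by simp

lemma esm_diff: "esm f \<Longrightarrow> esm g \<Longrightarrow> esm (\<lambda>x. f x - g x)"
  using esm_add[OF _ esm_minus, of f g] by simp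

lemma esm_sum: "(\<And>i. i \<in> I \<Longrightarrow> esm (f i)) \<Longrightarrow> esm (\<lambda>x. \<Sum>i\<in>I. f i x)"
  by (induction I rule: infinite_finite_induct) (auto intro: esm_const esm_add)

lemma esm_power: "esm f \<Longrightarrow> esm (\<lambda>x. f x ^ n)"
  by (induction n) (auto intro: esm_const esm_mult)

lemma esm_compose_linear:
  "esm f \<Longrightarrow> bounded_linear l \<Longrightarrow> esm (\<lambda>x. f (l x))"
proof (induction rule: esm.induct)
  case (esm_linear f)
  then show ?case by (intro esm.esm_linear) (rule bounded_linear_compose)
qed (auto intro: esm.intros)

lemma esm_norm_square: "esm (\<lambda>x::'a::euclidean_space. (norm x)\<^sup>2)"
proof -
  have "esm (\<lambda>x::'a. \<Sum>b\<in>Basis. (x \<bullet> b) ^ 2)"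
    by (intro esm_sum esm_power esm_linear bounded_linear_inner_left)
  moreover have "(norm x)\<^sup>2 = (\<Sum>b\<in>Basis. (x \<bullet> b) ^ 2)" for x :: 'a
    unfolding power2_norm_eq_inner by (subst euclidean_inner) (simp add: power2_eq_square)
  ultimately show ?thesis by simp
qed

text \<open>Differentiability and membership of all directional derivatives are carried through one
  induction; together they let \<open>iter_dd\<close> be iterated without leaving the class.\<close>

lemma esm_has_derivative:
  assumes "esm f"
  shows "\<exists>f'. \<forall>x. (f has_derivative f' x) (at x) \<and> (\<forall>v. esm (\<lambda>x. f' x v))"
  using assms
proof (induction rule: esm.induct)
  case (esm_const c)
  show ?case
    by (rule exI[of _ "\<lambda>x v. 0"]) (auto intro: esm.intros)
next
  case (esm_linear f)
  then show ?case
    by (intro exI[of _ "\<lambda>x. f"])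
      (auto intro: esm.intros bounded_linear_imp_has_derivative)
next
  case (esm_add f g)
  then obtain f' g' where "\<And>x. (f has_derivative f' x) (at x)" "\<And>v. esm (\<lambda>x. f' x v)"
    "\<And>x. (g has_derivative g' x) (at x)" "\<And>v. esm (\<lambda>x. g' x v)" by metis
  then show ?case
    by (intro exI[of _ "\<lambda>x v. f' x v + g' x v"])
      (auto intro: esm.intros has_derivative_add)
next
  case (esm_mult f g)
  then obtain f' g' where "\<And>x. (f has_derivative f' x) (at x)" "\<And>v. esm (\<lambda>x. f' x v)"
    "\<And>x. (g has_derivative g' x) (at x)" "\<And>v. esm (\<lambda>x. g' x v)" by metis
  with esm_mult.hyps show ?case
    by (intro exI[of _ "\<lambda>x v. f x * g' x v + f' x v * g x"])
      (auto intro!: esm.esm_add esm.esm_mult has_derivative_mult)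
next
  case (esm_inverse f)
  then obtain f' where "\<And>x. (f has_derivative f' x) (at x)" "\<And>v. esm (\<lambda>x. f' x v)" by metis
  with esm_inverse.hyps show ?case
    by (intro exI[of _ "\<lambda>x v. - (inverse (f x) * f' x v * inverse (f x))"])
      (auto intro!: esm_minus esm.esm_inverse esm.esm_mult has_derivative_inverse)
next
  case (esm_flat f m)
  then obtain f' where f': "\<And>x. (f has_derivative f' x) (at x)" "\<And>v. esm (\<lambda>x. f' x v)" by metis
  have "((\<lambda>x. flat m (f x)) has_derivative
      (\<lambda>v. (flat (m + 2) (f x) - of_nat m * flat (m + 1) (f x)) * f' x v)) (at x)" for x
    using has_derivative_compose[OF f'(1) has_field_derivative_imp_has_derivative[OF DERIV_flat]]
    by simp
  moreover have "esm (\<lambda>x. (flat (m + 2) (f x) - of_nat m * flat (m + 1) (f x)) * f' x v)" for v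
    by (intro esm.esm_mult esm_diff f' esm.esm_flat esm_flat.hyps esm.esm_const)
  ultimately show ?case
    by (intro exI[of _ "\<lambda>x v. (flat (m + 2) (f x) - of_nat m * flat (m + 1) (f x)) * f' x v"]) auto
qed

lemma esm_differentiable: "esm f \<Longrightarrow> f differentiable (at x)"
  using esm_has_derivative differentiable_def by blast

lemma esm_frechet_derivative:
  assumes "esm f" shows "esm (\<lambda>x. frechet_derivative f (at x) v)"
proof -
  obtain f' where f': "\<And>x. (f has_derivative f' x) (at x)" "\<And>v. esm (\<lambda>x. f' x v)"
    using esm_has_derivative[OF assms] by blast
  have "(\<lambda>x. frechet_derivative f (at x) v) = (\<lambda>x. f' x v)"
    using frechet_derivative_at[OF f'(1)] by metis
  with f'(2) show ?thesis by simp
qed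

lemma esm_imp_smooth_fun: "esm f \<Longrightarrow> smooth_fun f"
proof -
  assume f: "esm f"
  have "esm (iter_dd f vs)" for vs
    by (induction vs) (auto intro: f esm_frechet_derivative)
  then show ?thesis
    by (simp add: smooth_fun_def esm_differentiable)
qed

lemma esm_continuous: "esm f \<Longrightarrow> continuous_on S f"
  by (meson continuous_at_imp_continuous_on differentiable_imp_continuous_within esm_differentiable)

text \<open>The usual quotient of bump functions, taken in the squared norm because the norm is not
  smooth at 0. Since \<open>a < b\<close>, the two summands of the denominator never vanish
  together, as \<open>esm_inverse\<close> demands.\<close>

lemma esm_cutoff:
  fixes a b :: real
  assumes "0 \<le> a" "a < b"
  obtains \<kappa> :: "'a::euclidean_space \<Rightarrow> real" where "esm \<kappa>" "\<And>x. 0 \<le> \<kappa> x" "\<And>x. \<kappa> x \<le> 1"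
    "\<And>x. norm x \<le> a \<Longrightarrow> \<kappa> x = 1" "\<And>x. b \<le> norm x \<Longrightarrow> \<kappa> x = 0"
proof -
  define \<kappa> where "\<kappa> = (\<lambda>x::'a. flat 0 (b\<^sup>2 - (norm x)\<^sup>2) *
     inverse (flat 0 (b\<^sup>2 - (norm x)\<^sup>2) + flat 0 ((norm x)\<^sup>2 - a\<^sup>2)))"
  have ab: "a\<^sup>2 < b\<^sup>2"
    using assms by (simp add: power_strict_mono)
  have pos: "0 < flat 0 (b\<^sup>2 - y) + flat 0 (y - a\<^sup>2)" for y
  proof (cases "y < b\<^sup>2")
    case True
    then show ?thesis using flat_pos[of "b\<^sup>2 - y" 0] flat_nonneg[of 0 "y - a\<^sup>2"] by simp
  next
    case False
    then show ?thesis using ab flat_pos[of "y - a\<^sup>2" 0] flat_nonneg[of 0 "b\<^sup>2 - y"] by simp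
  qed
  show ?thesis
  proof
    show "esm \<kappa>"
      unfolding \<kappa>_def
      by (rule esm_mult esm_inverse esm_add esm_flat esm_diff esm_const esm_norm_square
          less_imp_neq[OF pos, symmetric])+
    show "0 \<le> \<kappa> x" for x
      using pos[of "(norm x)\<^sup>2"] by (simp add: \<kappa>_def flat_nonneg)
    show "\<kappa> x \<le> 1" for x
      using pos[of "(norm x)\<^sup>2"] flat_nonneg[of 0 "(norm x)\<^sup>2 - a\<^sup>2"]
      by (simp add: \<kappa>_def flat_nonneg field_simps)
    show "\<kappa> x = 1" if "norm x \<le> a" for x
    proof -
      have "(norm x)\<^sup>2 \<le> a\<^sup>2" using that by (simp add: power_mono)
      then show ?thesis
        using pos[of "(norm x)\<^sup>2"] by (simp add: \<kappa>_def flat_eq_0)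
    qed
    show "\<kappa> x = 0" if "b \<le> norm x" for x
    proof -
      have "b\<^sup>2 \<le> (norm x)\<^sup>2" using that assms by (simp add: power_mono)
      then show ?thesis by (simp add: \<kappa>_def flat_eq_0)
    qed
  qed
qed

lemma esm_Cc_inf:
  fixes f :: "'a::euclidean_space \<Rightarrow> real"
  assumes "esm f" "\<And>x. b \<le> norm x \<Longrightarrow> f x = 0"
  shows "Cc_inf f"
  unfolding Cc_inf_def
  using assms by (auto intro!: esm_imp_smooth_fun exI[of _ "cball 0 b"])

section \<open>Radial solutions of the adjoint elliptic equation\<close>

text \<open>For r > 0 this is the integral of \<open>\<rho> ^ m * g \<rho>\<close> over [0, r]
  divided by \<open>r ^ (m + 1)\<close>. The rescaled form has no singularity at r = 0 and keeps
  continuity on the whole line.\<close>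

definition avg :: "nat \<Rightarrow> (real \<Rightarrow> real) \<Rightarrow> real \<Rightarrow> real" where
  "avg m g r = integral {0..1} (\<lambda>\<tau>. \<tau> ^ m * g (r * \<tau>))"

lemma avg_integrable:
  assumes "continuous_on UNIV g"
  shows "(\<lambda>\<tau>. \<tau> ^ m * g (r * \<tau>)) integrable_on {0..1::real}"
  by (intro integrable_continuous_real continuous_intros continuous_on_compose2[OF assms]) auto

lemma continuous_on_avg:
  assumes "continuous_on UNIV g"
  shows "continuous_on UNIV (avg m g)"
proof -
  have "continuous_on UNIV (\<lambda>r. integral (cbox 0 1) (\<lambda>\<tau>. \<tau> ^ m * g (r * \<tau>)))"
    by (rule integral_continuous_on_param)
      (auto simp: split_beta intro!: continuous_intros continuous_on_compose2[OF assms])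
  then show ?thesis by (simp add: avg_def[abs_def])
qed

lemma avg_diff:
  assumes "continuous_on UNIV f" "continuous_on UNIV g"
  shows "avg m (\<lambda>x. f x - g x) r = avg m f r - avg m g r"
  unfolding avg_def right_diff_distrib
  by (intro integral_diff avg_integrable assms)

lemma avg_sum:
  assumes "\<And>i. i \<in> I \<Longrightarrow> continuous_on UNIV (f i)" "finite I"
  shows "avg m (\<lambda>x. \<Sum>i\<in>I. f i x) r = (\<Sum>i\<in>I. avg m (f i) r)"
  unfolding avg_def using assms
  by (subst integral_sum[symmetric]) (auto intro: avg_integrable simp: sum_distrib_left)

lemma avg_cmult: "avg m (\<lambda>x. c * f x) r = c * avg m f r"
  unfolding avg_def by (subst integral_mult_right[symmetric]) (simp add: algebra_simps)

lemma avg_power: "avg m (\<lambda>x. x ^ j) r = r ^ j / real (m + j + 1)"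
proof -
  have "((\<lambda>\<tau>. \<tau> ^ (m + j)) has_integral (1 ^ Suc (m + j) / real (Suc (m + j)) - 0 ^ Suc (m + j) / real (Suc (m + j)))) {0..1::real}"
  proof (rule fundamental_theorem_of_calculus)
    fix x :: real
    have "((\<lambda>x. x ^ Suc (m + j) / real (Suc (m + j))) has_real_derivative
        real (Suc (m + j)) * x ^ (m + j) / real (Suc (m + j))) (at x within {0..1})"
      by (rule DERIV_cdivide) (use DERIV_pow[of "Suc (m + j)" x] in \<open>simp del: of_nat_Suc power_Suc\<close>)
    then show "((\<lambda>x. x ^ Suc (m + j) / real (Suc (m + j))) has_vector_derivative x ^ (m + j)) (at x within {0..1})"
      by (simp add: has_real_derivative_iff_has_vector_derivative del: of_nat_Suc)
  qed simp
  from has_integral_mult_right[OF this, of "r ^ j"]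
  show ?thesis
    unfolding avg_def by (intro integral_unique) (simp add: power_mult_distrib power_add mult_ac)
qed

lemma avg_abs_le:
  assumes "continuous_on UNIV f" "continuous_on UNIV g"
    and "\<And>\<tau>. 0 \<le> \<tau> \<Longrightarrow> \<tau> \<le> 1 \<Longrightarrow> \<bar>f (r * \<tau>)\<bar> \<le> g (r * \<tau>)"
  shows "\<bar>avg m f r\<bar> \<le> avg m g r"
  unfolding avg_def real_norm_def[symmetric] using assms
  by (intro integral_norm_bound_integral avg_integrable) (auto simp: abs_mult intro!: mult_left_mono)

lemma avg_nonneg:
  assumes "continuous_on UNIV f" "\<And>\<tau>. 0 \<le> \<tau> \<Longrightarrow> \<tau> \<le> 1 \<Longrightarrow> 0 \<le> f (r * \<tau>)"
  shows "0 \<le> avg m f r"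
  unfolding avg_def using assms
  by (intro integral_nonneg avg_integrable) auto

lemma avg_abs_le_const:
  assumes "continuous_on UNIV f" "\<And>x. \<bar>x\<bar> \<le> L \<Longrightarrow> \<bar>f x\<bar> \<le> e" "\<bar>r\<bar> \<le> L"
  shows "\<bar>avg m f r\<bar> \<le> e"
proof -
  have le: "\<bar>r * \<tau>\<bar> \<le> L" if "0 \<le> \<tau>" "\<tau> \<le> 1" for \<tau>
    using that assms(3) mult_left_le[of \<tau> "\<bar>r\<bar>"] by (simp add: abs_mult)
  have "0 \<le> e" using assms(2)[of r] assms(3) by linarith
  have "\<bar>avg m f r\<bar> \<le> avg m (\<lambda>_. e) r"
    using assms(2) le by (intro avg_abs_le assms) auto
  also have "\<dots> = e / real (m + 1)"
    using avg_cmult[of m e "\<lambda>x. x ^ 0" r] avg_power[of m 0 r] by simp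
  also have "\<dots> \<le> e"
    using \<open>0 \<le> e\<close> by (simp add: field_simps)
  finally show ?thesis .
qed

lemma avg_eq_integral:
  assumes "r > 0"
  shows "r ^ Suc m * avg m g r = integral {0..r} (\<lambda>\<rho>. \<rho> ^ m * g \<rho>)"
proof -
  have im: "(\<lambda>x. x / r) ` {0..r} = {0..1}"
    using assms by (auto simp: image_iff field_simps intro!: bexI[of _ "_ * r"])
  have "r ^ m * avg m g r = integral {0..1} (\<lambda>\<tau>. (r * \<tau>) ^ m * g (r * \<tau>))"
    unfolding avg_def by (subst integral_mult_right[symmetric]) (simp add: algebra_simps power_mult_distrib)
  also have "\<dots> = 1 / \<bar>r\<bar> * integral {0..r} (\<lambda>\<rho>. \<rho> ^ m * g \<rho>)"
    using integral_stretch_real[of r 0 r "\<lambda>\<rho>. \<rho> ^ m * g \<rho>"] assms im by simp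
  finally show ?thesis using assms by (simp add: field_simps)
qed

lemma DERIV_avg:
  assumes "continuous_on UNIV g" "r > 0"
  shows "((\<lambda>r. r ^ Suc m * avg m g r) has_real_derivative r ^ m * g r) (at r)"
proof -
  have "((\<lambda>u. integral {0..u} (\<lambda>\<rho>. \<rho> ^ m * g \<rho>)) has_real_derivative r ^ m * g r) (at r within {0..r + 1})"
    by (rule integral_has_real_derivative)
      (use assms in \<open>auto intro!: continuous_intros continuous_on_subset[OF assms(1)]\<close>)
  then have "((\<lambda>u. integral {0..u} (\<lambda>\<rho>. \<rho> ^ m * g \<rho>)) has_real_derivative r ^ m * g r) (at r)"
    using at_within_interior[of r "{0..r + 1}"] assms(2) by (simp add: interior_atLeastAtMost_real)
  then show ?thesis
    by (rule has_field_derivative_transform_within_open[where S = "{0<..}"])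
      (use assms avg_eq_integral in auto)
qed

text \<open>For r > 0 and n > 0 this is the iterated integral of
  \<open>\<rho> ^ (n - 1) * a \<rho> * g \<rho>\<close>, then of the result divided by
  \<open>\<rho> ^ (n - 1)\<close>: the solution f of f'' + (n - 1) f' / r = a g with f(0) = f'(0) =
  0. A fixed point of \<open>1 + volterra n a \<phi>\<close> is thus the radial solution of
  \<Delta>\<phi> = a \<phi> with value 1 at the origin, stated without second derivatives.\<close>

definition volterra :: "nat \<Rightarrow> (real \<Rightarrow> real) \<Rightarrow> (real \<Rightarrow> real) \<Rightarrow> real \<Rightarrow> real" where
  "volterra n a g r = r\<^sup>2 * avg 1 (avg (n - 1) (\<lambda>\<rho>. a \<rho> * g \<rho>)) r"

lemma continuous_on_volterra:
  assumes "continuous_on UNIV a" "continuous_on UNIV g"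
  shows "continuous_on UNIV (volterra n a g)"
proof -
  have "continuous_on UNIV (avg 1 (avg (n - 1) (\<lambda>\<rho>. a \<rho> * g \<rho>)))"
    by (intro continuous_on_avg continuous_intros assms)
  then show ?thesis
    by (auto simp: volterra_def[abs_def] intro!: continuous_intros)
qed

text \<open>Picard iteration: \<phi> is the sum of the iterates of the operator on the constant 1.
  All terms are nonnegative, so the first one alone gives the lower bound 1, and a factorial
  estimate makes the series converge uniformly on bounded intervals.\<close>

lemma volterra_solution:
  assumes a: "continuous_on UNIV a" "\<And>r. 0 \<le> a r"
  obtains \<phi> where "continuous_on UNIV \<phi>" "\<And>r. 1 \<le> \<phi> r" "\<And>r. \<phi> r = 1 + volterra n a \<phi> r"
proof -
  define f where "f = rec_nat (\<lambda>_. 1) (\<lambda>_. volterra n a)"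
  have f0: "f 0 = (\<lambda>_. 1)" and fS: "f (Suc j) = volterra n a (f j)" for j
    by (simp_all add: f_def)
  have cf: "continuous_on UNIV (f j)" for j
    by (induction j) (auto simp: f0 fS intro: continuous_on_volterra a)
  have f_nonneg: "0 \<le> f j r" for j r
  proof (induction j arbitrary: r)
    case (Suc j)
    then show ?case
      unfolding fS volterra_def
      by (intro mult_nonneg_nonneg avg_nonneg continuous_on_avg continuous_intros a cf) auto
  qed (simp add: f0)
  \<comment> \<open>The outer average of a power of degree 2j contributes 1 / (2j + 2), weakened to
    1 / (j + 1), and this builds the factorial. The denominator produced by the inner average is
    discarded.\<close>
  have f_le: "f j r \<le> (K * r\<^sup>2) ^ j / fact j"
    if K: "\<And>x. \<bar>x\<bar> \<le> L \<Longrightarrow> a x \<le> K" and "\<bar>r\<bar> \<le> L" for j r K L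
    using that(2)
  proof (induction j arbitrary: r)
    case (Suc j)
    have K0: "0 \<le> K" using K[of r] a(2)[of r] Suc.prems by linarith
    have le: "\<bar>r * \<tau>\<bar> \<le> L" if "0 \<le> \<tau>" "\<tau> \<le> 1" "\<bar>r\<bar> \<le> L" for \<tau> r
      using that mult_left_le[of \<tau> "\<bar>r\<bar>"] by (simp add: abs_mult)
    let ?c = "K ^ Suc j / fact j"
    have le1: "\<bar>avg (n - 1) (\<lambda>\<rho>. a \<rho> * f j \<rho>) r\<bar> \<le> ?c * r ^ (2 * j)" if "\<bar>r\<bar> \<le> L" for r
    proof -
      have "\<bar>avg (n - 1) (\<lambda>\<rho>. a \<rho> * f j \<rho>) r\<bar> \<le> avg (n - 1) (\<lambda>\<rho>. ?c * \<rho> ^ (2 * j)) r"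
      proof (rule avg_abs_le)
        fix \<tau> :: real assume "0 \<le> \<tau>" "\<tau> \<le> 1"
        then have l: "\<bar>r * \<tau>\<bar> \<le> L" using le that by blast
        have "a (r * \<tau>) * f j (r * \<tau>) \<le> K * ((K * (r * \<tau>)\<^sup>2) ^ j / fact j)"
          by (intro mult_mono K Suc.IH l K0 f_nonneg)
        also have "\<dots> = ?c * (r * \<tau>) ^ (2 * j)"
          by (simp add: power_mult_distrib flip: power_mult)
        finally show "\<bar>a (r * \<tau>) * f j (r * \<tau>)\<bar> \<le> ?c * (r * \<tau>) ^ (2 * j)"
          using a(2) f_nonneg by (simp add: abs_mult)
      qed (intro continuous_intros a cf)+
      also have "\<dots> = ?c * r ^ (2 * j) / real (n - 1 + 2 * j + 1)"
        by (simp only: avg_cmult avg_power) simp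
      also have "\<dots> \<le> ?c * r ^ (2 * j)"
        using divide_left_mono[of 1 "real (n - 1 + 2 * j + 1)" "?c * r ^ (2 * j)"] K0
        by (simp add: zero_le_even_power)
      finally show ?thesis .
    qed
    have "f (Suc j) r \<le> r\<^sup>2 * avg 1 (\<lambda>\<rho>. ?c * \<rho> ^ (2 * j)) r"
      unfolding fS volterra_def
    proof (intro mult_left_mono order_trans[OF abs_ge_self avg_abs_le])
      fix \<tau> :: real assume "0 \<le> \<tau>" "\<tau> \<le> 1"
      then show "\<bar>avg (n - 1) (\<lambda>\<rho>. a \<rho> * f j \<rho>) (r * \<tau>)\<bar> \<le> ?c * (r * \<tau>) ^ (2 * j)"
        using le1 le Suc.prems by blast
    qed (auto intro!: continuous_on_avg continuous_intros a cf)
    also have "\<dots> = r\<^sup>2 * (?c * r ^ (2 * j)) / real (2 * j + 2)"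
      by (simp only: avg_cmult avg_power) simp
    also have "\<dots> \<le> r\<^sup>2 * (?c * r ^ (2 * j)) / real (j + 1)"
      using K0 by (intro divide_left_mono mult_nonneg_nonneg) auto
    also have "\<dots> = (K * r\<^sup>2) ^ Suc j / fact (Suc j)"
      by (simp add: power_mult_distrib field_simps flip: power_mult)
    finally show ?case .
  qed (simp add: f0)
  have bdd: "\<exists>K. \<forall>x. \<bar>x\<bar> \<le> L \<longrightarrow> a x \<le> K" for L
  proof -
    have "compact (a ` {-L..L})"
      by (intro compact_continuous_image continuous_on_subset[OF a(1)]) auto
    then obtain K where "\<forall>y\<in>a ` {-L..L}. norm y \<le> K"
      using compact_imp_bounded bounded_iff by blast
    then show ?thesis
      by (intro exI[of _ K]) (auto simp: abs_le_iff)
  qed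
  define \<phi> where "\<phi> = (\<lambda>r. \<Sum>j. f j r)"
  define S where "S = (\<lambda>N r. \<Sum>j<N. f j r)"
  have unif: "uniform_limit {-L..L} S \<phi> sequentially" for L
  proof -
    obtain K where K: "\<And>x. \<bar>x\<bar> \<le> L \<Longrightarrow> a x \<le> K" using bdd by blast
    show ?thesis
      unfolding S_def \<phi>_def
    proof (rule Weierstrass_m_test[where M = "\<lambda>j. (K * L\<^sup>2) ^ j / fact j"])
      show "summable (\<lambda>j. (K * L\<^sup>2) ^ j / fact j)"
        using summable_exp[of "K * L\<^sup>2"] by (simp add: divide_inverse mult_ac)
      fix j r assume r: "r \<in> {-L..L}"
      then have rL: "\<bar>r\<bar> \<le> L" by auto
      have K0: "0 \<le> K" using K[of r] a(2)[of r] rL by linarith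
      have "f j r \<le> (K * r\<^sup>2) ^ j / fact j"
        using K rL by (rule f_le)
      also have "\<dots> \<le> (K * L\<^sup>2) ^ j / fact j"
      proof (intro divide_right_mono power_mono[of "K * r\<^sup>2"] mult_left_mono)
        show "r\<^sup>2 \<le> L\<^sup>2" using rL by (simp flip: abs_le_square_iff)
      qed (use K0 in auto)
      finally show "norm (f j r) \<le> (K * L\<^sup>2) ^ j / fact j"
        using f_nonneg by simp
    qed
  qed
  have cS: "continuous_on UNIV (S N)" for N
    unfolding S_def by (intro continuous_intros cf)
  have c\<phi>: "continuous_on UNIV \<phi>"
  proof -
    have "isCont \<phi> r" for r
    proof -
      have "continuous_on {-(\<bar>r\<bar> + 1)..\<bar>r\<bar> + 1} \<phi>"
        by (rule uniform_limit_theorem[OF _ unif])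
          (auto intro!: always_eventually continuous_on_subset[OF cS])
      moreover have "r \<in> interior {-(\<bar>r\<bar> + 1)..\<bar>r\<bar> + 1}"
        by (auto simp: interior_atLeastAtMost_real)
      ultimately show ?thesis
        using continuous_on_interior by blast
    qed
    then show ?thesis by (simp add: continuous_at_imp_continuous_on)
  qed
  have lim: "(\<lambda>N. S N r) \<longlonglongrightarrow> \<phi> r" for r
    by (rule tendsto_uniform_limitI[OF unif[of "\<bar>r\<bar>"]]) (auto simp: abs_real_def)
  have S_Suc: "S (Suc N) r = 1 + volterra n a (S N) r" for N r
  proof -
    have "avg (n - 1) (\<lambda>\<rho>. a \<rho> * S N \<rho>) = (\<lambda>x. \<Sum>j<N. avg (n - 1) (\<lambda>\<rho>. a \<rho> * f j \<rho>) x)"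
      unfolding S_def sum_distrib_left
      by (intro ext avg_sum) (auto intro!: continuous_intros a cf)
    then have "avg 1 (avg (n - 1) (\<lambda>\<rho>. a \<rho> * S N \<rho>)) r = (\<Sum>j<N. avg 1 (avg (n - 1) (\<lambda>\<rho>. a \<rho> * f j \<rho>)) r)"
      by (simp only:) (intro avg_sum, auto intro!: continuous_on_avg continuous_intros a cf)
    then have "volterra n a (S N) r = (\<Sum>j<N. f (Suc j) r)"
      by (simp add: volterra_def fS sum_distrib_left)
    then show ?thesis
      unfolding S_def by (subst sum.lessThan_Suc_shift) (simp add: f0)
  qed
  have fix_eq: "\<phi> r = 1 + volterra n a \<phi> r" for r
  proof -
    have "(\<lambda>N. volterra n a (S N) r) \<longlonglongrightarrow> volterra n a \<phi> r"
    proof (rule LIMSEQ_I)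
      fix e :: real assume "0 < e"
      obtain K where K: "\<And>x. \<bar>x\<bar> \<le> \<bar>r\<bar> \<Longrightarrow> a x \<le> K" using bdd by blast
      have K0: "0 \<le> K" using K[of r] a(2)[of r] by simp
      \<comment> \<open>The operator amplifies a uniform error \<open>d\<close> by at most
        \<open>r\<^sup>2 * K\<close>; the additional 1 keeps the denominator positive and the final
        inequality strict.\<close>
      define d where "d = e / (r\<^sup>2 * K + 1)"
      have "0 < d"
        unfolding d_def using \<open>0 < e\<close> K0 by (intro divide_pos_pos add_nonneg_pos) auto
      then obtain N0 where N0: "\<And>N x. N \<ge> N0 \<Longrightarrow> x \<in> {-\<bar>r\<bar>..\<bar>r\<bar>} \<Longrightarrow> dist (S N x) (\<phi> x) < d"
        using uniform_limitD[OF unif[of "\<bar>r\<bar>"]] unfolding eventually_sequentially by blast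
      have "norm (volterra n a (S N) r - volterra n a \<phi> r) < e" if "N \<ge> N0" for N
      proof -
        have c1: "continuous_on UNIV (\<lambda>\<rho>. a \<rho> * S N \<rho>)" "continuous_on UNIV (\<lambda>\<rho>. a \<rho> * \<phi> \<rho>)"
          by (intro continuous_intros a cS c\<phi>)+
        have eq: "volterra n a (S N) r - volterra n a \<phi> r = r\<^sup>2 * avg 1 (avg (n - 1) (\<lambda>\<rho>. a \<rho> * S N \<rho> - a \<rho> * \<phi> \<rho>)) r"
        proof -
          have "avg (n - 1) (\<lambda>\<rho>. a \<rho> * S N \<rho> - a \<rho> * \<phi> \<rho>) =
              (\<lambda>x. avg (n - 1) (\<lambda>\<rho>. a \<rho> * S N \<rho>) x - avg (n - 1) (\<lambda>\<rho>. a \<rho> * \<phi> \<rho>) x)"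
            by (intro ext avg_diff c1)
          then show ?thesis
            unfolding volterra_def right_diff_distrib[symmetric]
            by (simp only: avg_diff[OF continuous_on_avg[OF c1(1)] continuous_on_avg[OF c1(2)]])
        qed
        have "\<bar>avg 1 (avg (n - 1) (\<lambda>\<rho>. a \<rho> * S N \<rho> - a \<rho> * \<phi> \<rho>)) r\<bar> \<le> K * d"
        proof (intro avg_abs_le_const continuous_on_avg continuous_on_diff c1)
          fix x :: real assume "\<bar>x\<bar> \<le> \<bar>r\<bar>"
          then have "\<bar>S N x - \<phi> x\<bar> \<le> d" "a x \<le> K"
            using N0[OF that, of x] K by (auto simp: dist_real_def abs_le_iff)
          then have "\<bar>a x\<bar> * \<bar>S N x - \<phi> x\<bar> \<le> K * d"
            using a(2)[of x] K0 by (intro mult_mono) auto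
          then show "\<bar>a x * S N x - a x * \<phi> x\<bar> \<le> K * d"
            by (simp add: abs_mult flip: right_diff_distrib)
        qed auto
        then have "\<bar>volterra n a (S N) r - volterra n a \<phi> r\<bar> \<le> r\<^sup>2 * (K * d)"
          unfolding eq abs_mult by (intro mult_mono) auto
        also have "\<dots> < (r\<^sup>2 * K + 1) * d"
          using \<open>0 < d\<close> by (simp add: algebra_simps)
        also have "\<dots> = e"
          unfolding d_def using K0 by (simp add: add_nonneg_pos less_imp_neq[symmetric])
        finally show ?thesis by simp
      qed
      then show "\<exists>N0. \<forall>N\<ge>N0. norm (volterra n a (S N) r - volterra n a \<phi> r) < e" by blast
    qed
    then have "(\<lambda>N. S (Suc N) r) \<longlonglongrightarrow> 1 + volterra n a \<phi> r"
      unfolding S_Suc by (intro tendsto_intros)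
    with LIMSEQ_Suc[OF lim] show ?thesis
      by (rule LIMSEQ_unique)
  qed
  have "1 \<le> \<phi> r" for r
  proof -
    have "1 \<le> S (Suc N) r" for N
      unfolding S_def by (subst sum.lessThan_Suc_shift) (simp add: f0 sum_nonneg f_nonneg)
    then show ?thesis
      using LIMSEQ_Suc[OF lim, of r] by (intro LIMSEQ_le_const) auto
  qed
  with c\<phi> fix_eq show ?thesis using that by blast
qed

text \<open>Multiplication by \<open>r powr s\<close> with s = (n - 1) / 2 removes the first-order
  term: g = r^s \<phi> satisfies g'' = (a + s (s - 1) / r^2) g. As a - 1 decays like
  \<open>r powr (- \<gamma>)\<close> with \<gamma> > 1, this is an integrable perturbation of g'' =
  g, so g is comparable to exp r. The dimension gives s \<ge> 1 and hence a nonnegative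
  perturbation, and \<gamma> \<le> 2 lets the inverse square be absorbed.\<close>

lemma volterra_bounds:
  fixes a \<phi> :: "real \<Rightarrow> real" and n :: nat and K \<gamma> :: real
  assumes n: "n \<ge> 3"
    and a: "continuous_on UNIV a" "\<And>r. 1 \<le> a r"
    and \<gamma>: "1 < \<gamma>" "\<gamma> \<le> 2" and K: "0 \<le> K" "\<And>r. 1 \<le> r \<Longrightarrow> a r \<le> 1 + K * r powr (- \<gamma>)"
    and \<phi>: "continuous_on UNIV \<phi>" "\<And>r. 1 \<le> \<phi> r" "\<And>r. \<phi> r = 1 + volterra n a \<phi> r"
  shows "\<exists>c>0. \<exists>C>0. \<forall>r\<ge>0. c * ((1 + r) powr (- ((real n - 1) / 2)) * exp r) \<le> \<phi> r \<and>
            \<phi> r \<le> C * ((1 + r) powr (- ((real n - 1) / 2)) * exp r)"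
proof -
  define s where "s = (real n - 1) / 2"
  have s1: "1 \<le> s" using n by (simp add: s_def)
  \<comment> \<open>The derivative of \<phi> is \<open>r * M r\<close>, so the second-order equation
    becomes a first-order system for \<phi> and \<open>M\<close>.\<close>
  define M where "M = avg (n - 1) (\<lambda>\<rho>. a \<rho> * \<phi> \<rho>)"
  have ca: "continuous_on UNIV (\<lambda>\<rho>. a \<rho> * \<phi> \<rho>)" by (intro continuous_intros a \<phi>)
  have cM: "continuous_on UNIV M" unfolding M_def by (intro continuous_on_avg ca)
  have a0: "0 \<le> a r" "0 \<le> \<phi> r" "0 < \<phi> r" for r using a(2)[of r] \<phi>(2)[of r] by auto
  have M0: "0 \<le> M r" for r
    unfolding M_def by (intro avg_nonneg ca) (auto simp: a0)
  have dphi: "(\<phi> has_real_derivative r * M r) (at r)" if "0 < r" for r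
  proof -
    have "\<phi> = (\<lambda>r. 1 + r ^ Suc 1 * avg 1 M r)"
      by (rule ext, subst \<phi>(3)) (simp add: volterra_def M_def power2_eq_square)
    then show ?thesis
      using DERIV_add[OF DERIV_const[of 1] DERIV_avg[OF cM that, of 1]] by simp
  qed
  have dM: "(M has_real_derivative (a r * \<phi> r - real n * M r) / r) (at r)" if "0 < r" for r
  proof -
    have nn: "Suc (n - 1) = n" "n - 1 + 1 = n" using n by auto
    have d: "((\<lambda>r. r ^ n * M r) has_real_derivative r ^ (n - 1) * (a r * \<phi> r)) (at r)"
      using DERIV_avg[OF ca that, of "n - 1"] unfolding nn M_def by simp
    have "((\<lambda>r. (r ^ n * M r) / r ^ n) has_real_derivative
       (r ^ (n - 1) * (a r * \<phi> r) * r ^ n - (r ^ n * M r) * (real n * r ^ (n - 1))) / (r ^ n * r ^ n)) (at r)"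
      by (rule DERIV_divide[OF d]) (use that in \<open>auto intro!: derivative_eq_intros\<close>)
    also have "(r ^ (n - 1) * (a r * \<phi> r) * r ^ n - (r ^ n * M r) * (real n * r ^ (n - 1))) / (r ^ n * r ^ n)
       = (a r * \<phi> r - real n * M r) / r"
    proof -
      have "r ^ n = r * r ^ (n - 1)" using n by (cases n) auto
      then show ?thesis using that by (simp add: field_simps)
    qed
    finally show ?thesis
      by (rule has_field_derivative_transform_within_open[where S = "{0<..}"]) (use that in auto)
  qed
  define g where "g = (\<lambda>r. r powr s * \<phi> r)"
  define h where "h = (\<lambda>r. s * r powr (s - 1) * \<phi> r + r powr (s + 1) * M r)"
  have dg: "(g has_real_derivative h r) (at r)" if "0 < r" for r
  proof -
    have "(g has_real_derivative s * r powr (s - 1) * \<phi> r + r * M r * r powr s) (at r)"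
      unfolding g_def using DERIV_mult[OF has_real_derivative_powr[OF that, of s] dphi[OF that]] by simp
    then show ?thesis using that by (simp add: h_def powr_add mult_ac)
  qed
  have dh: "(h has_real_derivative (a r + s * (s - 1) * r powr (-2)) * g r) (at r)" if "0 < r" for r
  proof -
    have "(h has_real_derivative (s * ((s - 1) * r powr (s - 1 - 1))) * \<phi> r + r * M r * (s * r powr (s - 1))
        + ((s + 1) * r powr (s + 1 - 1) * M r + (a r * \<phi> r - real n * M r) / r * r powr (s + 1))) (at r)"
      unfolding h_def
      by (intro DERIV_add DERIV_mult DERIV_cmult has_real_derivative_powr dphi dM that)
    moreover have "(s * ((s - 1) * r powr (s - 1 - 1))) * \<phi> r + r * M r * (s * r powr (s - 1))
        + ((s + 1) * r powr (s + 1 - 1) * M r + (a r * \<phi> r - real n * M r) / r * r powr (s + 1))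
        = (a r + s * (s - 1) * r powr (-2)) * g r"
    proof -
      have p1: "r powr (s - 1 - 1) = r powr (-2) * r powr s" by (simp add: powr_add[symmetric])
      have p2: "r powr (s - 1) = r powr s / r" using that by (simp add: powr_diff)
      have p3: "r powr (s + 1) = r powr s * r" using that by (simp add: powr_add)
      have nS: "real n = 2 * s + 1" by (simp add: s_def field_simps)
      show ?thesis
        unfolding g_def p1 p2 p3 nS using that by (simp add: field_simps)
    qed
    ultimately show ?thesis by simp
  qed
  have g_pos: "0 < g r" if "0 < r" for r using that a0 by (simp add: g_def)
  have h_nonneg: "0 \<le> h r" if "0 < r" for r
    unfolding h_def using that a0[of r] M0[of r] s1 by (intro add_nonneg_nonneg mult_nonneg_nonneg) auto
  define z where "z = (\<lambda>r. g r + h r)"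
  have dz: "(z has_real_derivative z r + (a r - 1 + s * (s - 1) * r powr (-2)) * g r) (at r)" if "0 < r" for r
    unfolding z_def using DERIV_add[OF dg[OF that] dh[OF that]] by (simp add: algebra_simps)
  have z1: "0 < z 1" using g_pos[of 1] h_nonneg[of 1] by (simp add: z_def)
  define K1 where "K1 = K + s * (s - 1)"
  have K1: "0 \<le> K1" using K s1 by (simp add: K1_def)
  \<comment> \<open>Chosen so that \<open>k * r powr (1 - \<gamma>)\<close> has derivative
    \<open>- K1 * r powr (- \<gamma>)\<close>. The function \<open>E\<close> in the next bound is
    then the integrating factor that makes \<open>z * E\<close> nonincreasing.\<close>
  define k where "k = K1 / (\<gamma> - 1)"
  have k0: "0 \<le> k" using K1 \<gamma> by (simp add: k_def)

  \<comment> \<open>Upper bound: \<open>z = g + g'\<close> satisfies \<open>z' \<le> (1 + K1 * r powr (- \<gamma>)) * z\<close>, an integrable perturbation of \<open>z' = z\<close>.\<close>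
  have upper: "g r \<le> z 1 * exp (k - 1) * exp r" if r: "1 \<le> r" for r
  proof -
    define E where "E = (\<lambda>r. exp (k * r powr (1 - \<gamma>) - r))"
    have "z r * E r \<le> z 1 * E 1"
    proof (rule DERIV_nonpos_imp_nonincreasing[OF r])
      fix x :: real assume x: "1 \<le> x" "x \<le> r"
      then have x0: "0 < x" by simp
      have "((\<lambda>r. k * r powr (1 - \<gamma>) - r) has_real_derivative k * ((1 - \<gamma>) * x powr (1 - \<gamma> - 1)) - 1) (at x)"
        by (intro DERIV_diff DERIV_cmult has_real_derivative_powr x0 DERIV_ident)
      moreover have "k * ((1 - \<gamma>) * x powr (1 - \<gamma> - 1)) - 1 = - K1 * x powr (- \<gamma>) - 1"
        using \<gamma> by (simp add: k_def field_simps)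
      ultimately have dE: "(E has_real_derivative E x * (- K1 * x powr (- \<gamma>) - 1)) (at x)"
        unfolding E_def by (auto intro: DERIV_fun_exp)
      have "x powr (-2) \<le> x powr (- \<gamma>)" using x \<gamma> by (intro powr_mono) auto
      then have "a x - 1 + s * (s - 1) * x powr (-2) \<le> K * x powr (- \<gamma>) + s * (s - 1) * x powr (- \<gamma>)"
        using K(2)[of x] x s1 by (intro add_mono mult_left_mono) auto
      also have "\<dots> = K1 * x powr (- \<gamma>)" by (simp add: K1_def algebra_simps)
      finally have le: "a x - 1 + s * (s - 1) * x powr (-2) \<le> K1 * x powr (- \<gamma>)" .
      have "(a x - 1 + s * (s - 1) * x powr (-2)) * g x \<le> (K1 * x powr (- \<gamma>)) * z x"
        using le g_pos[OF x0] h_nonneg[OF x0] K1 by (intro mult_mono) (auto simp: z_def)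
      then have "E x * (z x + (a x - 1 + s * (s - 1) * x powr (-2)) * g x - z x - (K1 * x powr (- \<gamma>)) * z x) \<le> 0"
        by (intro mult_nonneg_nonpos) (auto simp: E_def)
      then have "(z x + (a x - 1 + s * (s - 1) * x powr (-2)) * g x) * E x + E x * (- K1 * x powr (- \<gamma>) - 1) * z x \<le> 0"
        by (simp add: algebra_simps)
      then show "\<exists>y. ((\<lambda>r. z r * E r) has_real_derivative y) (at x) \<and> y \<le> 0"
        using DERIV_mult[OF dz[OF x0] dE] by (intro exI conjI) auto
    qed
    then have "z r \<le> z 1 * E 1 / E r" by (simp add: E_def field_simps)
    also have "\<dots> = z 1 * exp (k - 1 - k * r powr (1 - \<gamma>)) * exp r"
      by (simp add: E_def exp_diff[symmetric] exp_add[symmetric] mult.assoc flip: times_divide_eq_right)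
    also have "\<dots> \<le> z 1 * exp (k - 1) * exp r"
      using z1 k0 by (intro mult_right_mono mult_left_mono) auto
    finally show ?thesis using h_nonneg[of r] r by (simp add: z_def)
  qed
  \<comment> \<open>For the lower bound, z' \<ge> z makes \<open>z\<close> grow like exp r, and the
    derivative of \<open>g r * exp r\<close> is \<open>z r * exp r\<close>. Integrating exp (2 r)
    costs the factor 2 in \<open>z 1 / 2\<close>, while \<open>g 1\<close> starts the comparison at
    r = 1.\<close>
  define m where "m = min (g 1) (z 1 / 2)"
  have m0: "0 < m" using z1 g_pos[of 1] by (simp add: m_def)
  have z_ge: "2 * m * exp (r - 1) \<le> z r" if r: "1 \<le> r" for r
  proof -
    have "z 1 * exp (- 1) \<le> z r * exp (- r)"
    proof (rule DERIV_nonneg_imp_nondecreasing[OF r])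
      fix x :: real assume x: "1 \<le> x" "x \<le> r"
      then have x0: "0 < x" by simp
      have "((\<lambda>r. exp (- r)) has_real_derivative exp (- x) * - 1) (at x)"
        by (intro DERIV_fun_exp derivative_eq_intros) auto
      from DERIV_mult[OF dz[OF x0] this]
      have "((\<lambda>r. z r * exp (- r)) has_real_derivative (a x - 1 + s * (s - 1) * x powr (-2)) * g x * exp (- x)) (at x)"
        by (simp add: algebra_simps)
      moreover have "0 \<le> (a x - 1 + s * (s - 1) * x powr (-2)) * g x * exp (- x)"
        using a(2)[of x] s1 g_pos[OF x0] by (intro mult_nonneg_nonneg add_nonneg_nonneg) auto
      ultimately show "\<exists>y. ((\<lambda>r. z r * exp (- r)) has_real_derivative y) (at x) \<and> y \<ge> 0" by blast
    qed
    then have "z 1 * exp (r - 1) \<le> z r"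
      by (simp add: exp_diff exp_minus field_simps)
    moreover have "2 * m * exp (r - 1) \<le> z 1 * exp (r - 1)"
      by (intro mult_right_mono) (auto simp: m_def)
    ultimately show ?thesis by linarith
  qed
  have lower: "m * exp (r - 1) \<le> g r" if r: "1 \<le> r" for r
  proof -
    have "g 1 * exp 1 - m * exp (2 * 1 - 1) \<le> g r * exp r - m * exp (2 * r - 1)"
    proof (rule DERIV_nonneg_imp_nondecreasing[OF r])
      fix x :: real assume x: "1 \<le> x" "x \<le> r"
      then have x0: "0 < x" by simp
      have "((\<lambda>r. m * exp (2 * r - 1)) has_real_derivative m * (exp (2 * x - 1) * 2)) (at x)"
        by (intro DERIV_cmult DERIV_fun_exp) (auto intro!: derivative_eq_intros)
      from DERIV_diff[OF DERIV_mult[OF dg[OF x0] DERIV_exp] this]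
      have "((\<lambda>r. g r * exp r - m * exp (2 * r - 1)) has_real_derivative
          z x * exp x - m * (exp (2 * x - 1) * 2)) (at x)"
        by (simp add: z_def algebra_simps)
      moreover have "(2 * m * exp (x - 1)) * exp x \<le> z x * exp x"
        using z_ge[OF x(1)] by (intro mult_right_mono) auto
      then have "0 \<le> z x * exp x - m * (exp (2 * x - 1) * 2)"
        by (simp add: mult_exp_exp mult.assoc)
      ultimately show "\<exists>y. ((\<lambda>r. g r * exp r - m * exp (2 * r - 1)) has_real_derivative y) (at x) \<and> y \<ge> 0"
        by blast
    qed
    moreover have "m * exp 1 \<le> g 1 * exp 1" by (intro mult_right_mono) (auto simp: m_def)
    moreover have "m * exp (2 * 1 - 1) = m * exp 1" by simp
    ultimately have "m * exp (2 * r - 1) \<le> g r * exp r" by linarith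
    then have "(m * exp (r - 1)) * exp r \<le> g r * exp r" by (simp add: mult_exp_exp mult.assoc)
    then show ?thesis by simp
  qed
  have mono: "\<phi> r \<le> \<phi> 1" if "0 \<le> r" "r \<le> 1" for r
  proof (rule DERIV_nonneg_imp_increasing_open[OF that(2)])
    fix x assume "r < x" "x < 1"
    then show "\<exists>y. DERIV \<phi> x :> y \<and> 0 \<le> y"
      using dphi[of x] M0[of x] that by (intro exI[of _ "x * M x"] conjI) auto
  qed (rule continuous_on_subset[OF \<phi>(1)], simp)
  define w where "w = (\<lambda>r::real. (1 + r) powr (- s) * exp r)"
  \<comment> \<open>Below radius 1 the comparison function is at most exp 1 and at least
    \<open>2 powr (- s)\<close>, and \<phi> lies between 1 and \<open>\<phi> 1\<close>. Beyond
    radius 1 the bounds for \<open>g\<close> apply; the factor \<open>2 powr s\<close> in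
    \<open>C\<close> also pays for replacing r by (1 + r) / 2.\<close>
  define c where "c = min (exp (- 1)) (m * exp (- 1))"
  define C where "C = 2 powr s * max (\<phi> 1) (z 1 * exp (k - 1))"
  have "0 < c" using m0 by (simp add: c_def)
  moreover have C0: "0 < C" using a0(3)[of 1] by (simp add: C_def less_max_iff_disj)
  moreover have "c * w r \<le> \<phi> r \<and> \<phi> r \<le> C * w r" if r: "0 \<le> r" for r
  proof (cases "r \<le> 1")
    case True
    have "w r \<le> 1 * exp 1"
      unfolding w_def using r True s1 powr_mono[of "- s" 0 "1 + r"] by (intro mult_mono) auto
    then have "c * w r \<le> exp (- 1) * exp 1"
      using m0 by (intro mult_mono) (auto simp: c_def w_def)
    then have "c * w r \<le> 1" by (simp add: mult_exp_exp)
    moreover have "2 powr (- s) * 1 \<le> w r"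
      unfolding w_def using r True s1 by (intro mult_mono powr_mono2') auto
    then have "C * 2 powr (- s) \<le> C * w r" using C0 by (intro mult_left_mono) auto
    then have "max (\<phi> 1) (z 1 * exp (k - 1)) \<le> C * w r"
      by (simp add: C_def powr_minus field_simps)
    ultimately show ?thesis using mono[OF r True] \<phi>(2)[of r] by linarith
  next
    case False
    then have r1: "1 \<le> r" "0 < r" by auto
    have phi_eq: "\<phi> r = r powr (- s) * g r" using r1 by (simp add: g_def powr_minus)
    have "(1 + r) powr (- s) \<le> r powr (- s)" using r1 s1 by (intro powr_mono2') auto
    then have "c * w r \<le> (m * exp (- 1)) * (r powr (- s) * exp r)"
      unfolding w_def using m0 by (intro mult_mono mult_right_mono) (auto simp: c_def)
    also have "\<dots> = r powr (- s) * (m * exp (r - 1))"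
      by (simp add: exp_diff exp_minus field_simps)
    also have "\<dots> \<le> \<phi> r" unfolding phi_eq by (intro mult_left_mono lower r1) auto
    finally have 1: "c * w r \<le> \<phi> r" .
    have "r powr (- s) \<le> ((1 + r) / 2) powr (- s)" using r1 s1 by (intro powr_mono2') auto
    also have "\<dots> = 2 powr s * (1 + r) powr (- s)" using r1 by (simp add: powr_divide powr_minus field_simps)
    finally have 2: "r powr (- s) \<le> 2 powr s * (1 + r) powr (- s)" .
    have "\<phi> r \<le> (2 powr s * (1 + r) powr (- s)) * (z 1 * exp (k - 1) * exp r)"
      unfolding phi_eq using upper[OF r1(1)] g_pos[OF r1(2)] by (intro mult_mono 2) auto
    also have "\<dots> \<le> (2 powr s * (1 + r) powr (- s)) * (max (\<phi> 1) (z 1 * exp (k - 1)) * exp r)"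
      by (intro mult_left_mono mult_right_mono) auto
    also have "\<dots> = C * w r" by (simp add: C_def w_def mult_ac)
    finally show ?thesis using 1 by simp
  qed
  ultimately show ?thesis
    unfolding w_def s_def by blast
qed

text \<open>The coefficients are merely continuous, so the radial solution is not an admissible test
  function.  Polynomials in \<open>r\<^sup>2\<close> approximate it together with its Laplacian; this uses
  \<open>\<Delta> r\<^bsup>2i+2\<^esup> = (2i + 2) (2i + n) r\<^bsup>2i\<^esup>\<close>.\<close>

lemma volterra_poly_approx:
  fixes a \<phi> :: "real \<Rightarrow> real" and n :: nat
  assumes n: "n > 0" and a: "continuous_on UNIV a"
    and \<phi>: "continuous_on UNIV \<phi>" "\<And>r. \<phi> r = 1 + volterra n a \<phi> r"
    and e: "0 < e"
  obtains c :: "nat \<Rightarrow> real" and N :: nat where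
    "\<And>r. 0 \<le> r \<Longrightarrow> r \<le> L \<Longrightarrow> \<bar>(\<Sum>i\<le>N. c i * (r\<^sup>2) ^ i) - a r * \<phi> r\<bar> \<le> e"
    "\<And>r. 0 \<le> r \<Longrightarrow> r \<le> L \<Longrightarrow> \<bar>1 + (\<Sum>i\<le>N. c i / real ((2 * i + 2) * (2 * i + n)) * (r\<^sup>2) ^ Suc i) - \<phi> r\<bar> \<le> e"
proof -
  \<comment> \<open>The Laplacian is off by \<open>d\<close> itself; the double average multiplies
    this error by at most the square of \<open>L\<close> in the function value.\<close>
  define d where "d = e / (1 + L\<^sup>2)"
  have d0: "0 < d" using e by (simp add: d_def add_pos_nonneg)
  have d1: "d \<le> e" "L\<^sup>2 * d \<le> e" using e by (auto simp: d_def field_simps add_pos_nonneg)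
  have ca: "continuous_on UNIV (\<lambda>r. a r * \<phi> r)" by (intro continuous_intros a \<phi>)
  \<comment> \<open>Approximation in the variable s = r^2 produces a polynomial in the squared norm,
    hence a smooth function of x.\<close>
  have "continuous_on {0..L\<^sup>2} (\<lambda>s. a (sqrt s) * \<phi> (sqrt s))"
    by (rule continuous_on_compose2[OF ca]) (auto intro: continuous_on_real_sqrt)
  then obtain g where "real_polynomial_function g" and g: "\<And>s. s \<in> {0..L\<^sup>2} \<Longrightarrow> \<bar>a (sqrt s) * \<phi> (sqrt s) - g s\<bar> < d"
    using Stone_Weierstrass_real_polynomial_function[OF compact_Icc _ d0] by blast
  then obtain c N where gc: "g = (\<lambda>x. \<Sum>i\<le>N. c i * x^i)"
    using real_polynomial_function_iff_sum by blast
  define G where "G = (\<lambda>r. \<Sum>i\<le>N. c i * (r\<^sup>2) ^ i)"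
  have cG: "continuous_on UNIV G" unfolding G_def by (intro continuous_intros)
  have G: "\<bar>G r - a r * \<phi> r\<bar> \<le> d" if "0 \<le> r" "r \<le> L" for r
    using g[of "r\<^sup>2"] that by (simp add: G_def gc power_mono)
  have "\<bar>1 + (\<Sum>i\<le>N. c i / real ((2 * i + 2) * (2 * i + n)) * (r\<^sup>2) ^ Suc i) - \<phi> r\<bar> \<le> e" if r: "0 \<le> r" "r \<le> L" for r
  proof -
    have avgG: "avg (n - 1) G = (\<lambda>x. \<Sum>i\<le>N. c i / real (2 * i + n) * x ^ (2 * i))"
    proof
      fix x
      have "avg (n - 1) G x = (\<Sum>i\<le>N. avg (n - 1) (\<lambda>r. c i * (r\<^sup>2) ^ i) x)"
        unfolding G_def by (intro avg_sum continuous_intros) auto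
      also have "\<dots> = (\<Sum>i\<le>N. c i / real (2 * i + n) * x ^ (2 * i))"
        using n by (intro sum.cong refl) (simp add: avg_cmult avg_power add.commute flip: power_mult)
      finally show "avg (n - 1) G x = \<dots>" .
    qed
    have "avg 1 (avg (n - 1) G) r = (\<Sum>i\<le>N. avg 1 (\<lambda>x. c i / real (2 * i + n) * x ^ (2 * i)) r)"
      unfolding avgG by (intro avg_sum continuous_intros) auto
    also have "\<dots> = (\<Sum>i\<le>N. c i / real ((2 * i + 2) * (2 * i + n)) * r ^ (2 * i))"
      by (intro sum.cong refl) (simp only: avg_cmult avg_power, simp add: field_simps)
    finally have "r\<^sup>2 * avg 1 (avg (n - 1) G) r = (\<Sum>i\<le>N. c i / real ((2 * i + 2) * (2 * i + n)) * (r\<^sup>2) ^ Suc i)"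
      by (simp add: sum_distrib_left mult_ac flip: power_mult)
    then have eq: "1 + (\<Sum>i\<le>N. c i / real ((2 * i + 2) * (2 * i + n)) * (r\<^sup>2) ^ Suc i) - \<phi> r =
        r\<^sup>2 * (avg 1 (avg (n - 1) G) r - avg 1 (avg (n - 1) (\<lambda>\<rho>. a \<rho> * \<phi> \<rho>)) r)"
      using \<phi>(2)[of r] by (simp add: volterra_def algebra_simps)
    have cd: "continuous_on UNIV (\<lambda>x. avg (n - 1) G x - avg (n - 1) (\<lambda>\<rho>. a \<rho> * \<phi> \<rho>) x)"
      by (intro continuous_on_diff continuous_on_avg cG ca)
    have in1: "\<bar>avg (n - 1) G x - avg (n - 1) (\<lambda>\<rho>. a \<rho> * \<phi> \<rho>) x\<bar> \<le> d" if x: "0 \<le> x" "x \<le> L" for x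
    proof -
      have "\<bar>avg (n - 1) (\<lambda>\<rho>. G \<rho> - a \<rho> * \<phi> \<rho>) x\<bar> \<le> avg (n - 1) (\<lambda>_. d) x"
        using x by (intro avg_abs_le continuous_on_diff cG ca continuous_on_const G) (auto simp: mult_left_le order_trans[OF mult_left_le])
      also have "\<dots> \<le> d"
        using d0 avg_abs_le_const[of "\<lambda>_. d" "\<bar>x\<bar>" d x "n - 1"] by (simp add: abs_le_iff)
      finally show ?thesis by (simp add: avg_diff[OF cG ca])
    qed
    have "\<bar>avg 1 (\<lambda>x. avg (n - 1) G x - avg (n - 1) (\<lambda>\<rho>. a \<rho> * \<phi> \<rho>) x) r\<bar> \<le> avg 1 (\<lambda>_. d) r"
      using r by (intro avg_abs_le cd continuous_on_const in1) (auto simp: order_trans[OF mult_left_le])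
    also have "\<dots> \<le> d"
      using d0 avg_abs_le_const[of "\<lambda>_. d" "\<bar>r\<bar>" d r 1] by (simp add: abs_le_iff)
    finally have "\<bar>1 + (\<Sum>i\<le>N. c i / real ((2 * i + 2) * (2 * i + n)) * (r\<^sup>2) ^ Suc i) - \<phi> r\<bar> \<le> r\<^sup>2 * d"
      unfolding eq avg_diff[OF continuous_on_avg[OF cG] continuous_on_avg[OF ca]] abs_mult
      by (intro mult_mono) auto
    also have "\<dots> \<le> L\<^sup>2 * d" using r d0 by (intro mult_right_mono power_mono) auto
    finally show ?thesis using d1 by linarith
  qed
  moreover have "\<bar>(\<Sum>i\<le>N. c i * (r\<^sup>2) ^ i) - a r * \<phi> r\<bar> \<le> e" if "0 \<le> r" "r \<le> L" for r
    using G[OF that] d1 by (simp add: G_def)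
  ultimately show ?thesis using that by blast
qed

section \<open>Weighted inequalities that force blow-up\<close>

lemma weighted_am_gm:
  fixes x y t :: real
  assumes "0 \<le> x" "0 \<le> y" "0 < t" "t < 1"
  shows "x powr t * y powr (1 - t) \<le> t * x + (1 - t) * y"
proof (cases "x = 0 \<or> y = 0")
  case False
  then show ?thesis using Youngs_inequality_0[of t "1 - t" x y] assms by simp
qed (use assms in auto)

text \<open>Young's inequality is applied pointwise after both integrals are normalised to 1; if one
  of them is zero, the product vanishes almost everywhere.\<close>

lemma Hoelder_powr:
  fixes F G :: "'b \<Rightarrow> real"
  assumes F: "integrable M F" "\<And>z. 0 \<le> F z" and G: "integrable M G" "\<And>z. 0 \<le> G z"
    and t: "0 < t" "t < 1"
  shows "integrable M (\<lambda>z. F z powr t * G z powr (1 - t))"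
    and "(\<integral>z. F z powr t * G z powr (1 - t) \<partial>M) \<le> (\<integral>z. F z \<partial>M) powr t * (\<integral>z. G z \<partial>M) powr (1 - t)"
proof -
  have [measurable]: "F \<in> borel_measurable M" "G \<in> borel_measurable M" using F G by auto
  show int: "integrable M (\<lambda>z. F z powr t * G z powr (1 - t))"
  proof (rule Bochner_Integration.integrable_bound)
    show "integrable M (\<lambda>z. t * F z + (1 - t) * G z)" using F G by auto
    show "AE z in M. norm (F z powr t * G z powr (1 - t)) \<le> norm (t * F z + (1 - t) * G z)"
    proof (rule AE_I2)
      fix z show "norm (F z powr t * G z powr (1 - t)) \<le> norm (t * F z + (1 - t) * G z)"
        using weighted_am_gm[OF F(2) G(2) t, of z z] by simp
    qed
  qed measurable
  define X Y where "X = (\<integral>z. F z \<partial>M)" and "Y = (\<integral>z. G z \<partial>M)"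
  have XY: "0 \<le> X" "0 \<le> Y" using F G by (auto simp: X_def Y_def)
  have "(\<integral>z. F z powr t * G z powr (1 - t) \<partial>M) \<le> X powr t * Y powr (1 - t)"
  proof (cases "X = 0 \<or> Y = 0")
    case True
    then have "(AE z in M. F z = 0) \<or> (AE z in M. G z = 0)"
      using integral_nonneg_eq_0_iff_AE[OF F(1)] integral_nonneg_eq_0_iff_AE[OF G(1)] F G
      by (auto simp: X_def Y_def)
    then have "AE z in M. F z powr t * G z powr (1 - t) = 0"
      by (elim disjE) (auto elim: eventually_mono)
    then have "(\<integral>z. F z powr t * G z powr (1 - t) \<partial>M) = (\<integral>z. 0 \<partial>M)"
      by (intro integral_cong_AE) auto
    then show ?thesis by simp
  next
    case False
    then have pos: "0 < X" "0 < Y" using XY by auto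
    have "(\<integral>z. F z powr t * G z powr (1 - t) \<partial>M) \<le>
      (\<integral>z. (X powr t * Y powr (1 - t)) * (t * (F z / X) + (1 - t) * (G z / Y)) \<partial>M)"
    proof (rule integral_mono[OF int])
      fix z
      have "F z powr t * G z powr (1 - t) = (X powr t * Y powr (1 - t)) * ((F z / X) powr t * (G z / Y) powr (1 - t))"
        using pos F(2)[of z] G(2)[of z] by (simp add: powr_divide)
      also have "\<dots> \<le> (X powr t * Y powr (1 - t)) * (t * (F z / X) + (1 - t) * (G z / Y))"
        using pos F(2)[of z] G(2)[of z] t by (intro mult_left_mono weighted_am_gm) auto
      finally show "F z powr t * G z powr (1 - t) \<le> \<dots>" .
    qed (use F G in auto)
    also have "\<dots> = (X powr t * Y powr (1 - t)) * (t * (X / X) + (1 - t) * (Y / Y))"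
      using F G by (simp add: X_def Y_def)
    finally show ?thesis using pos by simp
  qed
  then show "(\<integral>z. F z powr t * G z powr (1 - t) \<partial>M) \<le> (\<integral>z. F z \<partial>M) powr t * (\<integral>z. G z \<partial>M) powr (1 - t)"
    by (simp add: X_def Y_def)
qed

text \<open>A discrete substitute for the blow-up of \<open>z' \<ge> c z\<^sup>r\<close>: as long as \<open>z\<close> stays bounded,
  \<open>z\<close> to the power \<open>1 - r\<close> drops by a fixed amount in each step.\<close>

lemma superlinear_recursion_bound:
  fixes c K r :: real
  assumes c: "0 < c" and K: "0 < K" and r: "1 < r"
  obtains B where "0 < B" "\<And>(z :: nat \<Rightarrow> real) J. 0 < z 0 \<Longrightarrow>
     (\<And>j. j < J \<Longrightarrow> z j + c * z j powr r \<le> z (Suc j)) \<Longrightarrow> (\<And>j. j \<le> J \<Longrightarrow> z j \<le> K) \<Longrightarrow>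
     real J \<le> B * z 0 powr (1 - r)"
proof -
  \<comment> \<open>As long as z \<le> K, the relative increment \<open>c * z powr (r - 1)\<close>
    stays in [0, Y]. There \<open>(1 + x) powr (1 - r)\<close> decreases at least as steeply as at
    the far end Y, which determines the fixed drop \<open>d\<close>.\<close>
  define Y where "Y = c * K powr (r - 1)"
  define d where "d = (r - 1) * (1 + Y) powr (- r) * c"
  have Y0: "0 \<le> Y" using c by (simp add: Y_def)
  have d0: "0 < d" using r c Y0 by (simp add: d_def)
  have bern: "(1 + x) powr (1 - r) \<le> 1 - (r - 1) * (1 + Y) powr (- r) * x" if x: "0 \<le> x" "x \<le> Y" for x
  proof -
    have "(1 + x) powr (1 - r) + (r - 1) * (1 + Y) powr (- r) * x \<le> (1 + 0) powr (1 - r) + (r - 1) * (1 + Y) powr (- r) * 0"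
    proof (rule DERIV_nonpos_imp_nonincreasing[OF x(1)])
      fix y assume y: "0 \<le> y" "y \<le> x"
      have "((\<lambda>y. (1 + y) powr (1 - r)) has_real_derivative (1 - r) * (1 + y) powr (1 - r - 1)) (at y)"
        using y by (auto intro!: derivative_eq_intros)
      then have "((\<lambda>y. (1 + y) powr (1 - r) + (r - 1) * (1 + Y) powr (- r) * y) has_real_derivative
          (1 - r) * (1 + y) powr (1 - r - 1) + (r - 1) * (1 + Y) powr (- r) * 1) (at y)"
        by (intro DERIV_add DERIV_cmult DERIV_ident)
      moreover have "(r - 1) * (1 + Y) powr (- r) \<le> (r - 1) * (1 + y) powr (- r)"
        using y x r by (intro mult_left_mono powr_mono2') auto
      then have "(1 - r) * (1 + y) powr (1 - r - 1) + (r - 1) * (1 + Y) powr (- r) * 1 \<le> 0"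
        by (simp add: algebra_simps)
      ultimately show "\<exists>D. ((\<lambda>y. (1 + y) powr (1 - r) + (r - 1) * (1 + Y) powr (- r) * y) has_real_derivative D) (at y) \<and> D \<le> 0"
        by blast
    qed
    then show ?thesis by simp
  qed
  have main: "real J * d \<le> z 0 powr (1 - r)"
    if z0: "0 < z 0" and step: "\<And>j. j < J \<Longrightarrow> z j + c * z j powr r \<le> z (Suc j)" and zK: "\<And>j. j \<le> J \<Longrightarrow> z j \<le> K"
    for z :: "nat \<Rightarrow> real" and J
  proof -
    have "0 < z j \<and> z j powr (1 - r) \<le> z 0 powr (1 - r) - real j * d" if "j \<le> J" for j
      using that
    proof (induction j)
      case (Suc j)
      then have pos: "0 < z j" and IH: "z j powr (1 - r) \<le> z 0 powr (1 - r) - real j * d" by auto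
      define x where "x = c * z j powr (r - 1)"
      have "z j powr (r - 1) \<le> K powr (r - 1)"
        using pos zK[of j] Suc.prems r by (intro powr_mono2) auto
      then have x: "0 \<le> x" "x \<le> Y" using c by (auto simp: x_def Y_def intro: mult_left_mono)
      have "z j powr r = z j powr (r - 1) * z j" using pos by (simp add: powr_diff)
      then have eq: "z j * (1 + x) = z j + c * z j powr r" by (simp add: x_def algebra_simps)
      have ge: "z j * (1 + x) \<le> z (Suc j)" unfolding eq using step Suc.prems by simp
      have pos1: "0 < z j * (1 + x)" using pos x by simp
      then have pos': "0 < z (Suc j)" using ge by linarith
      have "z (Suc j) powr (1 - r) \<le> (z j * (1 + x)) powr (1 - r)"
        using ge pos1 r by (intro powr_mono2') auto
      also have "\<dots> = z j powr (1 - r) * (1 + x) powr (1 - r)"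
        using pos x by (simp add: powr_mult)
      also have "\<dots> \<le> z j powr (1 - r) * (1 - (r - 1) * (1 + Y) powr (- r) * x)"
        by (intro mult_left_mono bern x) auto
      also have "\<dots> = z j powr (1 - r) - d * (z j powr (1 - r) * z j powr (r - 1))"
        by (simp add: x_def d_def algebra_simps)
      also have "\<dots> = z j powr (1 - r) - d"
        using pos by (simp flip: powr_add)
      finally show ?case using IH pos' by (simp add: algebra_simps)
    qed (use z0 in auto)
    from this[of J] show ?thesis using powr_ge_zero[of "z J" "1 - r"] by linarith
  qed
  show ?thesis
  proof (rule that[of "1 / d"])
    show "0 < 1 / d" using d0 by simp
    fix z :: "nat \<Rightarrow> real" and J
    assume "0 < z 0" "\<And>j. j < J \<Longrightarrow> z j + c * z j powr r \<le> z (Suc j)" "\<And>j. j \<le> J \<Longrightarrow> z j \<le> K"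
    from main[OF this] show "real J \<le> 1 / d * z 0 powr (1 - r)"
      using d0 by (simp add: field_simps)
  qed
qed

text \<open>The tangent line inequality for a convex power; it converts the growth of the time
  profile between dyadic times into a gain for the weighted integral.\<close>

lemma power_tangent_le:
  fixes x y :: real
  assumes "0 \<le> x" "x \<le> y"
  shows "x ^ k + real k * x ^ (k - 1) * (y - x) \<le> y ^ k"
proof (induction k)
  case (Suc k)
  have "x ^ Suc k + real (Suc k) * x ^ (Suc k - 1) * (y - x) = x ^ k * y + real k * x ^ k * (y - x)"
    by (simp add: algebra_simps)
  also have "\<dots> \<le> x ^ k * y + real k * x ^ (k - 1) * (y - x) * y"
  proof -
    have "x ^ k \<le> x ^ (k - 1) * y" if "k \<noteq> 0"
      using that assms by (cases k) (auto simp: mult.commute intro: mult_mono)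
    then have "real k * (x ^ k) * (y - x) \<le> real k * (x ^ (k - 1) * y) * (y - x)"
    proof (cases "k = 0")
      case False
      with \<open>k \<noteq> 0 \<Longrightarrow> x ^ k \<le> x ^ (k - 1) * y\<close> assms show ?thesis
        by (intro mult_right_mono mult_left_mono) auto
    qed simp
    then show ?thesis by (simp add: mult_ac)
  qed
  also have "\<dots> = (x ^ k + real k * x ^ (k - 1) * (y - x)) * y" by (simp add: algebra_simps)
  also have "\<dots> \<le> y ^ k * y" using Suc.IH assms by (intro mult_right_mono) auto
  finally show ?case by (simp add: mult.commute)
qed simp

text \<open>Enlarge X to u + X on the right and divide by \<open>(u + X) powr \<theta>\<close>; the
  positivity of u permits the division.\<close>

lemma sublinear_self_bound:
  fixes u X A \<theta> :: real
  assumes "0 < u" "0 \<le> X" "0 < \<theta>" "\<theta> < 1" "0 \<le> A" "u + X \<le> A * X powr \<theta>"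
  shows "u + X \<le> A powr (1 / (1 - \<theta>))"
proof -
  define v where "v = u + X"
  have v: "0 < v" "X \<le> v" using assms by (auto simp: v_def)
  have "X powr \<theta> \<le> v powr \<theta>" using v assms by (intro powr_mono2) auto
  then have "v \<le> A * v powr \<theta>"
    using assms mult_left_mono[of "X powr \<theta>" "v powr \<theta>" A] by (simp add: v_def)
  then have "v powr (1 - \<theta>) \<le> A"
    using v by (simp add: powr_diff field_simps)
  then have "(v powr (1 - \<theta>)) powr (1 / (1 - \<theta>)) \<le> A powr (1 / (1 - \<theta>))"
    using assms by (intro powr_mono2) auto
  then show ?thesis using v assms by (simp add: powr_powr v_def)
qed

text \<open>This collects what the blow-up argument uses about the geometry. \<open>W\<close> is a
  weight extended by 0 off the cone, so the time \<open>tt\<close> is known to be nonnegative only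
  where \<open>W\<close> is nonzero. In the intended instance a time slice has mass of order (1 +
  t)^s, and e \<le> s keeps the remaining power (1 + t)^(s - e) nondecreasing.
  \<open>C0 \<ge> 1\<close> allows powers of \<open>C0\<close> with exponent below 1 to be replaced
  by \<open>C0\<close>.\<close>

locale cone_weight =
  fixes M :: "'b measure" and tt W :: "'b \<Rightarrow> real" and s C0 T :: real
  assumes meas [measurable]: "tt \<in> borel_measurable M" "W \<in> borel_measurable M"
    and W_nonneg: "\<And>z. 0 \<le> W z" and tt_nonneg: "\<And>z. W z \<noteq> 0 \<Longrightarrow> 0 \<le> tt z"
    and C0: "1 \<le> C0"
    and intW: "\<And>e \<sigma>. 0 \<le> e \<Longrightarrow> e \<le> s \<Longrightarrow> 1 \<le> \<sigma> \<Longrightarrow> \<sigma> < T \<Longrightarrow>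
        integrable M (\<lambda>z. if tt z < \<sigma> then W z * (1 + tt z) powr (- e) else 0)"
    and intW_le: "\<And>e \<sigma>. 0 \<le> e \<Longrightarrow> e \<le> s \<Longrightarrow> 1 \<le> \<sigma> \<Longrightarrow> \<sigma> < T \<Longrightarrow>
        (\<integral>z. (if tt z < \<sigma> then W z * (1 + tt z) powr (- e) else 0) \<partial>M) \<le> C0 * (1 + \<sigma>) powr (s + 1 - e)"
    and s_pos: "0 < s"
begin

text \<open>With \<tau> = (1 + t) / (1 + \<sigma>) this equals 1 - \<tau> before time \<sigma> and 0
  afterwards. The denominator \<open>1 + \<sigma>\<close> instead of \<open>\<sigma>\<close> makes
  the profile an exact function of \<tau>.\<close>

definition hat :: "real \<Rightarrow> 'b \<Rightarrow> real" where "hat \<sigma> z = max 0 ((\<sigma> - tt z) / (1 + \<sigma>))"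

lemma hat_measurable [measurable]: "hat \<sigma> \<in> borel_measurable M"
  unfolding hat_def by measurable

lemma hat_nonneg: "0 \<le> hat \<sigma> z" by (simp add: hat_def)

lemma hat_le_1: "1 \<le> \<sigma> \<Longrightarrow> W z \<noteq> 0 \<Longrightarrow> hat \<sigma> z \<le> 1"
  using tt_nonneg[of z] by (simp add: hat_def)

lemma hat_eq_0: "1 \<le> \<sigma> \<Longrightarrow> \<sigma> \<le> tt z \<Longrightarrow> hat \<sigma> z = 0"
  unfolding hat_def by (intro max_absorb1) (simp add: divide_le_0_iff)

definition admissible :: "real \<Rightarrow> ('b \<Rightarrow> real) \<Rightarrow> bool" where
  "admissible p f \<longleftrightarrow> f \<in> borel_measurable M \<and> (\<forall>z. 0 \<le> f z) \<and>
     (\<forall>\<sigma>. 1 \<le> \<sigma> \<longrightarrow> \<sigma> < T \<longrightarrow> integrable M (\<lambda>z. if tt z < \<sigma> then f z powr p * W z else 0))"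

definition X :: "nat \<Rightarrow> real \<Rightarrow> ('b \<Rightarrow> real) \<Rightarrow> real \<Rightarrow> real" where
  "X k p f \<sigma> = (\<integral>z. f z powr p * W z * hat \<sigma> z ^ k \<partial>M)"

text \<open>Formally \<open>real k * P k p f \<sigma>\<close> is the derivative of
  \<open>X k p f \<sigma>\<close> with respect to log (1 + \<sigma>), because (1 + \<sigma>) times
  the \<sigma>-derivative of \<open>hat\<close> is \<tau>. A Hoelder bound in terms of
  \<open>P\<close> is therefore a differential inequality for \<open>X\<close>.\<close>

definition P :: "nat \<Rightarrow> real \<Rightarrow> ('b \<Rightarrow> real) \<Rightarrow> real \<Rightarrow> real" where
  "P k p f \<sigma> = (\<integral>z. f z powr p * W z * ((1 + tt z) / (1 + \<sigma>)) * hat \<sigma> z ^ (k - 1) \<partial>M)"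

lemma admissible_integrable:
  assumes f: "admissible p f" and \<sigma>: "1 \<le> \<sigma>" "\<sigma> < T" and [measurable]: "h \<in> borel_measurable M"
    and h: "\<And>z. \<sigma> \<le> tt z \<Longrightarrow> h z = 0" "\<And>z. W z \<noteq> 0 \<Longrightarrow> tt z < \<sigma> \<Longrightarrow> \<bar>h z\<bar> \<le> 1"
  shows "integrable M (\<lambda>z. f z powr p * W z * h z)"
proof (rule Bochner_Integration.integrable_bound)
  have [measurable]: "f \<in> borel_measurable M" using f by (simp add: admissible_def)
  show "integrable M (\<lambda>z. if tt z < \<sigma> then f z powr p * W z else 0)"
    using f \<sigma> by (simp add: admissible_def)
  show "(\<lambda>z. f z powr p * W z * h z) \<in> borel_measurable M" by measurable
  show "AE z in M. norm (f z powr p * W z * h z) \<le> norm (if tt z < \<sigma> then f z powr p * W z else 0)"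
  proof (rule AE_I2)
    fix z
    show "norm (f z powr p * W z * h z) \<le> norm (if tt z < \<sigma> then f z powr p * W z else 0)"
      using h[of z] mult_left_le[of "\<bar>h z\<bar>" "\<bar>f z powr p * W z\<bar>"]
      by (cases "W z = 0"; cases "tt z < \<sigma>") (auto simp: abs_mult)
  qed
qed

lemma X_integrable:
  assumes "admissible p f" "1 \<le> \<sigma>" "\<sigma> < T" "1 \<le> k"
  shows "integrable M (\<lambda>z. f z powr p * W z * hat \<sigma> z ^ k)"
  using assms hat_nonneg hat_le_1
  by (intro admissible_integrable[OF assms(1-3)]) (auto simp: hat_eq_0 power_le_one)

lemma P_integrable:
  assumes "admissible p f" "1 \<le> \<sigma>" "\<sigma> < T" "2 \<le> k"
  shows "integrable M (\<lambda>z. f z powr p * W z * ((1 + tt z) / (1 + \<sigma>)) * hat \<sigma> z ^ (k - 1))"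
proof -
  have "integrable M (\<lambda>z. f z powr p * W z * (((1 + tt z) / (1 + \<sigma>)) * hat \<sigma> z ^ (k - 1)))"
  proof (rule admissible_integrable[OF assms(1-3)])
    fix z assume z: "W z \<noteq> 0" "tt z < \<sigma>"
    have "(1 + tt z) / (1 + \<sigma>) \<le> 1" "0 \<le> (1 + tt z) / (1 + \<sigma>)"
      using tt_nonneg[OF z(1)] z assms by auto
    moreover have "hat \<sigma> z ^ (k - 1) \<le> 1" "0 \<le> hat \<sigma> z ^ (k - 1)"
      using hat_nonneg[of \<sigma> z] hat_le_1[OF assms(2) z(1)] by (auto intro: power_le_one)
    ultimately show "\<bar>(1 + tt z) / (1 + \<sigma>) * hat \<sigma> z ^ (k - 1)\<bar> \<le> 1"
      using mult_le_one[of "(1 + tt z) / (1 + \<sigma>)" "hat \<sigma> z ^ (k - 1)"]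
      by (subst abs_of_nonneg[OF mult_nonneg_nonneg])
  qed (use assms in \<open>auto simp: hat_eq_0\<close>)
  then show ?thesis by (simp add: mult.assoc)
qed

lemma X_nonneg: "0 \<le> X k p f \<sigma>"
  unfolding X_def using W_nonneg hat_nonneg by (intro integral_nonneg_AE AE_I2 mult_nonneg_nonneg) auto

lemma P_nonneg: "0 \<le> P k p f \<sigma>" if "1 \<le> \<sigma>"
  unfolding P_def
proof (intro integral_nonneg_AE AE_I2)
  fix z
  show "0 \<le> f z powr p * W z * ((1 + tt z) / (1 + \<sigma>)) * hat \<sigma> z ^ (k - 1)"
    using W_nonneg[of z] hat_nonneg[of \<sigma> z] tt_nonneg[of z] that by (cases "W z = 0") auto
qed

text \<open>As \<open>hat\<close> is at most 1, a higher power is smaller. For m = k the exponent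
  condition is a largeness condition on \<open>k\<close>; for m = k - 1 it follows from p >
  1.\<close>

lemma hat_power_mono:
  assumes "1 < p" "2 \<le> k" "1 \<le> \<sigma>" "W z \<noteq> 0" "real m / p \<le> real (k - 1)" "tt z < \<sigma>"
  shows "hat \<sigma> z ^ (k - 1) \<le> (hat \<sigma> z ^ m) powr (1 / p)"
proof -
  have h: "0 < hat \<sigma> z" using assms by (simp add: hat_def max_def)
  have "hat \<sigma> z ^ (k - 1) = hat \<sigma> z powr real (k - 1)" using h by (simp add: powr_realpow)
  also have "\<dots> \<le> hat \<sigma> z powr (real m / p)"
    using assms h hat_le_1[of \<sigma> z] by (intro powr_mono') auto
  also have "\<dots> = (hat \<sigma> z ^ m) powr (1 / p)" using h by (simp add: powr_realpow[symmetric] powr_powr)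
  finally show ?thesis .
qed

text \<open>The integrand is split into the density of \<open>X\<close> to the power 1 / p and
  \<open>W\<close> to the dual power. The exponent \<open>- 0\<close> in \<open>G\<close> only
  matches the form of \<open>intW\<close>.\<close>

lemma hoelder_X:
  assumes f: "admissible p f" and p: "1 < p" and k: "2 \<le> k" "real k / p \<le> real (k - 1)"
    and \<sigma>: "1 \<le> \<sigma>" "\<sigma> < T"
  shows "(\<integral>z. f z * W z * hat \<sigma> z ^ (k - 1) \<partial>M) \<le> X k p f \<sigma> powr (1 / p) * (C0 * (1 + \<sigma>) powr (s + 1)) powr (1 - 1 / p)"
proof -
  define F where "F = (\<lambda>z. f z powr p * W z * hat \<sigma> z ^ k)"
  define G where "G = (\<lambda>z. if tt z < \<sigma> then W z * (1 + tt z) powr (- 0) else 0)"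
  have f0: "0 \<le> f z" for z using f by (simp add: admissible_def)
  have F: "integrable M F" "\<And>z. 0 \<le> F z"
    unfolding F_def using X_integrable[OF f \<sigma>] k W_nonneg hat_nonneg by auto
  have G: "integrable M G" "\<And>z. 0 \<le> G z"
    unfolding G_def using intW[of 0 \<sigma>] \<sigma> s_pos W_nonneg by auto
  note H = Hoelder_powr[OF F G, of "1 / p"]
  have "(\<integral>z. f z * W z * hat \<sigma> z ^ (k - 1) \<partial>M) \<le> (\<integral>z. F z powr (1 / p) * G z powr (1 - 1 / p) \<partial>M)"
  proof (rule integral_mono')
    show "integrable M (\<lambda>z. F z powr (1 / p) * G z powr (1 - 1 / p))" using H(1) p by auto
    fix z
    show "0 \<le> F z powr (1 / p) * G z powr (1 - 1 / p)" by simp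
    show "f z * W z * hat \<sigma> z ^ (k - 1) \<le> F z powr (1 / p) * G z powr (1 - 1 / p)"
    proof (cases "W z \<noteq> 0 \<and> tt z < \<sigma>")
      case True
      then have W: "0 < W z" using W_nonneg[of z] by auto
      have "1 + tt z \<noteq> 0" using tt_nonneg[of z] True by auto
      then have "F z powr (1 / p) * G z powr (1 - 1 / p) =
          f z * (W z powr (1 / p) * W z powr (1 - 1 / p)) * (hat \<sigma> z ^ k) powr (1 / p)"
        using True f0[of z] W hat_nonneg[of \<sigma> z] p unfolding F_def G_def
        by (simp add: powr_mult powr_powr)
      also have "W z powr (1 / p) * W z powr (1 - 1 / p) = W z"
        using W by (simp flip: powr_add)
      finally show ?thesis
        using hat_power_mono[OF p k(1) \<sigma>(1) _ k(2), of z] True f0[of z] W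
        by (simp add: mult_left_mono)
    next
      case False
      then show ?thesis using k \<sigma> by (auto simp: hat_eq_0 F_def G_def power_0_left)
    qed
  qed
  also have "\<dots> \<le> (\<integral>z. F z \<partial>M) powr (1 / p) * (\<integral>z. G z \<partial>M) powr (1 - 1 / p)"
    using H(2) p by auto
  also have "\<dots> \<le> X k p f \<sigma> powr (1 / p) * (C0 * (1 + \<sigma>) powr (s + 1)) powr (1 - 1 / p)"
    unfolding X_def F_def[symmetric] using intW_le[of 0 \<sigma>] \<sigma> s_pos p Bochner_Integration.integral_nonneg[of M G, OF G(2)]
    by (intro mult_left_mono powr_mono2) (auto simp: G_def)
  finally show ?thesis .
qed

text \<open>The factor \<tau>^(1/p) is given to the density of \<open>P\<close> and compensated by
  the dual weight \<tau>^(-e), where e = 1 / (p - 1) solves e (1 - 1/p) = 1/p. The factor (1 +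
  \<sigma>)^e in that weight is cancelled by the smaller mass in \<open>intW_le\<close>, so the
  right side is as good as in \<open>hoelder_X\<close>.\<close>

lemma hoelder_P:
  assumes f: "admissible p f" and p: "1 < p" "1 / (p - 1) \<le> s" and k: "2 \<le> k"
    and \<sigma>: "1 \<le> \<sigma>" "\<sigma> < T"
  shows "(\<integral>z. f z * W z * hat \<sigma> z ^ (k - 1) \<partial>M) \<le> P k p f \<sigma> powr (1 / p) * (C0 * (1 + \<sigma>) powr (s + 1)) powr (1 - 1 / p)"
proof -
  define e where "e = 1 / (p - 1)"
  have e: "0 \<le> e" "e \<le> s" using p by (auto simp: e_def)
  define F where "F = (\<lambda>z. f z powr p * W z * ((1 + tt z) / (1 + \<sigma>)) * hat \<sigma> z ^ (k - 1))"
  define G where "G = (\<lambda>z. (1 + \<sigma>) powr e * (if tt z < \<sigma> then W z * (1 + tt z) powr (- e) else 0))"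
  have f0: "0 \<le> f z" for z using f by (simp add: admissible_def)
  have F: "integrable M F" "\<And>z. 0 \<le> F z"
  proof -
    show "integrable M F" unfolding F_def by (rule P_integrable[OF f \<sigma> k])
    fix z show "0 \<le> F z"
      using W_nonneg[of z] hat_nonneg[of \<sigma> z] tt_nonneg[of z] \<sigma> by (cases "W z = 0") (auto simp: F_def)
  qed
  have G: "integrable M G" "\<And>z. 0 \<le> G z"
    unfolding G_def using intW[of e \<sigma>] \<sigma> e W_nonneg by auto
  note H = Hoelder_powr[OF F G, of "1 / p"]
  have "(\<integral>z. f z * W z * hat \<sigma> z ^ (k - 1) \<partial>M) \<le> (\<integral>z. F z powr (1 / p) * G z powr (1 - 1 / p) \<partial>M)"
  proof (rule integral_mono')
    show "integrable M (\<lambda>z. F z powr (1 / p) * G z powr (1 - 1 / p))" using H(1) p by auto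
    fix z
    show "0 \<le> F z powr (1 / p) * G z powr (1 - 1 / p)" by simp
    show "f z * W z * hat \<sigma> z ^ (k - 1) \<le> F z powr (1 / p) * G z powr (1 - 1 / p)"
    proof (cases "W z \<noteq> 0 \<and> tt z < \<sigma>")
      case True
      then have W: "0 < W z" using W_nonneg[of z] by auto
      have t0: "0 < 1 + tt z" using tt_nonneg[of z] True by auto
      define \<tau> where "\<tau> = (1 + tt z) / (1 + \<sigma>)"
      have \<tau>: "0 < \<tau>" using t0 \<sigma> by (simp add: \<tau>_def)
      have G_eq: "G z = W z * \<tau> powr (- e)"
        using True t0 \<sigma> by (simp add: G_def \<tau>_def powr_divide powr_minus field_simps)
      have "e * (1 - 1 / p) = 1 / p" using p by (simp add: e_def field_simps)
      then have "\<tau> powr (1 / p) * (\<tau> powr (- e)) powr (1 - 1 / p) = 1"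
        using \<tau> by (simp add: powr_powr flip: powr_add)
      moreover have "W z powr (1 / p) * W z powr (1 - 1 / p) = W z"
        using W by (simp flip: powr_add)
      moreover have "F z powr (1 / p) * G z powr (1 - 1 / p) =
          f z * (W z powr (1 / p) * W z powr (1 - 1 / p)) * (\<tau> powr (1 / p) * (\<tau> powr (- e)) powr (1 - 1 / p)) * (hat \<sigma> z ^ (k - 1)) powr (1 / p)"
        using f0[of z] W hat_nonneg[of \<sigma> z] p \<tau> unfolding F_def \<tau>_def[symmetric] G_eq
        by (simp add: powr_mult powr_powr)
      ultimately have eq: "F z powr (1 / p) * G z powr (1 - 1 / p) = f z * W z * (hat \<sigma> z ^ (k - 1)) powr (1 / p)"
        by (simp only: mult_1_right)
      have "real (k - 1) / p \<le> real (k - 1)" using p by (simp add: divide_le_eq mult_le_cancel_left1)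
      then show ?thesis
        using hat_power_mono[OF p(1) k(1) \<sigma>(1) _, of z "k - 1"] True f0[of z] W unfolding eq
        by (intro mult_left_mono) auto
    next
      case False
      then show ?thesis using k \<sigma> by (auto simp: hat_eq_0 F_def G_def power_0_left)
    qed
  qed
  also have "\<dots> \<le> (\<integral>z. F z \<partial>M) powr (1 / p) * (\<integral>z. G z \<partial>M) powr (1 - 1 / p)"
    using H(2) p by auto
  also have "\<dots> \<le> P k p f \<sigma> powr (1 / p) * (C0 * (1 + \<sigma>) powr (s + 1)) powr (1 - 1 / p)"
  proof -
    have "(\<integral>z. G z \<partial>M) \<le> (1 + \<sigma>) powr e * (C0 * (1 + \<sigma>) powr (s + 1 - e))"
      unfolding G_def integral_mult_right_zero using intW_le[of e \<sigma>] e \<sigma> by (intro mult_left_mono) auto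
    also have "\<dots> = C0 * (1 + \<sigma>) powr (s + 1)" using \<sigma> by (simp add: powr_diff)
    finally show ?thesis
      unfolding P_def F_def[symmetric] using p Bochner_Integration.integral_nonneg[of M G, OF G(2)]
      by (intro mult_left_mono powr_mono2) auto
  qed
  finally show ?thesis .
qed

text \<open>Doubling \<open>1 + \<sigma>\<close> halves \<tau>, so the profile rises from 1 - \<tau>
  to 1 - \<tau>/2; the tangent inequality for its k-th power yields the factor k / 2.\<close>

lemma P_le_X_increment:
  assumes f: "admissible p f" and k: "2 \<le> k" and \<sigma>: "1 \<le> \<sigma>" "\<sigma>' < T" "1 + \<sigma>' = 2 * (1 + \<sigma>)"
  shows "X k p f \<sigma> + real k / 2 * P k p f \<sigma> \<le> X k p f \<sigma>'"
proof -
  have \<sigma>T: "\<sigma> < T" "1 \<le> \<sigma>'" using \<sigma> by auto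
  have i1: "integrable M (\<lambda>z. f z powr p * W z * hat \<sigma> z ^ k)" and i3: "integrable M (\<lambda>z. f z powr p * W z * hat \<sigma>' z ^ k)"
    and i2: "integrable M (\<lambda>z. f z powr p * W z * ((1 + tt z) / (1 + \<sigma>)) * hat \<sigma> z ^ (k - 1))"
    using X_integrable[OF f] P_integrable[OF f] \<sigma> \<sigma>T k by auto
  have "X k p f \<sigma> + real k / 2 * P k p f \<sigma> =
     (\<integral>z. f z powr p * W z * hat \<sigma> z ^ k + real k / 2 * (f z powr p * W z * ((1 + tt z) / (1 + \<sigma>)) * hat \<sigma> z ^ (k - 1)) \<partial>M)"
    unfolding X_def P_def
    by (simp only: Bochner_Integration.integral_add[OF i1 integrable_mult_right[OF i2]] integral_mult_right_zero)
  also have "\<dots> \<le> X k p f \<sigma>'"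
    unfolding X_def
  proof (rule integral_mono)
    show "integrable M (\<lambda>z. f z powr p * W z * hat \<sigma> z ^ k + real k / 2 * (f z powr p * W z * ((1 + tt z) / (1 + \<sigma>)) * hat \<sigma> z ^ (k - 1)))"
      by (intro Bochner_Integration.integrable_add integrable_mult_right i1 i2)
    fix z
    have "hat \<sigma> z ^ k + real k / 2 * ((1 + tt z) / (1 + \<sigma>)) * hat \<sigma> z ^ (k - 1) \<le> hat \<sigma>' z ^ k" if "W z \<noteq> 0"
    proof (cases "tt z < \<sigma>")
      case True
      define \<tau> where "\<tau> = (1 + tt z) / (1 + \<sigma>)"
      have h: "hat \<sigma> z = 1 - \<tau>"
        using True \<sigma> by (simp add: hat_def \<tau>_def field_simps max_def)
      have "\<sigma>' = 2 * (1 + \<sigma>) - 1" using \<sigma>(3) by linarith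
      then have h': "hat \<sigma>' z = 1 - \<tau> / 2"
        using True \<sigma> by (simp add: hat_def \<tau>_def field_simps max_def)
      have "0 \<le> \<tau>" using tt_nonneg[OF that] \<sigma> by (simp add: \<tau>_def)
      then have "hat \<sigma> z ^ k + real k * hat \<sigma> z ^ (k - 1) * (hat \<sigma>' z - hat \<sigma> z) \<le> hat \<sigma>' z ^ k"
        using hat_nonneg[of \<sigma> z] by (intro power_tangent_le) (auto simp: h h')
      then show ?thesis unfolding \<tau>_def[symmetric] by (simp add: h h' algebra_simps)
    next
      case False
      then show ?thesis using k \<sigma> hat_nonneg by (simp add: hat_eq_0 power_0_left)
    qed
    then have "f z powr p * W z * (hat \<sigma> z ^ k + real k / 2 * ((1 + tt z) / (1 + \<sigma>)) * hat \<sigma> z ^ (k - 1)) \<le> f z powr p * W z * hat \<sigma>' z ^ k"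
      using W_nonneg[of z] by (cases "W z = 0") (auto intro!: mult_left_mono)
    then show "f z powr p * W z * hat \<sigma> z ^ k + real k / 2 * (f z powr p * W z * ((1 + tt z) / (1 + \<sigma>)) * hat \<sigma> z ^ (k - 1))
        \<le> f z powr p * W z * hat \<sigma>' z ^ k"
      by (simp only: distrib_left mult_ac)
  qed (rule i3)
  finally show ?thesis .
qed

end

section \<open>Eliminating one unknown from the two coupled inequalities\<close>

definition Gam :: "real \<Rightarrow> real \<Rightarrow> real \<Rightarrow> real" where
  "Gam s p q = (p + 1) / (p * q - 1) - s"

text \<open>The left side is the power of \<open>1 + \<sigma>\<close> left after inserting one
  Hoelder estimate into the other. The factor 1 - 1 / (p q) disappears when the resulting sublinear
  inequality is solved, so exactly \<open>- Gam s p q\<close> remains. \<open>Gam\<close> is the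
  branch of \<open>GammaGG\<close> that is the maximum when q \<le> p.\<close>

lemma chain_exponent:
  fixes p q s :: real
  assumes "1 < p" "1 < q"
  shows "((s + 1) * (1 - 1 / p) - 1) / q + ((s + 1) * (1 - 1 / q) - 1) = - Gam s p q * (1 - 1 / (p * q))"
proof -
  have "p * q > 1" using assms by (simp add: less_1_mult)
  then show ?thesis using assms by (simp add: Gam_def field_simps)
qed

lemma powr_minus_mult_le:
  fixes B V P r :: real
  assumes "0 < B" "V \<le> B powr r * P"
  shows "B powr (- r) * V \<le> P"
proof -
  have "0 < B powr r" using assms by simp
  then show ?thesis using assms by (simp add: powr_minus field_simps)
qed

lemma inverse_minus_one_eq:
  fixes p :: real
  assumes "1 < p"
  shows "1 / (p - 1) = (p + 1) / (p * p - 1)"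
proof -
  have "p * p - 1 = (p - 1) * (p + 1)" by (simp add: algebra_simps)
  then show ?thesis using assms by simp
qed

lemma chain_powr:
  fixes A N v Y Z a b p q :: real
  assumes "1 < p" "1 < q" "0 \<le> A" "0 < N" "0 \<le> Y" "0 \<le> Z"
    and Y: "Y \<le> A * Z powr (1 / p) * N powr b" and v: "v \<le> A * Y powr (1 / q) * N powr a"
  shows "v \<le> (A * A powr (1 / q)) * Z powr (1 / (p * q)) * N powr (b / q + a)"
proof -
  have "Y powr (1 / q) \<le> (A * Z powr (1 / p) * N powr b) powr (1 / q)"
    using assms by (intro powr_mono2) auto
  also have "\<dots> = A powr (1 / q) * Z powr (1 / (p * q)) * N powr (b / q)"
    using assms by (simp add: powr_mult powr_powr)
  finally have "A * Y powr (1 / q) * N powr a \<le> A * (A powr (1 / q) * Z powr (1 / (p * q)) * N powr (b / q)) * N powr a"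
    using assms by (intro mult_right_mono mult_left_mono) auto
  also have "\<dots> = (A * A powr (1 / q)) * Z powr (1 / (p * q)) * N powr (b / q + a)"
    using assms by (simp add: powr_add mult_ac)
  finally show ?thesis using v by linarith
qed

context cone_weight
begin

text \<open>One integrated equation: \<open>f\<close> is the modulus of the time derivative that
  forms the source, \<open>g\<close> that of the unknown itself, and \<open>u\<close> is the
  contribution of the data. The system consists of two instances with the roles exchanged.\<close>

definition coupled :: "nat \<Rightarrow> real \<Rightarrow> real \<Rightarrow> real \<Rightarrow> real \<Rightarrow> ('b \<Rightarrow> real) \<Rightarrow> ('b \<Rightarrow> real) \<Rightarrow> bool" where
  "coupled k p u q C f g \<longleftrightarrow> admissible p f \<and> admissible q g \<and>
     (\<forall>\<sigma>. 1 \<le> \<sigma> \<longrightarrow> \<sigma> < T \<longrightarrow> u + X k p f \<sigma> \<le> C / (1 + \<sigma>) * (\<integral>z. g z * W z * hat \<sigma> z ^ (k - 1) \<partial>M))"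

lemma weight_factor:
  assumes "0 < C" "1 < q" "1 \<le> \<sigma>" "0 \<le> Y"
    and "I \<le> Y powr (1 / q) * (C0 * (1 + \<sigma>) powr (s + 1)) powr (1 - 1 / q)"
  shows "C / (1 + \<sigma>) * I \<le> (C * C0) * Y powr (1 / q) * (1 + \<sigma>) powr ((s + 1) * (1 - 1 / q) - 1)"
proof -
  have "C / (1 + \<sigma>) * I \<le> C / (1 + \<sigma>) * (Y powr (1 / q) * (C0 * (1 + \<sigma>) powr (s + 1)) powr (1 - 1 / q))"
    using assms by (intro mult_left_mono) auto
  also have "\<dots> = (C * C0 powr (1 - 1 / q)) * Y powr (1 / q) * (1 + \<sigma>) powr ((s + 1) * (1 - 1 / q) - 1)"
  proof -
    have "(C0 * (1 + \<sigma>) powr (s + 1)) powr (1 - 1 / q) = C0 powr (1 - 1 / q) * (1 + \<sigma>) powr ((s + 1) * (1 - 1 / q))"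
      using C0 by (subst powr_mult) (auto simp: powr_powr)
    moreover have "(1 + \<sigma>) powr ((s + 1) * (1 - 1 / q) - 1) = (1 + \<sigma>) powr ((s + 1) * (1 - 1 / q)) / (1 + \<sigma>)"
      using assms by (subst powr_diff) auto
    ultimately show ?thesis by simp
  qed
  also have "\<dots> \<le> (C * C0) * Y powr (1 / q) * (1 + \<sigma>) powr ((s + 1) * (1 - 1 / q) - 1)"
  proof (intro mult_right_mono mult_left_mono)
    show "C0 powr (1 - 1 / q) \<le> C0"
      using powr_mono[of "1 - 1 / q" 1 C0] C0 assms by simp
  qed (use assms in auto)
  finally show ?thesis .
qed

lemma coupled_X:
  assumes "coupled k p u q C f g" "0 < C" "1 < q" "2 \<le> k" "real k / q \<le> real (k - 1)" "1 \<le> \<sigma>" "\<sigma> < T"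
  shows "u + X k p f \<sigma> \<le> (C * C0) * X k q g \<sigma> powr (1 / q) * (1 + \<sigma>) powr ((s + 1) * (1 - 1 / q) - 1)"
  using assms weight_factor[OF _ _ _ X_nonneg hoelder_X, of C q \<sigma> g k]
  unfolding coupled_def by fastforce

lemma coupled_P:
  assumes "coupled k p u q C f g" "0 < C" "1 < q" "2 \<le> k" "1 / (q - 1) \<le> s" "1 \<le> \<sigma>" "\<sigma> < T"
  shows "u + X k p f \<sigma> \<le> (C * C0) * P k q g \<sigma> powr (1 / q) * (1 + \<sigma>) powr ((s + 1) * (1 - 1 / q) - 1)"
  using assms weight_factor[OF _ _ _ P_nonneg hoelder_P, of C q \<sigma> g k]
  unfolding coupled_def by fastforce

definition bnd :: "real \<Rightarrow> real \<Rightarrow> real \<Rightarrow> real" where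
  "bnd C p q = ((C * C0) * (C * C0) powr (1 / q)) powr (1 / (1 - 1 / (p * q)))"

text \<open>It serves both regimes: for positive \<open>Gam\<close> the right side decays and
  contradicts the fixed data term at large times; for \<open>Gam\<close> equal to 0 it is the
  uniform bound that \<open>superlinear_recursion_bound\<close> requires.\<close>

lemma coupled_bound:
  assumes fg: "coupled k p u q C f g" and gf: "coupled k q u p C g f"
    and "0 < C" "0 < u" and p: "1 < p" and q: "1 < q" and k: "2 \<le> k" "real k / p \<le> real (k - 1)" "real k / q \<le> real (k - 1)"
    and \<sigma>: "1 \<le> \<sigma>" "\<sigma> < T"
  shows "u + X k p f \<sigma> \<le> bnd C p q * (1 + \<sigma>) powr (- Gam s p q)"
proof -
  have pq: "1 < p * q" using p q by (simp add: less_1_mult)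
  define \<theta> where "\<theta> = 1 / (p * q)"
  have \<theta>: "0 < \<theta>" "\<theta> < 1" using pq by (auto simp: \<theta>_def)
  let ?A = "C * C0"
  have A: "0 \<le> ?A" using assms C0 by simp
  have 1: "X k q g \<sigma> \<le> ?A * X k p f \<sigma> powr (1 / p) * (1 + \<sigma>) powr ((s + 1) * (1 - 1 / p) - 1)"
    using coupled_X[OF gf \<open>0 < C\<close> p k(1,2) \<sigma>] \<open>0 < u\<close> by linarith
  have "u + X k p f \<sigma> \<le> (?A * ?A powr (1 / q)) * X k p f \<sigma> powr \<theta> * (1 + \<sigma>) powr (- Gam s p q * (1 - \<theta>))"
    using chain_powr[OF p q A _ X_nonneg X_nonneg 1 coupled_X[OF fg \<open>0 < C\<close> q k(1,3) \<sigma>]] \<sigma>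
    unfolding chain_exponent[OF p q] \<theta>_def by simp
  then have "u + X k p f \<sigma> \<le> ((?A * ?A powr (1 / q)) * (1 + \<sigma>) powr (- Gam s p q * (1 - \<theta>))) * X k p f \<sigma> powr \<theta>"
    by (simp add: mult_ac)
  then have "u + X k p f \<sigma> \<le> ((?A * ?A powr (1 / q)) * (1 + \<sigma>) powr (- Gam s p q * (1 - \<theta>))) powr (1 / (1 - \<theta>))"
    using \<theta> A \<open>0 < u\<close> by (intro sublinear_self_bound X_nonneg) auto
  also have "\<dots> = bnd C p q * ((1 + \<sigma>) powr (- Gam s p q * (1 - \<theta>))) powr (1 / (1 - \<theta>))"
    unfolding bnd_def \<theta>_def using A by (simp add: powr_mult)
  also have "((1 + \<sigma>) powr (- Gam s p q * (1 - \<theta>))) powr (1 / (1 - \<theta>)) = (1 + \<sigma>) powr (- Gam s p q)"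
    using \<theta> by (simp add: powr_powr)
  finally show ?thesis .
qed

text \<open>The first integer J above B cannot satisfy the bound, so its dyadic time is not below T.
  Since J + 1 \<le> B + 2 and 2 \<le> exp 1, the claim follows.\<close>

lemma T_le_of_dyadic_bound:
  assumes "0 \<le> B" "\<And>J. 2 ^ Suc J - 1 < T \<Longrightarrow> real J \<le> B"
  shows "T \<le> exp (B + 2)"
proof -
  define J where "J = nat \<lfloor>B\<rfloor> + 1"
  have J: "B < real J" "real J \<le> B + 1" using assms by (auto simp: J_def) linarith+
  have "T \<le> 2 ^ Suc J - 1" using assms(2)[of J] J by fastforce
  also have "\<dots> \<le> 2 ^ Suc J" by simp
  also have "\<dots> \<le> exp 1 ^ Suc J" using exp_ge_add_one_self[of 1] by (intro power_mono) auto
  also have "\<dots> = exp (real (Suc J))" using exp_of_nat_mult[of "Suc J" "1::real"] by (simp del: power_Suc of_nat_Suc)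
  also have "\<dots> \<le> exp (B + 2)" using J by simp
  finally show ?thesis .
qed

text \<open>The weighted estimate \<open>hoelder_P\<close> is used for the integral of
  \<open>f\<close> and the plain one for the integral of \<open>g\<close>. The powers of
  \<open>1 + \<sigma>\<close> cancel in the composition, so u + X is at most a constant times
  P^(1/(p q)), and \<open>k \<ge> 2\<close> makes the increment of \<open>X\<close> at least
  \<open>P\<close>.\<close>

lemma critical_step:
  assumes fg: "coupled k p u q C f g" and gf: "coupled k q u p C g f"
    and "0 < C" "0 < u" and p: "1 < p" "1 / (p - 1) \<le> s" and q: "1 < q" and k: "2 \<le> k" "real k / p \<le> real (k - 1)" "real k / q \<le> real (k - 1)"
    and \<sigma>: "1 \<le> \<sigma>" "\<sigma>' < T" "1 + \<sigma>' = 2 * (1 + \<sigma>)" and G: "Gam s p q = 0"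
  shows "(u + X k p f \<sigma>) + (C * C0 * (C * C0) powr (1 / q)) powr (- (p * q)) * (u + X k p f \<sigma>) powr (p * q) \<le> u + X k p f \<sigma>'"
proof -
  have \<sigma>T: "\<sigma> < T" using \<sigma> by auto
  have pq: "1 < p * q" using p q by (simp add: less_1_mult)
  let ?A = "C * C0"
  let ?B = "?A * ?A powr (1 / q)"
  have A: "0 < ?A" using assms C0 by simp
  have B: "0 < ?B"
    by (rule mult_pos_pos[OF A], subst powr_gt_zero, rule less_imp_neq[OF A, symmetric])
  have adm: "admissible p f" using fg by (simp add: coupled_def)
  have 1: "X k q g \<sigma> \<le> ?A * P k p f \<sigma> powr (1 / p) * (1 + \<sigma>) powr ((s + 1) * (1 - 1 / p) - 1)"
    using coupled_P[OF gf \<open>0 < C\<close> p(1) k(1) p(2) \<sigma>(1) \<sigma>T] \<open>0 < u\<close> by linarith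
  have P0: "0 \<le> P k p f \<sigma>" using P_nonneg \<sigma> by auto
  define v where "v = u + X k p f \<sigma>"
  have v: "0 < v" using \<open>0 < u\<close> X_nonneg[of k p f \<sigma>] by (simp add: v_def)
  have "v \<le> ?B * P k p f \<sigma> powr (1 / (p * q))"
    using chain_powr[OF p(1) q less_imp_le[OF A] _ X_nonneg P0 1 coupled_X[OF fg \<open>0 < C\<close> q k(1,3) \<sigma>(1) \<sigma>T]] \<sigma>
    unfolding chain_exponent[OF p(1) q] G v_def by simp
  then have "v powr (p * q) \<le> (?B * P k p f \<sigma> powr (1 / (p * q))) powr (p * q)"
    using v pq by (intro powr_mono2) auto
  also have "\<dots> = ?B powr (p * q) * P k p f \<sigma>"
    using P0 p q by (subst powr_mult) (auto simp: powr_powr)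
  finally have "?B powr (- (p * q)) * v powr (p * q) \<le> P k p f \<sigma>"
    by (rule powr_minus_mult_le[OF B])
  moreover have "P k p f \<sigma> \<le> real k / 2 * P k p f \<sigma>"
    using k P0 mult_right_mono[of 1 "real k / 2" "P k p f \<sigma>"] by simp
  ultimately show ?thesis
    using P_le_X_increment[OF adm k(1) \<sigma>] unfolding v_def by linarith
qed

lemma critical_step_eq:
  assumes fg: "coupled k q u p C f g"
    and "0 < C" "0 < u" and p: "1 < p" "1 / (p - 1) = s" and k: "2 \<le> k"
    and \<sigma>: "1 \<le> \<sigma>" "\<sigma>' < T" "1 + \<sigma>' = 2 * (1 + \<sigma>)"
  shows "X k p g \<sigma> + (C * C0) powr (- p) * (u + X k q f \<sigma>) powr p \<le> X k p g \<sigma>'"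
proof -
  have \<sigma>T: "\<sigma> < T" using \<sigma> by auto
  let ?A = "C * C0"
  have A: "0 < ?A" using assms C0 by simp
  have adm: "admissible p g" using fg by (simp add: coupled_def)
  have P0: "0 \<le> P k p g \<sigma>" using P_nonneg \<sigma> by auto
  define v where "v = u + X k q f \<sigma>"
  have v: "0 < v" using \<open>0 < u\<close> X_nonneg[of k q f \<sigma>] by (simp add: v_def)
  have e: "(s + 1) * (1 - 1 / p) - 1 = 0" using p(1) by (simp add: p(2)[symmetric] field_simps)
  have "v \<le> ?A * P k p g \<sigma> powr (1 / p)"
    using coupled_P[OF fg \<open>0 < C\<close> p(1) k _ \<sigma>(1) \<sigma>T] p \<sigma> unfolding e v_def by simp
  then have "v powr p \<le> (?A * P k p g \<sigma> powr (1 / p)) powr p"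
    using v p by (intro powr_mono2) auto
  also have "\<dots> = ?A powr p * P k p g \<sigma>"
    using A p(1) P0 by (simp add: powr_mult powr_powr)
  finally have "?A powr (- p) * v powr p \<le> P k p g \<sigma>"
    by (rule powr_minus_mult_le[OF A])
  moreover have "P k p g \<sigma> \<le> real k / 2 * P k p g \<sigma>"
    using k P0 mult_right_mono[of 1 "real k / 2" "P k p g \<sigma>"] by simp
  ultimately show ?thesis
    using P_le_X_increment[OF adm k(1) \<sigma>] unfolding v_def by linarith
qed

end

lemma dyadic_times:
  fixes T :: real
  assumes "2 ^ Suc J - 1 < T"
  shows "j \<le> J \<Longrightarrow> 1 \<le> (2::real) ^ Suc j - 1" "j \<le> J \<Longrightarrow> (2::real) ^ Suc j - 1 < T"
    "1 + ((2::real) ^ Suc (Suc j) - 1) = 2 * (1 + (2 ^ Suc j - 1))"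
proof -
  show "1 \<le> (2::real) ^ Suc j - 1" using one_le_power[of "2::real" j] by simp
  show "(2::real) ^ Suc j - 1 < T" if "j \<le> J"
    using assms power_increasing[of "Suc j" "Suc J" "2::real"] that by linarith
qed simp

text \<open>\<open>K\<close> is fixed before the measure, the time T and the data size \<epsilon>.
  The additive 1 in each bound makes it valid for every \<epsilon> > 0, so finiteness of the
  lifespan is not restricted to small data.\<close>

lemma coupled_lifespan:
  fixes p q s c C C0 :: real and k :: nat
  assumes q: "1 < q" "q \<le> p" and s: "0 < s" and \<Gamma>: "0 \<le> Gam s p q"
    and c: "0 < c" and C: "0 < C" and C0: "1 \<le> C0"
    and k: "2 \<le> k" "real k / p \<le> real (k - 1)" "real k / q \<le> real (k - 1)"
  obtains K where "0 < K"
    "\<And>(M :: 'b measure) tt W T f g \<epsilon>. cone_weight M tt W s C0 T \<Longrightarrow> 0 < \<epsilon> \<Longrightarrow>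
      cone_weight.coupled M tt W T k p (c * \<epsilon>) q C f g \<Longrightarrow> cone_weight.coupled M tt W T k q (c * \<epsilon>) p C g f \<Longrightarrow>
      T \<le> (if 0 < Gam s p q then 1 + K * \<epsilon> powr (- (1 / Gam s p q))
           else if p \<noteq> q then exp (K * (1 + \<epsilon> powr (- (p * q - 1))))
           else exp (K * (1 + \<epsilon> powr (- (p - 1)))))"
proof -
  have p: "1 < p" using q by auto
  have pq: "1 < p * q" using p q by (simp add: less_1_mult)
  define A where "A = C * C0"
  have A: "0 < A" using C C0 by (simp add: A_def)
  define b where "b = (A * A powr (1 / q)) powr (1 / (1 - 1 / (p * q)))"
  have b: "0 < b" using A by (simp add: b_def)
  consider "0 < Gam s p q" | "Gam s p q = 0" "p \<noteq> q" | "Gam s p q = 0" "p = q" using \<Gamma> by linarith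
  then show ?thesis
  proof cases
    case 1
    \<comment> \<open>\<open>K\<close> solves b (K \<epsilon>^(-1/\<Gamma>))^(-\<Gamma>) = c
      \<epsilon>. A solution living past the \<sigma> chosen below would give 1 + \<sigma> \<le>
      \<sigma> - 1.\<close>
    define K where "K = (b / c) powr (1 / Gam s p q)"
    have K: "0 < K" using b c by (simp add: K_def)
    show ?thesis
    proof (rule that[OF K])
      fix M :: "'b measure" and tt W T f g \<epsilon>
      assume cw: "cone_weight M tt W s C0 T" and e: "0 < \<epsilon>"
        and fg: "cone_weight.coupled M tt W T k p (c * \<epsilon>) q C f g" and gf: "cone_weight.coupled M tt W T k q (c * \<epsilon>) p C g f"
      interpret cone_weight M tt W s C0 T by (rule cw)
      have "T \<le> 1 + K * \<epsilon> powr (- (1 / Gam s p q))"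
      proof (rule ccontr)
        assume "\<not> ?thesis"
        define \<sigma> where "\<sigma> = 1 + K * \<epsilon> powr (- (1 / Gam s p q))"
        have \<sigma>: "1 \<le> \<sigma>" "\<sigma> < T" using K e \<open>\<not> _\<close> by (auto simp: \<sigma>_def)
        have "c * \<epsilon> \<le> b * (1 + \<sigma>) powr (- Gam s p q)"
          using coupled_bound[OF fg gf C _ p q(1) k \<sigma>] c e X_nonneg[of k p f \<sigma>]
          by (simp add: bnd_def A_def[symmetric] b_def[symmetric])
        then have "(1 + \<sigma>) powr Gam s p q \<le> b / (c * \<epsilon>)"
          using c e \<sigma> by (simp add: powr_minus field_simps)
        then have "((1 + \<sigma>) powr Gam s p q) powr (1 / Gam s p q) \<le> (b / (c * \<epsilon>)) powr (1 / Gam s p q)"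
          using 1 by (intro powr_mono2) auto
        also have "\<dots> = K * \<epsilon> powr (- (1 / Gam s p q))"
          using b c e by (simp add: K_def powr_divide powr_mult powr_minus field_simps)
        finally show False using 1 \<sigma> by (simp add: powr_powr \<sigma>_def)
      qed
      then show "T \<le> (if 0 < Gam s p q then 1 + K * \<epsilon> powr (- (1 / Gam s p q))
           else if p \<noteq> q then exp (K * (1 + \<epsilon> powr (- (p * q - 1))))
           else exp (K * (1 + \<epsilon> powr (- (p - 1)))))"
        using 1 by simp
    qed
  next
    case 2
    have "s = (p + 1) / (p * q - 1)" using 2 by (simp add: Gam_def)
    moreover note inverse_minus_one_eq[OF p]
    moreover have "(p + 1) / (p * p - 1) \<le> (p + 1) / (p * q - 1)"
      using p q pq less_1_mult[OF p p] by (intro divide_left_mono mult_pos_pos) auto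
    \<comment> \<open>Criticality expresses s through p and q; replacing q by the larger p lowers
      the value to 1 / (p - 1). This is where q \<le> p decides which integral may carry the weight
      \<tau>.\<close>
    ultimately have s1: "1 / (p - 1) \<le> s" by simp
    define d where "d = (A * A powr (1 / q)) powr (- (p * q))"
    have d: "0 < d" using A by (simp add: d_def)
    obtain B where B: "0 < B" "\<And>(z :: nat \<Rightarrow> real) J. 0 < z 0 \<Longrightarrow>
       (\<And>j. j < J \<Longrightarrow> z j + d * z j powr (p * q) \<le> z (Suc j)) \<Longrightarrow> (\<And>j. j \<le> J \<Longrightarrow> z j \<le> b) \<Longrightarrow>
       real J \<le> B * z 0 powr (1 - p * q)"
      using superlinear_recursion_bound[OF d b pq] by blast
    \<comment> \<open>The 2 absorbs the additive 2 of \<open>T_le_of_dyadic_bound\<close>.\<close>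
    define K where "K = max 2 (B * c powr (1 - p * q))"
    have K: "0 < K" by (simp add: K_def)
    show ?thesis
    proof (rule that[OF K])
      fix M :: "'b measure" and tt W T f g \<epsilon>
      assume cw: "cone_weight M tt W s C0 T" and e: "0 < \<epsilon>"
        and fg: "cone_weight.coupled M tt W T k p (c * \<epsilon>) q C f g" and gf: "cone_weight.coupled M tt W T k q (c * \<epsilon>) p C g f"
      interpret cone_weight M tt W s C0 T by (rule cw)
      have u: "0 < c * \<epsilon>" using c e by simp
      define z where "z = (\<lambda>j::nat. c * \<epsilon> + X k p f (2 ^ Suc j - 1))"
      have "T \<le> exp (B * (c * \<epsilon>) powr (1 - p * q) + 2)"
      proof (rule T_le_of_dyadic_bound)
        fix J :: nat assume J: "2 ^ Suc J - 1 < T"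
        have "real J \<le> B * z 0 powr (1 - p * q)"
        proof (rule B(2))
          show "0 < z 0" using u X_nonneg by (simp add: z_def add_pos_nonneg)
          show "z j + d * z j powr (p * q) \<le> z (Suc j)" if "j < J" for j
            unfolding z_def d_def A_def
            by (intro critical_step[OF fg gf C u p s1 q(1) k] dyadic_times[OF J] 2) (use that in auto)
          show "z j \<le> b" if "j \<le> J" for j
            using coupled_bound[OF fg gf C u p q(1) k dyadic_times(1,2)[OF J that]] 2 one_le_power[of "2::real" "Suc j"]
            by (simp add: bnd_def A_def[symmetric] b_def[symmetric] z_def)
        qed
        also have "\<dots> \<le> B * (c * \<epsilon>) powr (1 - p * q)"
          using B(1) u X_nonneg pq by (intro mult_left_mono powr_mono2') (auto simp: z_def)
        finally show "real J \<le> B * (c * \<epsilon>) powr (1 - p * q)" .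
      qed (use B in auto)
      also have "\<dots> \<le> exp (K * (1 + \<epsilon> powr (- (p * q - 1))))"
      proof -
        have "B * (c * \<epsilon>) powr (1 - p * q) = (B * c powr (1 - p * q)) * \<epsilon> powr (- (p * q - 1))"
          using c e by (simp add: powr_mult)
        also have "\<dots> \<le> K * \<epsilon> powr (- (p * q - 1))" by (intro mult_right_mono) (auto simp: K_def)
        finally have "B * (c * \<epsilon>) powr (1 - p * q) + 2 \<le> K * \<epsilon> powr (- (p * q - 1)) + K"
          by (intro add_mono) (auto simp: K_def)
        then show ?thesis by (simp add: algebra_simps)
      qed
      finally show "T \<le> (if 0 < Gam s p q then 1 + K * \<epsilon> powr (- (1 / Gam s p q))
           else if p \<noteq> q then exp (K * (1 + \<epsilon> powr (- (p * q - 1))))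
           else exp (K * (1 + \<epsilon> powr (- (p - 1)))))"
        using 2 by simp
    qed
  next
    case 3
    have "s = (p + 1) / (p * p - 1)" using 3 by (simp add: Gam_def)
    moreover note inverse_minus_one_eq[OF p]
    ultimately have s1: "1 / (p - 1) = s" by simp
    define d where "d = A powr (- p)"
    have d: "0 < d" using A by (simp add: d_def)
    obtain B where B: "0 < B" "\<And>(z :: nat \<Rightarrow> real) J. 0 < z 0 \<Longrightarrow>
       (\<And>j. j < J \<Longrightarrow> z j + d * z j powr p \<le> z (Suc j)) \<Longrightarrow> (\<And>j. j \<le> J \<Longrightarrow> z j \<le> b) \<Longrightarrow>
       real J \<le> B * z 0 powr (1 - p)"
      using superlinear_recursion_bound[OF d b p] by blast
    define K where "K = max 2 (B * c powr (1 - p))"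
    have K: "0 < K" by (simp add: K_def)
    show ?thesis
    proof (rule that[OF K])
      fix M :: "'b measure" and tt W T f g \<epsilon>
      assume cw: "cone_weight M tt W s C0 T" and e: "0 < \<epsilon>"
        and fg: "cone_weight.coupled M tt W T k p (c * \<epsilon>) q C f g" and gf: "cone_weight.coupled M tt W T k q (c * \<epsilon>) p C g f"
      interpret cone_weight M tt W s C0 T by (rule cw)
      note fg' = fg[folded \<open>p = q\<close>] and gf' = gf[folded \<open>p = q\<close>]
      have u: "0 < c * \<epsilon>" using c e by simp
      \<comment> \<open>Each function is pushed up by the size of the other one, so the minimum of
        the two integrals satisfies a closed recursion.\<close>
      define z where "z = (\<lambda>j::nat. c * \<epsilon> + min (X k p f (2 ^ Suc j - 1)) (X k p g (2 ^ Suc j - 1)))"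
      have z0: "c * \<epsilon> \<le> z j" for j using X_nonneg by (simp add: z_def)
      have "T \<le> exp (B * (c * \<epsilon>) powr (1 - p) + 2)"
      proof (rule T_le_of_dyadic_bound)
        fix J :: nat assume J: "2 ^ Suc J - 1 < T"
        have "real J \<le> B * z 0 powr (1 - p)"
        proof (rule B(2))
          show "0 < z 0" using u z0[of 0] by linarith
          show "z j + d * z j powr p \<le> z (Suc j)" if j: "j < J" for j
          proof -
            have *: "1 \<le> (2::real) ^ Suc j - 1" "2 ^ Suc (Suc j) - 1 < T"
              using j by (intro dyadic_times[OF J]; simp)+
            have "d * z j powr p \<le> d * (c * \<epsilon> + X k p f (2 ^ Suc j - 1)) powr p"
              "d * z j powr p \<le> d * (c * \<epsilon> + X k p g (2 ^ Suc j - 1)) powr p"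
              using d p u z0[of j] by (auto intro!: mult_left_mono powr_mono2 simp: z_def)
            moreover note critical_step_eq[OF fg' C u p s1 k(1) * dyadic_times(3)[OF J], folded A_def, folded d_def]
              critical_step_eq[OF gf' C u p s1 k(1) * dyadic_times(3)[OF J], folded A_def, folded d_def]
            ultimately show ?thesis unfolding z_def by linarith
          qed
          show "z j \<le> b" if "j \<le> J" for j
          proof -
            have "z j \<le> c * \<epsilon> + X k p f (2 ^ Suc j - 1)" by (simp add: z_def)
            also have "\<dots> \<le> b"
              using coupled_bound[OF fg gf C u p q(1) k dyadic_times(1,2)[OF J that]] 3(1) one_le_power[of "2::real" "Suc j"]
              by (simp add: bnd_def A_def[symmetric] b_def[symmetric])
            finally show ?thesis .
          qed
        qed
        also have "\<dots> \<le> B * (c * \<epsilon>) powr (1 - p)"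
          using B(1) u z0 p by (intro mult_left_mono powr_mono2') auto
        finally show "real J \<le> B * (c * \<epsilon>) powr (1 - p)" .
      qed (use B in auto)
      also have "\<dots> \<le> exp (K * (1 + \<epsilon> powr (- (p - 1))))"
      proof -
        have "B * (c * \<epsilon>) powr (1 - p) = (B * c powr (1 - p)) * \<epsilon> powr (- (p - 1))"
          using c e by (simp add: powr_mult)
        also have "\<dots> \<le> K * \<epsilon> powr (- (p - 1))" by (intro mult_right_mono) (auto simp: K_def)
        finally have "B * (c * \<epsilon>) powr (1 - p) + 2 \<le> K * \<epsilon> powr (- (p - 1)) + K"
          by (intro add_mono) (auto simp: K_def)
        then show ?thesis by (simp add: algebra_simps)
      qed
      finally show "T \<le> (if 0 < Gam s p q then 1 + K * \<epsilon> powr (- (1 / Gam s p q))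
           else if p \<noteq> q then exp (K * (1 + \<epsilon> powr (- (p * q - 1))))
           else exp (K * (1 + \<epsilon> powr (- (p - 1)))))"
        using 3 by simp
    qed
  qed
qed

section \<open>Weak solutions as a pairing in time\<close>

lemma is_L2_cmult:
  fixes f :: "'a::euclidean_space \<Rightarrow> real"
  assumes "is_L2 f" shows "is_L2 (\<lambda>x. c * f x)"
  using assms by (auto simp: is_L2_def power_mult_distrib)

lemma is_L2_diff:
  fixes f g :: "'a::euclidean_space \<Rightarrow> real"
  assumes "is_L2 f" "is_L2 g" shows "is_L2 (\<lambda>x. f x - g x)"
proof -
  have [measurable]: "f \<in> borel_measurable borel" "g \<in> borel_measurable borel"
    using assms by (auto simp: is_L2_def)
  have "integrable lborel (\<lambda>x. (norm (f x - g x))\<^sup>2)"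
  proof (rule Bochner_Integration.integrable_bound)
    show "integrable lborel (\<lambda>x. 2 * (norm (f x))\<^sup>2 + 2 * (norm (g x))\<^sup>2)"
      using assms by (auto simp: is_L2_def)
    show "AE x in lborel. norm ((norm (f x - g x))\<^sup>2) \<le> norm (2 * (norm (f x))\<^sup>2 + 2 * (norm (g x))\<^sup>2)"
    proof (rule AE_I2)
      fix x
      have "(f x - g x)\<^sup>2 \<le> 2 * (f x)\<^sup>2 + 2 * (g x)\<^sup>2"
        using zero_le_power2[of "f x + g x"] by (simp add: power2_eq_square algebra_simps)
      then show "norm ((norm (f x - g x))\<^sup>2) \<le> norm (2 * (norm (f x))\<^sup>2 + 2 * (norm (g x))\<^sup>2)"
        by simp
    qed
  qed measurable
  then show ?thesis by (simp add: is_L2_def)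
qed

lemma is_L2_bounded_support:
  fixes h :: "'a::euclidean_space \<Rightarrow> real"
  assumes [measurable]: "h \<in> borel_measurable borel" and "\<And>x. \<bar>h x\<bar> \<le> K" "\<And>x. L < norm x \<Longrightarrow> h x = 0"
  shows "is_L2 h"
proof -
  have "integrable lborel (\<lambda>x. (norm (h x))\<^sup>2)"
  proof (rule Bochner_Integration.integrable_bound)
    show "integrable lborel (\<lambda>x. indicator (cball (0::'a) L) x * K\<^sup>2)"
      by (intro integrable_mult_left integrable_real_indicator) (auto simp: emeasure_bounded_finite[simplified])
    show "AE x in lborel. norm ((norm (h x))\<^sup>2) \<le> norm (indicator (cball (0::'a) L) x * K\<^sup>2)"
    proof (rule AE_I2)
      fix x
      have "\<bar>h x\<bar> \<le> \<bar>K\<bar>" using assms(2)[of x] by linarith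
      then have "(h x)\<^sup>2 \<le> K\<^sup>2" by (simp add: abs_le_square_iff)
      then show "norm ((norm (h x))\<^sup>2) \<le> norm (indicator (cball (0::'a) L) x * K\<^sup>2)"
        using assms(3)[of x] by (cases "norm x \<le> L") (auto simp: indicator_def)
    qed
  qed measurable
  then show ?thesis by (simp add: is_L2_def)
qed

lemma L2_pairing:
  fixes f g :: "'a::euclidean_space \<Rightarrow> real"
  assumes "is_L2 f" "is_L2 g"
  shows "integrable lborel (\<lambda>x. f x * g x)" "\<bar>\<integral>x. f x * g x \<partial>lborel\<bar> \<le> L2norm f * L2norm g"
proof -
  have [measurable]: "f \<in> borel_measurable borel" "g \<in> borel_measurable borel"
    using assms by (auto simp: is_L2_def)
  have i: "integrable lborel (\<lambda>x. (f x)\<^sup>2)" "integrable lborel (\<lambda>x. (g x)\<^sup>2)"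
    using assms by (auto simp: is_L2_def)
  have eq: "((f x)\<^sup>2) powr (1/2) * ((g x)\<^sup>2) powr (1 - 1/2) = \<bar>f x * g x\<bar>" for x
    by (simp add: powr_half_sqrt abs_mult)
  note H = Hoelder_powr[OF i(1) _ i(2), of "1/2", unfolded eq]
  have 1: "integrable lborel (\<lambda>x. \<bar>f x * g x\<bar>)" using H(1) by auto
  then show "integrable lborel (\<lambda>x. f x * g x)"
    by (rule Bochner_Integration.integrable_bound) auto
  have "\<bar>\<integral>x. f x * g x \<partial>lborel\<bar> \<le> (\<integral>x. \<bar>f x * g x\<bar> \<partial>lborel)"
    by (rule integral_abs_bound)
  also have "\<dots> \<le> L2norm f * L2norm g"
    using H(2) by (simp add: L2norm_def powr_half_sqrt)
  finally show "\<bar>\<integral>x. f x * g x \<partial>lborel\<bar> \<le> L2norm f * L2norm g" .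
qed

lemma C1_L2_pairing_derivative:
  fixes w wt :: "real \<Rightarrow> 'a::euclidean_space \<Rightarrow> real"
  assumes w: "C1_L2 T w wt" and h: "is_L2 h" and t: "t \<in> {0..<T}"
  shows "((\<lambda>t. \<integral>x. w t x * h x \<partial>lborel) has_real_derivative (\<integral>x. wt t x * h x \<partial>lborel)) (at t within {0..<T})"
proof -
  have L2: "is_L2 (w s)" "is_L2 (wt s)" if "s \<in> {0..<T}" for s
    using w that by (auto simp: C1_L2_def)
  let ?W = "\<lambda>t. \<integral>x. w t x * h x \<partial>lborel"
  let ?r = "\<lambda>s. L2norm (\<lambda>x. (w s x - w t x) / (s - t) - wt t x)"
  have bound: "norm ((?W s - ?W t) / (s - t) - (\<integral>x. wt t x * h x \<partial>lborel)) \<le> ?r s * L2norm h" if s: "s \<in> {0..<T}" for s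
  proof -
    have "is_L2 (\<lambda>x. inverse (s - t) * (w s x - w t x) - wt t x)"
      by (intro is_L2_diff is_L2_cmult L2 s t)
    then have l2: "is_L2 (\<lambda>x. (w s x - w t x) / (s - t) - wt t x)"
      by (simp add: divide_inverse mult.commute)
    have "(\<integral>x. ((w s x - w t x) / (s - t) - wt t x) * h x \<partial>lborel) =
        (\<integral>x. inverse (s - t) * (w s x * h x - w t x * h x) - wt t x * h x \<partial>lborel)"
      by (simp add: field_simps)
    also have "\<dots> = inverse (s - t) * (?W s - ?W t) - (\<integral>x. wt t x * h x \<partial>lborel)"
      using L2_pairing(1)[OF L2(1)[OF s] h] L2_pairing(1)[OF L2(1)[OF t] h] L2_pairing(1)[OF L2(2)[OF t] h]
      by simp
    finally show ?thesis
      using L2_pairing(2)[OF l2 h] by (simp add: divide_inverse mult.commute)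
  qed
  have "(?r \<longlongrightarrow> 0) (at t within {0..<T})" using w t by (auto simp: C1_L2_def)
  then have lim: "((\<lambda>s. ?r s * L2norm h) \<longlongrightarrow> 0) (at t within {0..<T})"
    by (rule tendsto_mult_left_zero)
  have "((\<lambda>s. (?W s - ?W t) / (s - t) - (\<integral>x. wt t x * h x \<partial>lborel)) \<longlongrightarrow> 0) (at t within {0..<T})"
    by (rule Lim_null_comparison[OF _ lim]) (use bound in \<open>auto simp: eventually_at_filter\<close>)
  then show ?thesis
    unfolding has_field_derivative_iff by (rule LIM_zero_cancel)
qed

lemma C1_L2_pairing_continuous:
  fixes w wt :: "real \<Rightarrow> 'a::euclidean_space \<Rightarrow> real"
  assumes w: "C1_L2 T w wt" and h: "is_L2 h"
  shows "continuous_on {0..<T} (\<lambda>t. \<integral>x. wt t x * h x \<partial>lborel)"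
  unfolding continuous_on_def
proof
  fix t assume t: "t \<in> {0..<T}"
  have L2: "is_L2 (wt s)" if "s \<in> {0..<T}" for s
    using w that by (auto simp: C1_L2_def)
  let ?r = "\<lambda>s. L2norm (\<lambda>x. wt s x - wt t x)"
  have bound: "norm ((\<integral>x. wt s x * h x \<partial>lborel) - (\<integral>x. wt t x * h x \<partial>lborel)) \<le> ?r s * L2norm h" if s: "s \<in> {0..<T}" for s
  proof -
    have "(\<integral>x. (wt s x - wt t x) * h x \<partial>lborel) = (\<integral>x. wt s x * h x \<partial>lborel) - (\<integral>x. wt t x * h x \<partial>lborel)"
      using L2_pairing(1)[OF L2[OF s] h] L2_pairing(1)[OF L2[OF t] h] by (simp add: left_diff_distrib)
    then show ?thesis
      using L2_pairing(2)[OF is_L2_diff[OF L2[OF s] L2[OF t]] h] by simp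
  qed
  have "(?r \<longlongrightarrow> 0) (at t within {0..<T})" using w t by (auto simp: C1_L2_def)
  then have lim: "((\<lambda>s. ?r s * L2norm h) \<longlongrightarrow> 0) (at t within {0..<T})"
    by (rule tendsto_mult_left_zero)
  have "((\<lambda>s. (\<integral>x. wt s x * h x \<partial>lborel) - (\<integral>x. wt t x * h x \<partial>lborel)) \<longlongrightarrow> 0) (at t within {0..<T})"
    by (rule Lim_null_comparison[OF _ lim]) (use bound in \<open>auto simp: eventually_at_filter\<close>)
  then show "((\<lambda>t. \<integral>x. wt t x * h x \<partial>lborel) \<longlongrightarrow> (\<integral>x. wt t x * h x \<partial>lborel)) (at t within {0..<T})"
    by (rule LIM_zero_cancel)
qed

text \<open>Backward difference quotients are used: for s < t both \<open>w s\<close> and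
  \<open>w t\<close> vanish beyond radius t + R, so there the error of the quotient is
  \<open>wt t\<close> up to sign. Its L2 norm over that region is thus bounded by a quantity tending
  to 0.\<close>

lemma time_derivative_support:
  fixes w wt :: "real \<Rightarrow> 'a::euclidean_space \<Rightarrow> real"
  assumes w: "C1_L2 T w wt" and supp: "\<And>t. t \<in> {0..<T} \<Longrightarrow> AE x in lborel. norm x > t + R \<longrightarrow> w t x = 0"
    and t: "0 < t" "t < T"
  shows "AE x in lborel. norm x > t + R \<longrightarrow> wt t x = 0"
proof -
  have L2: "is_L2 (w s)" "is_L2 (wt s)" if "s \<in> {0..<T}" for s
    using w that by (auto simp: C1_L2_def)
  have tT: "t \<in> {0..<T}" using t by auto
  have [measurable]: "wt t \<in> borel_measurable borel" using L2(2)[OF tT] by (simp add: is_L2_def)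
  define A where "A = {x::'a. norm x > t + R}"
  have [measurable]: "A \<in> sets borel" unfolding A_def by measurable
  let ?q = "\<lambda>s x. (w s x - w t x) / (s - t) - wt t x"
  let ?I = "\<integral>x. indicator A x * (wt t x)\<^sup>2 \<partial>lborel"
  have iA: "integrable lborel (\<lambda>x. indicator A x * (wt t x)\<^sup>2)"
    by (rule Bochner_Integration.integrable_bound[of _ "\<lambda>x. (wt t x)\<^sup>2"])
      (use L2(2)[OF tT] in \<open>auto simp: is_L2_def indicator_def\<close>)
  have le: "sqrt ?I \<le> L2norm (?q s)" if s: "s \<in> {0..<t}" for s
  proof -
    have sT: "s \<in> {0..<T}" using s t by auto
    have "is_L2 (\<lambda>x. inverse (s - t) * (w s x - w t x) - wt t x)"
      by (intro is_L2_diff is_L2_cmult L2 sT tT)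
    then have l2: "is_L2 (?q s)"
      by (simp add: divide_inverse mult.commute)
    have ae: "AE x in lborel. indicator A x * (wt t x)\<^sup>2 \<le> (norm (?q s x))\<^sup>2"
      using supp[OF sT] supp[OF tT]
    proof eventually_elim
      case (elim x)
      show ?case
      proof (cases "x \<in> A")
        case True
        then have "w s x = 0" "w t x = 0" using elim s by (auto simp: A_def)
        then show ?thesis using True by simp
      qed simp
    qed
    have "?I \<le> (\<integral>x. (norm (?q s x))\<^sup>2 \<partial>lborel)"
      by (rule integral_mono_AE[OF iA _ ae]) (use l2 in \<open>simp add: is_L2_def\<close>)
    then show ?thesis by (simp add: L2norm_def)
  qed
  have "((\<lambda>s. L2norm (?q s)) \<longlongrightarrow> 0) (at t within {0..<T})" using w tT by (auto simp: C1_L2_def)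
  then have "((\<lambda>s. L2norm (?q s)) \<longlongrightarrow> 0) (at t within {0..t})"
    by (rule tendsto_within_subset) (use t in auto)
  then have "((\<lambda>s. L2norm (?q s)) \<longlongrightarrow> 0) (at_left t)"
    using at_within_Icc_at_left[OF t(1)] by simp
  moreover have "\<forall>\<^sub>F s in at_left t. sqrt ?I \<le> L2norm (?q s)"
    using t(1) le unfolding eventually_at_left_field by (intro exI[of _ 0]) auto
  ultimately have "sqrt ?I \<le> 0"
    by (intro tendsto_lowerbound) auto
  moreover have "0 \<le> ?I" by (intro Bochner_Integration.integral_nonneg) auto
  ultimately have "?I = 0" by simp
  then have "AE x in lborel. indicator A x * (wt t x)\<^sup>2 = 0"
    using integral_nonneg_eq_0_iff_AE[OF iA] by auto
  then show ?thesis
    by eventually_elim (auto simp: A_def indicator_def)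
qed

lemma set_integral_strip_Fubini:
  fixes F :: "real \<times> 'a::euclidean_space \<Rightarrow> real"
  assumes "set_integrable lborel ({0<..<T} \<times> UNIV) F"
  shows "(LINT z:{0<..<T} \<times> UNIV|lborel. F z) = (LINT t:{0<..<T}|lborel. (\<integral>x. F (t, x) \<partial>lborel))"
proof -
  have i: "integrable (lborel \<Otimes>\<^sub>M lborel) (\<lambda>z. indicator ({0<..<T} \<times> UNIV) z *\<^sub>R F z)"
    using assms unfolding set_integrable_def lborel_prod .
  have "(LINT z:{0<..<T} \<times> UNIV|lborel. F z) = (\<integral>t. \<integral>x. indicator ({0<..<T} \<times> (UNIV::'a set)) (t, x) *\<^sub>R F (t, x) \<partial>lborel \<partial>lborel)"
    unfolding set_lebesgue_integral_def using lborel_pair.integral_fst'[OF i] by (simp add: lborel_prod)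
  also have "\<dots> = (\<integral>t. indicator {0<..<T} t *\<^sub>R (\<integral>x. F (t, x) \<partial>lborel) \<partial>lborel)"
    by (intro Bochner_Integration.integral_cong refl) (simp add: indicator_times)
  finally show ?thesis by (simp add: set_lebesgue_integral_def)
qed

section \<open>Product test functions and local integrability\<close>

lemma esm_deriv:
  fixes \<theta> :: "real \<Rightarrow> real"
  assumes "esm \<theta>"
  shows "(\<theta> has_real_derivative frechet_derivative \<theta> (at t) 1) (at t)"
proof -
  have d: "(\<theta> has_derivative frechet_derivative \<theta> (at t)) (at t)"
    using esm_differentiable[OF assms] frechet_derivative_works by blast
  moreover have "frechet_derivative \<theta> (at t) y = y * frechet_derivative \<theta> (at t) 1" for y
    using linear_frechet_derivative[OF esm_differentiable[OF assms], of t, THEN linear_cmul, of y 1] by simp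
  ultimately show ?thesis
    unfolding has_field_derivative_def by (metis (no_types, lifting) ext mult.commute)
qed

lemma frechet_derivative_product_fun:
  fixes \<theta> :: "real \<Rightarrow> real" and \<zeta> :: "'a::euclidean_space \<Rightarrow> real"
  assumes "esm \<theta>" "esm \<zeta>"
  shows "frechet_derivative (\<lambda>z. \<theta> (fst z) * \<zeta> (snd z)) (at (t, x)) (a, y) =
    a * frechet_derivative \<theta> (at t) 1 * \<zeta> x + \<theta> t * frechet_derivative \<zeta> (at x) y"
proof -
  have 1: "((\<lambda>z. \<theta> (fst z)) has_derivative (\<lambda>v. frechet_derivative \<theta> (at t) 1 * fst v)) (at (t, x))"
    using has_derivative_compose[of fst fst "(t, x)" UNIV \<theta> "\<lambda>v. frechet_derivative \<theta> (at t) 1 * v"]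
      esm_deriv[OF assms(1), of t] unfolding has_field_derivative_def
    by (auto intro: bounded_linear_imp_has_derivative bounded_linear_fst)
  have 2: "((\<lambda>z. \<zeta> (snd z)) has_derivative (\<lambda>v. frechet_derivative \<zeta> (at x) (snd v))) (at (t, x))"
    using has_derivative_compose[of snd snd "(t, x)" UNIV \<zeta> "frechet_derivative \<zeta> (at x)"]
      esm_differentiable[OF assms(2), of x] unfolding frechet_derivative_works
    by (auto intro: bounded_linear_imp_has_derivative bounded_linear_snd)
  show ?thesis
    using frechet_derivative_at[OF has_derivative_mult[OF 1 2], symmetric] by (simp add: algebra_simps)
qed

lemma test_fun_product:
  fixes \<theta> :: "real \<Rightarrow> real" and \<zeta> :: "'a::euclidean_space \<Rightarrow> real"
  assumes "esm \<theta>" "esm \<zeta>" "b < T" "\<And>t. b \<le> \<bar>t\<bar> \<Longrightarrow> \<theta> t = 0" "\<And>x. L \<le> norm x \<Longrightarrow> \<zeta> x = 0"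
  shows "test_fun T (\<lambda>z. \<theta> (fst z) * \<zeta> (snd z))"
proof -
  have "esm (\<lambda>z::real \<times> 'a. \<theta> (fst z) * \<zeta> (snd z))"
    by (intro esm_mult esm_compose_linear[OF assms(1)] esm_compose_linear[OF assms(2)] bounded_linear_fst bounded_linear_snd)
  moreover have "compact ({-b..b} \<times> cball (0::'a) L)" by (intro compact_Times) auto
  moreover have "\<theta> (fst z) * \<zeta> (snd z) = 0" if "z \<notin> {-b..b} \<times> cball (0::'a) L" for z
    using that assms(4)[of "fst z"] assms(5)[of "snd z"] by (cases z) (auto simp: abs_real_def split: if_splits)
  ultimately show ?thesis
    unfolding test_fun_def using assms(3)
    by (intro conjI esm_imp_smooth_fun exI[of _ "{-b..b} \<times> cball (0::'a) L"]) auto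
qed

definition laplace :: "('a::euclidean_space \<Rightarrow> real) \<Rightarrow> 'a \<Rightarrow> real" where
  "laplace \<zeta> x = (\<Sum>e\<in>Basis. frechet_derivative (\<lambda>y. frechet_derivative \<zeta> (at y) e) (at x) e)"

lemma esm_laplace: "esm \<zeta> \<Longrightarrow> esm (laplace \<zeta>)"
  unfolding laplace_def[abs_def] by (intro esm_sum esm_frechet_derivative)

text \<open>The strict inequality provides an open neighbourhood on which the function vanishes; it
  accounts for the radii \<open>L + 1\<close> in later support statements.\<close>

lemma frechet_derivative_eq_0_outside:
  fixes f :: "'a::real_normed_vector \<Rightarrow> real"
  assumes "\<And>x. L \<le> norm x \<Longrightarrow> f x = 0" "L < norm x"
  shows "frechet_derivative f (at x) e = 0"
proof -
  have "((\<lambda>_. 0) has_derivative (\<lambda>_. 0)) (at x)" by (rule has_derivative_const)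
  then have "(f has_derivative (\<lambda>_. 0)) (at x)"
    by (rule has_derivative_transform_within_open[where s = "{y. L < norm y}"])
      (use assms in \<open>auto intro!: open_Collect_less continuous_intros\<close>)
  then show ?thesis
    using frechet_derivative_at by metis
qed

lemma continuous_support_bounded:
  fixes f :: "'a::euclidean_space \<Rightarrow> real"
  assumes "continuous_on UNIV f" "\<And>x. L < norm x \<Longrightarrow> f x = 0"
  obtains K where "0 \<le> K" "\<And>x. \<bar>f x\<bar> \<le> K"
proof -
  have "compact (f ` cball 0 L)"
    by (intro compact_continuous_image continuous_on_subset[OF assms(1)]) auto
  then obtain K where K: "\<forall>y\<in>f ` cball 0 L. norm y \<le> K"
    using compact_imp_bounded bounded_iff by blast
  have "\<bar>f x\<bar> \<le> max K 0" for x
  proof (cases "norm x \<le> L")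
    case True
    then show ?thesis using K by (auto simp: max.coboundedI1)
  next
    case False
    then show ?thesis using assms(2)[of x] by simp
  qed
  then show ?thesis using that[of "max K 0"] by auto
qed

lemma is_L2_continuous_support:
  fixes h :: "'a::euclidean_space \<Rightarrow> real"
  assumes "continuous_on UNIV h" "\<And>x. L < norm x \<Longrightarrow> h x = 0"
  shows "is_L2 h"
proof -
  obtain K where "\<And>x. \<bar>h x\<bar> \<le> K" using continuous_support_bounded[OF assms] by blast
  then show ?thesis
    using assms by (intro is_L2_bounded_support[of h K L]) (auto intro: borel_measurable_continuous_onI)
qed

text \<open>The boxes reach down to time 0 and stay away only from T, unlike the compact subsets of
  the open strip in \<open>Lp_loc\<close>: the test functions of \<open>weak_eq\<close> need not
  vanish at time 0.\<close>

definition loc_int :: "real \<Rightarrow> (real \<times> 'a::euclidean_space \<Rightarrow> real) \<Rightarrow> bool" where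
  "loc_int T F \<longleftrightarrow> (\<forall>b L. b < T \<longrightarrow> set_integrable lborel ({0<..b} \<times> cball 0 L) F)"

lemma loc_int_mult:
  assumes F: "loc_int T F" and b: "b < T" and [measurable]: "G \<in> borel_measurable borel"
    and "\<And>z. \<bar>G z\<bar> \<le> K" "\<And>z. b < fst z \<or> L < norm (snd z) \<Longrightarrow> G z = 0"
  shows "set_integrable lborel ({0<..<T} \<times> UNIV) (\<lambda>z. F z * G z)"
proof -
  have i: "integrable lborel (\<lambda>z. indicator ({0<..b} \<times> cball 0 L) z *\<^sub>R F z)"
    using F b by (simp add: loc_int_def set_integrable_def)
  then have [measurable]: "(\<lambda>z. indicator ({0<..b} \<times> cball 0 L) z *\<^sub>R F z) \<in> borel_measurable borel"
    by simp
  have "integrable lborel (\<lambda>z. (indicator ({0<..b} \<times> cball 0 L) z *\<^sub>R F z) * G z)"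
  proof (rule Bochner_Integration.integrable_bound[OF integrable_mult_left[OF i, of K]])
    show "AE z in lborel. norm ((indicator ({0<..b} \<times> cball 0 L) z *\<^sub>R F z) * G z) \<le> norm ((indicator ({0<..b} \<times> cball 0 L) z *\<^sub>R F z) * K)"
    proof (rule AE_I2)
      fix z
      have "\<bar>G z\<bar> \<le> \<bar>K\<bar>" using assms(4)[of z] by linarith
      then show "norm ((indicator ({0<..b} \<times> cball 0 L) z *\<^sub>R F z) * G z) \<le> norm ((indicator ({0<..b} \<times> cball 0 L) z *\<^sub>R F z) * K)"
        unfolding norm_mult by (intro mult_left_mono) auto
    qed
  qed measurable
  also have "(\<lambda>z. (indicator ({0<..b} \<times> cball 0 L) z *\<^sub>R F z) * G z) = (\<lambda>z. indicator ({0<..<T} \<times> UNIV) z *\<^sub>R (F z * G z))"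
  proof
    fix z :: "real \<times> 'a"
    show "(indicator ({0<..b} \<times> cball 0 L) z *\<^sub>R F z) * G z = indicator ({0<..<T} \<times> UNIV) z *\<^sub>R (F z * G z)"
      using assms(5)[of z] b by (cases z; cases "b < fst z \<or> L < norm (snd z)") (auto simp: indicator_def)
  qed
  finally show ?thesis by (simp add: set_integrable_def)
qed

text \<open>One scalar equation whose source is an arbitrary nonnegative function \<open>N\<close>,
  so that both components of the system are instances.\<close>

locale weak_wave =
  fixes T \<epsilon> R :: real and D V w0 w1 :: "'a::euclidean_space \<Rightarrow> real"
    and N w wt :: "real \<Rightarrow> 'a \<Rightarrow> real" and gw :: "real \<Rightarrow> 'a \<Rightarrow> 'a"
  assumes T: "0 < T" and H1: "C_H1 T w gw" and C1: "C1_L2 T w wt"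
    and wt_meas: "(\<lambda>z. wt (fst z) (snd z)) \<in> borel_measurable borel"
    and N_nonneg: "\<And>t x. 0 \<le> N t x"
    and init: "AE x in lborel. w 0 x = \<epsilon> * w0 x"
    and eq: "weak_eq T \<epsilon> D V w0 w1 N w wt gw"
    and supp: "\<And>t. t \<in> {0..<T} \<Longrightarrow> AE x in lborel. norm x > t + R \<longrightarrow> w t x = 0"
    and R: "0 < R"
    and coeff: "continuous_on UNIV D" "continuous_on UNIV V"
    and data: "continuous_on UNIV w0" "continuous_on UNIV w1"
      "\<And>x. norm x > R \<Longrightarrow> w0 x = 0" "\<And>x. norm x > R \<Longrightarrow> w1 x = 0"
begin

text \<open>The last property serves \<open>wt\<close>: the weak equation gives integrability of
  \<open>wt\<close> only against time derivatives of test functions, and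
  \<open>t * \<theta> t\<close> has derivative 1 on (0, b].\<close>

lemma cutoffs:
  assumes "b < T"
  obtains \<theta> :: "real \<Rightarrow> real" and \<zeta> :: "'a \<Rightarrow> real" and b' L' where "esm \<theta>" "esm \<zeta>" "b' < T"
    "\<And>t. b' \<le> \<bar>t\<bar> \<Longrightarrow> \<theta> t = 0" "\<And>x. L' \<le> norm x \<Longrightarrow> \<zeta> x = 0"
    "\<And>t. 0 < t \<Longrightarrow> t \<le> b \<Longrightarrow> \<theta> t = 1" "\<And>x. norm x \<le> L \<Longrightarrow> \<zeta> x = 1"
    "\<And>t. 0 < t \<Longrightarrow> t \<le> b \<Longrightarrow> frechet_derivative (\<lambda>t. t * \<theta> t) (at t) 1 = 1"
proof -
  define a where "a = (max b 0 + T) / 2"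
  have a: "0 < a" "a < (a + T) / 2" "(a + T) / 2 < T" "b < a" using assms T by (auto simp: a_def max_def)
  obtain \<theta> :: "real \<Rightarrow> real" where \<theta>: "esm \<theta>" "\<And>x. 0 \<le> \<theta> x" "\<And>x. \<theta> x \<le> 1" "\<And>x. norm x \<le> a \<Longrightarrow> \<theta> x = 1" "\<And>x. (a + T) / 2 \<le> norm x \<Longrightarrow> \<theta> x = 0"
    using a esm_cutoff[OF less_imp_le[OF a(1)] a(2), where 'a = real] by metis
  obtain \<zeta> :: "'a \<Rightarrow> real" where \<zeta>: "esm \<zeta>" "\<And>x. 0 \<le> \<zeta> x" "\<And>x. \<zeta> x \<le> 1" "\<And>x. norm x \<le> max L 0 \<Longrightarrow> \<zeta> x = 1" "\<And>x. max L 0 + 1 \<le> norm x \<Longrightarrow> \<zeta> x = 0"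
    using esm_cutoff[OF max.cobounded2[of 0 L] less_add_one, where 'a = 'a] by metis
  have "frechet_derivative (\<lambda>t. t * \<theta> t) (at t) 1 = 1" if "0 < t" "t \<le> b" for t
  proof -
    have "((\<lambda>t::real. t) has_derivative (\<lambda>v. v)) (at t)" by (rule has_derivative_ident)
    then have "((\<lambda>t. t * \<theta> t) has_derivative (\<lambda>v. v)) (at t)"
      by (rule has_derivative_transform_within_open[where s = "{-a<..<a}"]) (use that a \<theta>(4) in auto)
    from frechet_derivative_at[OF this] show ?thesis by metis
  qed
  then show ?thesis
    using \<theta> \<zeta> a by (intro that[of \<theta> \<zeta> "(a + T) / 2" "max L 0 + 1"]) auto
qed

lemma N_loc_int: "loc_int T (\<lambda>z. N (fst z) (snd z))"
  unfolding loc_int_def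
proof (intro allI impI)
  fix b L :: real assume "b < T"
  then obtain \<theta> :: "real \<Rightarrow> real" and \<zeta> :: "'a \<Rightarrow> real" and b' L' where c: "esm \<theta>" "esm \<zeta>" "b' < T"
    "\<And>t. b' \<le> \<bar>t\<bar> \<Longrightarrow> \<theta> t = 0" "\<And>x. L' \<le> norm x \<Longrightarrow> \<zeta> x = 0"
    "\<And>t. 0 < t \<Longrightarrow> t \<le> b \<Longrightarrow> \<theta> t = 1" "\<And>x. norm x \<le> L \<Longrightarrow> \<zeta> x = 1"
    by (rule cutoffs[of b L]) blast
  have "set_integrable lborel ({0<..<T} \<times> UNIV) (\<lambda>(t,x). N t x * (\<theta> t * \<zeta> x))"
    using eq test_fun_product[OF c(1-5)] unfolding weak_eq_def by fastforce
  then have "set_integrable lborel ({0<..b} \<times> cball 0 L) (\<lambda>(t,x). N t x * (\<theta> t * \<zeta> x))"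
    by (rule set_integrable_subset) (use \<open>b < T\<close> in \<open>auto intro!: borel_Times\<close>)
  then show "set_integrable lborel ({0<..b} \<times> cball 0 L) (\<lambda>z. N (fst z) (snd z))"
    by (rule iffD1[OF set_integrable_cong, rotated -1]) (auto simp: c)
qed

lemma wt_loc_int: "loc_int T (\<lambda>z. wt (fst z) (snd z))"
  unfolding loc_int_def
proof (intro allI impI)
  fix b L :: real assume "b < T"
  then obtain \<theta> :: "real \<Rightarrow> real" and \<zeta> :: "'a \<Rightarrow> real" and b' L' where c: "esm \<theta>" "esm \<zeta>" "b' < T"
    "\<And>t. b' \<le> \<bar>t\<bar> \<Longrightarrow> \<theta> t = 0" "\<And>x. L' \<le> norm x \<Longrightarrow> \<zeta> x = 0"
    "\<And>t. 0 < t \<Longrightarrow> t \<le> b \<Longrightarrow> \<theta> t = 1" "\<And>x. norm x \<le> L \<Longrightarrow> \<zeta> x = 1"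
    and d: "\<And>t. 0 < t \<Longrightarrow> t \<le> b \<Longrightarrow> frechet_derivative (\<lambda>t. t * \<theta> t) (at t) 1 = 1"
    by (rule cutoffs[of b L]) blast
  have e: "esm (\<lambda>t. t * \<theta> t)" by (intro esm_mult c esm_linear bounded_linear_ident)
  have "set_integrable lborel ({0<..<T} \<times> UNIV)
      (\<lambda>(t,x). wt t x * frechet_derivative (\<lambda>z. (\<lambda>t. t * \<theta> t) (fst z) * \<zeta> (snd z)) (at (t,x)) (1,0))"
    using eq test_fun_product[OF e c(2,3) _ c(5)] c(4) unfolding weak_eq_def by fastforce
  then have "set_integrable lborel ({0<..<T} \<times> UNIV)
      (\<lambda>(t,x). wt t x * (frechet_derivative (\<lambda>t. t * \<theta> t) (at t) 1 * \<zeta> x))"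
    unfolding frechet_derivative_product_fun[OF e c(2)]
    by (simp add: linear_0 linear_frechet_derivative esm_differentiable c)
  then have "set_integrable lborel ({0<..b} \<times> cball 0 L)
      (\<lambda>(t,x). wt t x * (frechet_derivative (\<lambda>t. t * \<theta> t) (at t) 1 * \<zeta> x))"
    by (rule set_integrable_subset) (use \<open>b < T\<close> in \<open>auto intro!: borel_Times\<close>)
  then show "set_integrable lborel ({0<..b} \<times> cball 0 L) (\<lambda>z. wt (fst z) (snd z))"
    by (rule iffD1[OF set_integrable_cong, rotated -1]) (auto simp: c d)
qed

text \<open>\<open>\<Lambda>\<close> is differentiated only within [0, b] and may jump at 0, which
  admits both a smooth factor and \<open>tail\<close>. As \<open>\<Lambda>\<close> vanishes at b,
  the only boundary term is the one at time 0, where the initial condition enters.\<close>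

lemma integrate_by_parts:
  assumes b: "0 \<le> b" "b < T" and h: "continuous_on UNIV h" "\<And>x. L < norm x \<Longrightarrow> h x = 0"
    and \<Lambda>: "\<And>t. t \<in> {0..b} \<Longrightarrow> (\<Lambda> has_real_derivative ld t) (at t within {0..b})"
      "continuous_on {0..b} ld" "\<And>t. b \<le> t \<Longrightarrow> \<Lambda> t = 0" "\<And>t. b < t \<Longrightarrow> ld t = 0"
      "\<Lambda> \<in> borel_measurable borel" "\<And>t. \<bar>\<Lambda> t\<bar> \<le> K"
  shows "set_integrable lborel ({0<..<T} \<times> UNIV) (\<lambda>z. wt (fst z) (snd z) * (\<Lambda> (fst z) * h (snd z)))"
    and "(LINT t:{0<..<T}|lborel. ld t * (\<integral>x. w t x * h x \<partial>lborel)) =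
      - \<Lambda> 0 * (\<epsilon> * (\<integral>x. w0 x * h x \<partial>lborel)) - (LINT z:{0<..<T} \<times> UNIV|lborel. wt (fst z) (snd z) * (\<Lambda> (fst z) * h (snd z)))"
proof -
  obtain Kh where Kh: "0 \<le> Kh" "\<And>x. \<bar>h x\<bar> \<le> Kh" using continuous_support_bounded[OF h] by blast
  have [measurable]: "\<Lambda> \<in> borel_measurable borel" "h \<in> borel_measurable borel"
    using \<Lambda> h by (auto intro: borel_measurable_continuous_onI)
  show int: "set_integrable lborel ({0<..<T} \<times> UNIV) (\<lambda>z. wt (fst z) (snd z) * (\<Lambda> (fst z) * h (snd z)))"
  proof (rule loc_int_mult[OF wt_loc_int b(2), where K = "\<bar>K\<bar> * Kh" and L = L])
    show "\<bar>\<Lambda> (fst z) * h (snd z)\<bar> \<le> \<bar>K\<bar> * Kh" for z :: "real \<times> 'a"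
      unfolding abs_mult using \<Lambda>(6)[of "fst z"] Kh(2)[of "snd z"] by (intro mult_mono) auto
  next
    fix z :: "real \<times> 'a" assume "b < fst z \<or> L < norm (snd z)"
    then show "\<Lambda> (fst z) * h (snd z) = 0" using \<Lambda>(3)[of "fst z"] h(2)[of "snd z"] by auto
  next
    have "(\<lambda>z::real \<times> 'a. \<Lambda> (fst z) * h (snd z)) \<in> borel_measurable (borel \<Otimes>\<^sub>M borel)" by measurable
    then show "(\<lambda>z::real \<times> 'a. \<Lambda> (fst z) * h (snd z)) \<in> borel_measurable borel" by (simp add: borel_prod)
  qed
  have hL2: "is_L2 h" by (rule is_L2_continuous_support[OF h])
  let ?W = "\<lambda>t. \<integral>x. w t x * h x \<partial>lborel" and ?W' = "\<lambda>t. \<integral>x. wt t x * h x \<partial>lborel"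
  have sub: "{0..b} \<subseteq> {0..<T}" using b by auto
  have dW: "(?W has_real_derivative ?W' t) (at t within {0..b})" if "t \<in> {0..b}" for t
    by (rule DERIV_subset[OF C1_L2_pairing_derivative[OF C1 hL2] sub]) (use that sub in auto)
  have cW: "continuous_on {0..b} ?W"
    by (rule DERIV_continuous_on) (rule dW)
  have cW': "continuous_on {0..b} ?W'"
    by (rule continuous_on_subset[OF C1_L2_pairing_continuous[OF C1 hL2] sub])
  have c\<Lambda>: "continuous_on {0..b} \<Lambda>"
    by (rule DERIV_continuous_on) (rule \<Lambda>(1))
  have c1: "continuous_on {0..b} (\<lambda>t. ld t * ?W t)" and c2: "continuous_on {0..b} (\<lambda>t. \<Lambda> t * ?W' t)"
    by (intro continuous_on_mult \<Lambda>(2) cW cW' c\<Lambda>)+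
  have i1: "set_integrable lborel {0..b} (\<lambda>t. ld t * ?W t)" and i2: "set_integrable lborel {0..b} (\<lambda>t. \<Lambda> t * ?W' t)"
    using borel_integrable_compact[OF compact_Icc c1] borel_integrable_compact[OF compact_Icc c2]
    unfolding set_integrable_def by auto
  have "(\<integral>t. indicator {0..b} t *\<^sub>R (ld t * ?W t + \<Lambda> t * ?W' t) \<partial>lborel) = \<Lambda> b * ?W b - \<Lambda> 0 * ?W 0"
  proof (rule integral_FTC_Icc[OF b(1)])
    fix t assume "0 \<le> t" "t \<le> b"
    then have "((\<lambda>t. \<Lambda> t * ?W t) has_real_derivative ld t * ?W t + ?W' t * \<Lambda> t) (at t within {0..b})"
      by (intro DERIV_mult \<Lambda>(1) dW) auto
    then show "((\<lambda>t. \<Lambda> t * ?W t) has_vector_derivative (ld t * ?W t + \<Lambda> t * ?W' t)) (at t within {0..b})"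
      by (simp add: has_real_derivative_iff_has_vector_derivative mult.commute)
  qed (intro continuous_on_add c1 c2)
  then have "(LINT t:{0..b}|lborel. ld t * ?W t) + (LINT t:{0..b}|lborel. \<Lambda> t * ?W' t) = - \<Lambda> 0 * ?W 0"
    using \<Lambda>(3)[of b] set_integral_add(2)[OF i1 i2] by (simp add: set_lebesgue_integral_def)
  moreover have "?W 0 = \<epsilon> * (\<integral>x. w0 x * h x \<partial>lborel)"
  proof -
    have "is_L2 (w 0)" using C1 T by (auto simp: C1_L2_def)
    then have [measurable]: "w 0 \<in> borel_measurable borel" by (simp add: is_L2_def)
    have [measurable]: "w0 \<in> borel_measurable borel" using data by (auto intro: borel_measurable_continuous_onI)
    have "?W 0 = (\<integral>x. (\<epsilon> * w0 x) * h x \<partial>lborel)"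
      by (rule integral_cong_AE) (use init in \<open>auto elim: eventually_mono\<close>)
    then show ?thesis by (simp add: mult.assoc)
  qed
  \<comment> \<open>The fundamental theorem is used on the closed interval [0, b], the weak form
    lives on the open (0, T). They differ by the null set {0} and by times beyond b, where the
    integrands vanish.\<close>
  moreover have ae: "AE t in lborel. t \<noteq> (0::real)" by (rule AE_lborel_singleton)
  have "(LINT t:{0..b}|lborel. ld t * ?W t) = (LINT t:{0<..<T}|lborel. ld t * ?W t)"
  proof -
    have m: "(\<lambda>t. indicator {0..b} t *\<^sub>R (ld t * ?W t)) \<in> borel_measurable lborel"
      using i1 unfolding set_integrable_def by auto
    have eq: "indicator {0<..<T} t *\<^sub>R (ld t * ?W t) = indicator {0<..} t *\<^sub>R indicator {0..b} t *\<^sub>R (ld t * ?W t)" for t :: real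
      using \<Lambda>(4)[of t] b by (auto simp: indicator_def)
    show ?thesis
      unfolding set_lebesgue_integral_def eq
      by (rule integral_cong_AE) (use m ae in \<open>auto simp: indicator_def elim!: eventually_mono\<close>)
  qed
  moreover have "(LINT t:{0..b}|lborel. \<Lambda> t * ?W' t) = (LINT t:{0<..<T}|lborel. \<Lambda> t * ?W' t)"
  proof -
    have m: "(\<lambda>t. indicator {0..b} t *\<^sub>R (\<Lambda> t * ?W' t)) \<in> borel_measurable lborel"
      using i2 unfolding set_integrable_def by auto
    have eq: "indicator {0<..<T} t *\<^sub>R (\<Lambda> t * ?W' t) = indicator {0<..} t *\<^sub>R indicator {0..b} t *\<^sub>R (\<Lambda> t * ?W' t)" for t :: real
      using \<Lambda>(3)[of t] b by (auto simp: indicator_def)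
    show ?thesis
      unfolding set_lebesgue_integral_def eq
      by (rule integral_cong_AE) (use m ae in \<open>auto simp: indicator_def elim!: eventually_mono\<close>)
  qed
  moreover have "(LINT z:{0<..<T} \<times> UNIV|lborel. wt (fst z) (snd z) * (\<Lambda> (fst z) * h (snd z))) = (LINT t:{0<..<T}|lborel. \<Lambda> t * ?W' t)"
    unfolding set_integral_strip_Fubini[OF int] by (simp add: mult.left_commute)
  ultimately show "(LINT t:{0<..<T}|lborel. ld t * ?W t) =
      - \<Lambda> 0 * (\<epsilon> * (\<integral>x. w0 x * h x \<partial>lborel)) - (LINT z:{0<..<T} \<times> UNIV|lborel. wt (fst z) (snd z) * (\<Lambda> (fst z) * h (snd z)))"
    by simp
qed

text \<open>The weak gradient is tested with each partial derivative of \<open>\<zeta>\<close>, and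
  the results are summed over the basis.\<close>

lemma weak_laplace:
  assumes \<zeta>: "esm \<zeta>" "\<And>x. L \<le> norm x \<Longrightarrow> \<zeta> x = 0" and t: "t \<in> {0..<T}"
  shows "(\<integral>x. frechet_derivative \<zeta> (at x) (gw t x) \<partial>lborel) = - (\<integral>x. w t x * laplace \<zeta> x \<partial>lborel)"
proof -
  have w: "is_L2 (w t)" and g: "is_L2 (gw t)" and wg: "weak_grad (w t) (gw t)"
    using H1 t by (auto simp: C_H1_def is_H1_def)
  have [measurable]: "gw t \<in> borel_measurable borel" using g by (simp add: is_L2_def)
  define \<zeta>e where "\<zeta>e = (\<lambda>e x. frechet_derivative \<zeta> (at x) e)"
  have e1: "esm (\<zeta>e e)" for e unfolding \<zeta>e_def by (intro esm_frechet_derivative \<zeta>)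
  have z1: "\<zeta>e e x = 0" if "L + 1 \<le> norm x" for e x
    unfolding \<zeta>e_def by (rule frechet_derivative_eq_0_outside[OF \<zeta>(2)]) (use that in auto)
  have z2: "frechet_derivative (\<zeta>e e) (at x) e' = 0" if "L + 1 < norm x" for e e' x
    by (rule frechet_derivative_eq_0_outside[OF z1]) (use that in auto)
  have l1: "is_L2 (\<zeta>e e)" for e
    by (rule is_L2_continuous_support[OF esm_continuous[OF e1], where L = "L + 1"]) (use z1 in auto)
  have l2: "is_L2 (\<lambda>x. frechet_derivative (\<zeta>e e) (at x) e')" for e e'
    by (rule is_L2_continuous_support[OF esm_continuous[OF esm_frechet_derivative[OF e1]], where L = "L + 1"]) (use z2 in auto)
  have gL2: "is_L2 (\<lambda>x. gw t x \<bullet> e)" if "e \<in> Basis" for e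
  proof -
    have "integrable lborel (\<lambda>x. (norm (gw t x \<bullet> e))\<^sup>2)"
    proof (rule Bochner_Integration.integrable_bound)
      show "integrable lborel (\<lambda>x. (norm (gw t x))\<^sup>2)" using g by (simp add: is_L2_def)
      show "AE x in lborel. norm ((norm (gw t x \<bullet> e))\<^sup>2) \<le> norm ((norm (gw t x))\<^sup>2)"
      proof (rule AE_I2)
        fix x
        have "(norm (gw t x \<bullet> e))\<^sup>2 \<le> (norm (gw t x))\<^sup>2"
          using Basis_le_norm[OF that, of "gw t x"] by (intro power_mono) auto
        then show "norm ((norm (gw t x \<bullet> e))\<^sup>2) \<le> norm ((norm (gw t x))\<^sup>2)" by simp
      qed
    qed measurable
    then show ?thesis by (simp add: is_L2_def)
  qed
  have lin: "frechet_derivative \<zeta> (at x) v = (\<Sum>e\<in>Basis. (v \<bullet> e) * \<zeta>e e x)" for x v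
  proof -
    have l: "linear (frechet_derivative \<zeta> (at x))"
      by (intro linear_frechet_derivative esm_differentiable \<zeta>)
    have "frechet_derivative \<zeta> (at x) v = frechet_derivative \<zeta> (at x) (\<Sum>e\<in>Basis. (v \<bullet> e) *\<^sub>R e)"
      by (simp add: euclidean_representation)
    also have "\<dots> = (\<Sum>e\<in>Basis. (v \<bullet> e) * \<zeta>e e x)"
      by (simp add: linear_sum[OF l] linear_cmul[OF l] \<zeta>e_def)
    finally show ?thesis .
  qed
  have "(\<integral>x. frechet_derivative \<zeta> (at x) (gw t x) \<partial>lborel) = (\<Sum>e\<in>Basis. \<integral>x. (gw t x \<bullet> e) * \<zeta>e e x \<partial>lborel)"
    unfolding lin by (intro Bochner_Integration.integral_sum L2_pairing gL2 l1)
  also have "\<dots> = (\<Sum>e\<in>Basis. - (\<integral>x. w t x * frechet_derivative (\<zeta>e e) (at x) e \<partial>lborel))"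
  proof (intro sum.cong refl)
    fix e :: 'a assume "e \<in> Basis"
    moreover have "Cc_inf (\<zeta>e e)" by (rule esm_Cc_inf[OF e1 z1])
    ultimately show "(\<integral>x. (gw t x \<bullet> e) * \<zeta>e e x \<partial>lborel) = - (\<integral>x. w t x * frechet_derivative (\<zeta>e e) (at x) e \<partial>lborel)"
      using wg by (simp add: weak_grad_def)
  qed
  also have "\<dots> = - (\<integral>x. (\<Sum>e\<in>Basis. w t x * frechet_derivative (\<zeta>e e) (at x) e) \<partial>lborel)"
    by (subst Bochner_Integration.integral_sum) (auto intro: L2_pairing w l2 simp: sum_negf)
  finally show ?thesis by (simp add: laplace_def \<zeta>e_def sum_distrib_left)
qed

end

text \<open>The antiderivative of \<open>- \<theta>\<close> that vanishes at b. Integration by parts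
  against it turns \<open>w\<close> paired with \<open>\<theta>\<close> into
  \<open>wt\<close>.\<close>

definition tail :: "real \<Rightarrow> (real \<Rightarrow> real) \<Rightarrow> real \<Rightarrow> real" where
  "tail b \<theta> t = indicator {0..b} t * integral {t..b} \<theta>"

lemma tail_eq_0: "b \<le> t \<Longrightarrow> tail b \<theta> t = 0"
  by (cases "b = t") (auto simp: tail_def)

lemma tail_deriv:
  assumes "continuous_on UNIV \<theta>" "t \<in> {0..b}"
  shows "(tail b \<theta> has_real_derivative - \<theta> t) (at t within {0..b})"
proof -
  have c: "continuous_on S \<theta>" for S using assms(1) continuous_on_subset by blast
  have "((\<lambda>u. integral {0..u} \<theta>) has_real_derivative \<theta> t) (at t within {0..b})"
    by (rule integral_has_real_derivative[OF c assms(2)])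
  then have "((\<lambda>u. integral {0..b} \<theta> - integral {0..u} \<theta>) has_real_derivative 0 - \<theta> t) (at t within {0..b})"
    by (intro DERIV_diff DERIV_const)
  moreover have "tail b \<theta> u = integral {0..b} \<theta> - integral {0..u} \<theta>" if "u \<in> {0..b}" for u
    using Henstock_Kurzweil_Integration.integral_combine[of 0 u b \<theta>] that integrable_continuous_real[OF c]
    by (auto simp: tail_def)
  ultimately show ?thesis
    by (subst has_field_derivative_cong_eventually[where g = "\<lambda>u. integral {0..b} \<theta> - integral {0..u} \<theta>"])
      (use assms(2) in \<open>auto simp: eventually_at_filter\<close>)
qed

lemma tail_measurable:
  assumes "continuous_on UNIV \<theta>"
  shows "tail b \<theta> \<in> borel_measurable borel"
proof -
  have "continuous_on {0..b} (tail b \<theta>)"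
    by (rule DERIV_continuous_on) (rule tail_deriv[OF assms])
  then have "(\<lambda>t. indicator {0..b} t *\<^sub>R tail b \<theta> t) \<in> borel_measurable borel"
    by (intro borel_measurable_continuous_on_indicator) auto
  moreover have "(\<lambda>t. indicator {0..b} t *\<^sub>R tail b \<theta> t) = tail b \<theta>"
    by (auto simp: tail_def fun_eq_iff indicator_def)
  ultimately show ?thesis by simp
qed

lemma tail_diff_le:
  assumes "continuous_on UNIV \<theta>" "continuous_on UNIV \<eta>" "0 \<le> b" "0 \<le> e"
    and "\<And>t. t \<in> {0..b} \<Longrightarrow> \<bar>\<theta> t - \<eta> t\<bar> \<le> e"
  shows "\<bar>tail b \<theta> t - tail b \<eta> t\<bar> \<le> e * b"
proof (cases "t \<in> {0..b}")
  case True
  have i: "\<theta> integrable_on {t..b}" "\<eta> integrable_on {t..b}"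
    by (intro integrable_continuous_real continuous_on_subset[OF assms(1)] continuous_on_subset[OF assms(2)]; simp)+
  have "\<bar>integral {t..b} (\<lambda>s. \<theta> s - \<eta> s)\<bar> \<le> e * (b - t)"
    unfolding real_norm_def[symmetric]
    by (rule integral_bound) (use True assms in \<open>auto intro!: continuous_intros intro: continuous_on_subset\<close>)
  also have "\<dots> \<le> e * b" using True assms by (intro mult_left_mono) auto
  finally show ?thesis using True integral_diff[OF i] by (simp add: tail_def)
qed (use assms in \<open>simp add: tail_def\<close>)

lemma tail_abs_le:
  assumes "continuous_on UNIV \<theta>" "0 \<le> b" "0 \<le> e" "\<And>t. t \<in> {0..b} \<Longrightarrow> \<bar>\<theta> t\<bar> \<le> e"
  shows "\<bar>tail b \<theta> t\<bar> \<le> e * b"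
  using tail_diff_le[OF assms(1) continuous_on_const[of UNIV 0] assms(2,3), of t] assms(4)
  by (simp add: tail_def)

context weak_wave
begin

text \<open>The damping term is integrated by parts with \<open>\<theta>\<close>, the Laplace and
  potential terms with \<open>tail b \<theta>\<close>. The boundary term from the damping cancels
  the \<open>w0 * D\<close> term of \<open>weak_eq\<close>; the other two boundary terms survive
  with the coefficient \<open>tail b \<theta> 0\<close>.\<close>

lemma product_identity:
  assumes \<theta>: "esm \<theta>" "0 \<le> b" "b < T" "\<And>t. b \<le> \<bar>t\<bar> \<Longrightarrow> \<theta> t = 0"
    and \<zeta>: "esm \<zeta>" "\<And>x. L \<le> norm x \<Longrightarrow> \<zeta> x = 0"
  shows "\<epsilon> * (\<theta> 0 * (\<integral>x. w1 x * \<zeta> x \<partial>lborel) + tail b \<theta> 0 * (\<integral>x. w0 x * (laplace \<zeta> x - V x * \<zeta> x) \<partial>lborel))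
     + (LINT z:{0<..<T} \<times> UNIV|lborel. N (fst z) (snd z) * (\<theta> (fst z) * \<zeta> (snd z)))
     = (LINT z:{0<..<T} \<times> UNIV|lborel. wt (fst z) (snd z) *
          (- frechet_derivative \<theta> (at (fst z)) 1 * \<zeta> (snd z) + \<theta> (fst z) * (D (snd z) * \<zeta> (snd z))
           - tail b \<theta> (fst z) * (laplace \<zeta> (snd z) - V (snd z) * \<zeta> (snd z))))"
proof -
  let ?S = "{0<..<T} \<times> (UNIV :: 'a set)"
  define d where "d = (\<lambda>t. frechet_derivative \<theta> (at t) 1)"
  define \<Psi> where "\<Psi> = (\<lambda>z. \<theta> (fst z) * \<zeta> (snd z))"
  have test: "test_fun T \<Psi>" unfolding \<Psi>_def by (rule test_fun_product[OF \<theta>(1) \<zeta>(1) \<theta>(3,4) \<zeta>(2)])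
  have c\<theta>: "continuous_on UNIV \<theta>" and c\<zeta>: "continuous_on UNIV \<zeta>" and cd: "continuous_on UNIV d"
    unfolding d_def by (intro esm_continuous esm_frechet_derivative \<theta> \<zeta>)+
  have lin0: "frechet_derivative \<zeta> (at x) 0 = 0" for x
    by (intro linear_0 linear_frechet_derivative esm_differentiable \<zeta>)
  have \<Psi>t: "frechet_derivative \<Psi> (at (t, x)) (1, 0) = d t * \<zeta> x" for t x
    unfolding \<Psi>_def frechet_derivative_product_fun[OF \<theta>(1) \<zeta>(1)] by (simp add: lin0 d_def)
  have \<Psi>x: "frechet_derivative \<Psi> (at (t, x)) (0, y) = \<theta> t * frechet_derivative \<zeta> (at x) y" for t x y
    unfolding \<Psi>_def frechet_derivative_product_fun[OF \<theta>(1) \<zeta>(1)] by simp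
  have I: "set_integrable lborel ?S (\<lambda>(t,x). wt t x * (d t * \<zeta> x))"
      "set_integrable lborel ?S (\<lambda>(t,x). \<theta> t * frechet_derivative \<zeta> (at x) (gw t x))"
      "set_integrable lborel ?S (\<lambda>(t,x). w t x * D x * (d t * \<zeta> x))"
      "set_integrable lborel ?S (\<lambda>(t,x). V x * w t x * \<Psi> (t, x))"
    and E: "\<epsilon> * (\<integral>x. w1 x * \<Psi> (0,x) \<partial>lborel) + \<epsilon> * (\<integral>x. w0 x * D x * \<Psi> (0,x) \<partial>lborel)
       + (LINT z:?S|lborel. (\<lambda>(t,x). N t x * \<Psi> (t,x)) z)
     = - (LINT z:?S|lborel. (\<lambda>(t,x). wt t x * (d t * \<zeta> x)) z)
       + (LINT z:?S|lborel. (\<lambda>(t,x). \<theta> t * frechet_derivative \<zeta> (at x) (gw t x)) z)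
       - (LINT z:?S|lborel. (\<lambda>(t,x). w t x * D x * (d t * \<zeta> x)) z)
       + (LINT z:?S|lborel. (\<lambda>(t,x). V x * w t x * \<Psi> (t,x)) z)"
    using eq test unfolding weak_eq_def by (auto simp: \<Psi>t \<Psi>x)
  have d0: "d t = 0" if "b < t" for t
    unfolding d_def using that frechet_derivative_eq_0_outside[of b \<theta> t 1] \<theta>(4) by auto
  obtain K where K: "\<And>t. \<bar>\<theta> t\<bar> \<le> K"
    using continuous_support_bounded[OF c\<theta>, of b] \<theta>(4) by (metis less_imp_le real_norm_def)
  have K0: "0 \<le> K" using K[of 0] by linarith
  have hl: "continuous_on UNIV (laplace \<zeta>)" "laplace \<zeta> x = 0" if "L + 1 < norm x" for x
  proof -
    show "continuous_on UNIV (laplace \<zeta>)" by (intro esm_continuous esm_laplace \<zeta>)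
    have z1: "frechet_derivative \<zeta> (at y) e = 0" if "L + 1 \<le> norm y" for e y
      by (rule frechet_derivative_eq_0_outside[OF \<zeta>(2)]) (use that in auto)
    show "laplace \<zeta> x = 0"
      unfolding laplace_def
      by (intro sum.neutral ballI, rule frechet_derivative_eq_0_outside[OF z1 that])
  qed
  have cl: "continuous_on UNIV (laplace \<zeta>)" by (intro esm_continuous esm_laplace \<zeta>)
  have hD: "continuous_on UNIV (\<lambda>x. D x * \<zeta> x)" and hV: "continuous_on UNIV (\<lambda>x. V x * \<zeta> x)"
    by (intro continuous_on_mult coeff c\<zeta>)+
  have \<zeta>0: "\<zeta> x = 0" if "L < norm x" for x using \<zeta>(2)[of x] that by simp
  have t1: "\<bar>tail b \<theta> t\<bar> \<le> K * b" for t using tail_abs_le[OF c\<theta> \<theta>(2) K0] K by blast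
  have cm: "continuous_on {0..b} (\<lambda>t. - \<theta> t)" "continuous_on {0..b} d"
    by (intro continuous_on_minus continuous_on_subset[OF c\<theta>] continuous_on_subset[OF cd]; simp)+
  have \<theta>0: "- \<theta> t = 0" if "b < t" for t using \<theta>(4)[of t] that by simp
  note ibp_tail = integrate_by_parts[OF \<theta>(2,3) _ _ tail_deriv[OF c\<theta>] cm(1) tail_eq_0 \<theta>0 tail_measurable[OF c\<theta>] t1]
  note L = ibp_tail[OF cl, of "L + 1", OF hl(2)]
  have "V x * \<zeta> x = 0" if "L < norm x" for x using \<zeta>0[OF that] by simp
  note V = ibp_tail[OF hV, of L, OF this]
  have D0: "D x * \<zeta> x = 0" if "L < norm x" for x using \<zeta>0[OF that] by simp
  have \<theta>z: "\<theta> t = 0" if "b \<le> t" for t using \<theta>(4)[of t] that by simp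
  have dd: "(\<theta> has_real_derivative d t) (at t within X)" for t X
    unfolding d_def by (rule DERIV_subset[OF esm_deriv[OF \<theta>(1)] subset_UNIV])
  note D = integrate_by_parts[where \<Lambda> = \<theta> and ld = d and K = K, OF \<theta>(2,3) hD D0
      dd cm(2) \<theta>z d0 borel_measurable_continuous_onI[OF c\<theta>] K]
  have e2: "(LINT z:?S|lborel. (\<lambda>(t,x). \<theta> t * frechet_derivative \<zeta> (at x) (gw t x)) z)
      = (LINT t:{0<..<T}|lborel. - \<theta> t * (\<integral>x. w t x * laplace \<zeta> x \<partial>lborel))"
    unfolding set_integral_strip_Fubini[OF I(2)]
    by (intro set_lebesgue_integral_cong) (auto simp: weak_laplace[OF \<zeta>])
  have e3: "(LINT z:?S|lborel. (\<lambda>(t,x). w t x * D x * (d t * \<zeta> x)) z)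
      = (LINT t:{0<..<T}|lborel. d t * (\<integral>x. w t x * (D x * \<zeta> x) \<partial>lborel))"
    unfolding set_integral_strip_Fubini[OF I(3)]
  proof (intro set_lebesgue_integral_cong allI impI)
    fix t
    have "(\<integral>x. w t x * D x * (d t * \<zeta> x) \<partial>lborel) = (\<integral>x. d t * (w t x * (D x * \<zeta> x)) \<partial>lborel)"
      by (simp add: mult_ac)
    then show "(\<integral>x. (case (t, x) of (t, x) \<Rightarrow> w t x * D x * (d t * \<zeta> x)) \<partial>lborel) = d t * (\<integral>x. w t x * (D x * \<zeta> x) \<partial>lborel)"
      by simp
  qed simp
  have e4: "(LINT z:?S|lborel. (\<lambda>(t,x). V x * w t x * \<Psi> (t,x)) z)
      = - (LINT t:{0<..<T}|lborel. - \<theta> t * (\<integral>x. w t x * (V x * \<zeta> x) \<partial>lborel))"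
  proof -
    have "(LINT z:?S|lborel. (\<lambda>(t,x). V x * w t x * \<Psi> (t,x)) z) = (LINT t:{0<..<T}|lborel. - (- \<theta> t * (\<integral>x. w t x * (V x * \<zeta> x) \<partial>lborel)))"
      unfolding set_integral_strip_Fubini[OF I(4)]
    proof (intro set_lebesgue_integral_cong allI impI)
      fix t
      have "(\<integral>x. V x * w t x * (\<theta> t * \<zeta> x) \<partial>lborel) = (\<integral>x. \<theta> t * (w t x * (V x * \<zeta> x)) \<partial>lborel)"
        by (simp add: mult_ac)
      then show "(\<integral>x. (case (t, x) of (t, x) \<Rightarrow> V x * w t x * \<Psi> (t,x)) \<partial>lborel) = - (- \<theta> t * (\<integral>x. w t x * (V x * \<zeta> x) \<partial>lborel))"
        by (simp add: \<Psi>_def)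
    qed simp
    then show ?thesis by (simp add: set_lebesgue_integral_def)
  qed
  let ?wt = "\<lambda>z :: real \<times> 'a. wt (fst z) (snd z)"
  have I1: "set_integrable lborel ?S (\<lambda>z. ?wt z * (d (fst z) * \<zeta> (snd z)))"
    using I(1) by (simp add: case_prod_beta')
  have e1: "(LINT z:?S|lborel. (\<lambda>(t,x). wt t x * (d t * \<zeta> x)) z) = (LINT z:?S|lborel. ?wt z * (d (fst z) * \<zeta> (snd z)))"
    by (simp add: case_prod_beta')
  have e0: "(LINT z:?S|lborel. (\<lambda>(t,x). N t x * \<Psi> (t,x)) z) = (LINT z:?S|lborel. N (fst z) (snd z) * (\<theta> (fst z) * \<zeta> (snd z)))"
    by (simp add: case_prod_beta' \<Psi>_def)
  have i1: "(\<integral>x. w1 x * \<Psi> (0,x) \<partial>lborel) = \<theta> 0 * (\<integral>x. w1 x * \<zeta> x \<partial>lborel)"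
    by (simp add: \<Psi>_def mult.left_commute)
  have i2: "(\<integral>x. w0 x * D x * \<Psi> (0,x) \<partial>lborel) = \<theta> 0 * (\<integral>x. w0 x * (D x * \<zeta> x) \<partial>lborel)"
    unfolding integral_mult_right_zero[symmetric] by (simp only: \<Psi>_def fst_conv snd_conv mult_ac)
  have w0L2: "is_L2 w0" by (rule is_L2_continuous_support[OF data(1,3)])
  have i3: "(\<integral>x. w0 x * (laplace \<zeta> x - V x * \<zeta> x) \<partial>lborel) = (\<integral>x. w0 x * laplace \<zeta> x \<partial>lborel) - (\<integral>x. w0 x * (V x * \<zeta> x) \<partial>lborel)"
  proof -
    have "is_L2 (laplace \<zeta>)" by (rule is_L2_continuous_support[OF cl hl(2)])
    moreover have "is_L2 (\<lambda>x. V x * \<zeta> x)" by (rule is_L2_continuous_support[OF hV, of L]) (simp add: \<zeta>0)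
    ultimately show ?thesis using L2_pairing(1)[OF w0L2] by (simp add: right_diff_distrib)
  qed
  let ?a = "LINT z:?S|lborel. ?wt z * (d (fst z) * \<zeta> (snd z))"
  let ?b = "LINT z:?S|lborel. ?wt z * (\<theta> (fst z) * (D (snd z) * \<zeta> (snd z)))"
  let ?c = "LINT z:?S|lborel. ?wt z * (tail b \<theta> (fst z) * laplace \<zeta> (snd z))"
  let ?e = "LINT z:?S|lborel. ?wt z * (tail b \<theta> (fst z) * (V (snd z) * \<zeta> (snd z)))"
  have "(LINT z:?S|lborel. ?wt z *
          (- d (fst z) * \<zeta> (snd z) + \<theta> (fst z) * (D (snd z) * \<zeta> (snd z))
           - tail b \<theta> (fst z) * (laplace \<zeta> (snd z) - V (snd z) * \<zeta> (snd z))))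
     = (LINT z:?S|lborel. ((?wt z * (\<theta> (fst z) * (D (snd z) * \<zeta> (snd z))) - ?wt z * (d (fst z) * \<zeta> (snd z)))
          - ?wt z * (tail b \<theta> (fst z) * laplace \<zeta> (snd z))) + ?wt z * (tail b \<theta> (fst z) * (V (snd z) * \<zeta> (snd z))))"
    by (simp add: algebra_simps)
  also have "\<dots> = ?b - ?a - ?c + ?e"
    using I1 L(1) V(1) D(1) by (simp add: set_integral_add set_integral_diff)
  finally have rhs: "(LINT z:?S|lborel. ?wt z *
          (- d (fst z) * \<zeta> (snd z) + \<theta> (fst z) * (D (snd z) * \<zeta> (snd z))
           - tail b \<theta> (fst z) * (laplace \<zeta> (snd z) - V (snd z) * \<zeta> (snd z)))) = ?b - ?a - ?c + ?e" .
  have l2: "(LINT t:{0<..<T}|lborel. - \<theta> t * (\<integral>x. w t x * laplace \<zeta> x \<partial>lborel)) = - tail b \<theta> 0 * (\<epsilon> * (\<integral>x. w0 x * laplace \<zeta> x \<partial>lborel)) - ?c"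
    by (rule L(2))
  have v2: "(LINT t:{0<..<T}|lborel. - \<theta> t * (\<integral>x. w t x * (V x * \<zeta> x) \<partial>lborel)) = - tail b \<theta> 0 * (\<epsilon> * (\<integral>x. w0 x * (V x * \<zeta> x) \<partial>lborel)) - ?e"
    by (rule V(2))
  have d2: "(LINT t:{0<..<T}|lborel. d t * (\<integral>x. w t x * (D x * \<zeta> x) \<partial>lborel)) = - \<theta> 0 * (\<epsilon> * (\<integral>x. w0 x * (D x * \<zeta> x) \<partial>lborel)) - ?b"
    by (rule D(2))
  have arith: "\<epsilon> * (t0 * A1 + s0 * (A2 - A3)) + n = bb - aa - cc + ee"
    if "\<epsilon> * (t0 * A1) + \<epsilon> * (t0 * A4) + n = - aa + (- s0 * (\<epsilon> * A2) - cc) - (- t0 * (\<epsilon> * A4) - bb) + - (- s0 * (\<epsilon> * A3) - ee)"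
    for t0 s0 A1 A2 A3 A4 n aa bb cc ee :: real
    using that by (simp add: algebra_simps)
  show ?thesis
    using arith[OF E[unfolded e0 e1 e2 e3 e4 i1 i2 l2 v2 d2]] rhs unfolding i3 d_def by simp
qed

end

section \<open>Approximating the ideal test function by smooth products\<close>

lemma frechet_derivative_cong_open:
  fixes f g :: "'a::euclidean_space \<Rightarrow> real"
  assumes "open S" "x \<in> S" "\<And>y. y \<in> S \<Longrightarrow> f y = g y" "f differentiable (at x)"
  shows "frechet_derivative f (at x) = frechet_derivative g (at x)"
proof -
  have "(f has_derivative frechet_derivative f (at x)) (at x)"
    using assms(4) frechet_derivative_works by blast
  then have "(g has_derivative frechet_derivative f (at x)) (at x)"
    by (rule has_derivative_transform_within_open[OF _ assms(1,2)]) (use assms in auto)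
  then show ?thesis by (rule frechet_derivative_at)
qed

lemma laplace_cong_open:
  fixes f g :: "'a::euclidean_space \<Rightarrow> real"
  assumes "open S" "x \<in> S" "\<And>y. y \<in> S \<Longrightarrow> f y = g y" "esm f"
  shows "laplace f x = laplace g x"
  unfolding laplace_def
proof (intro sum.cong refl)
  fix e :: 'a
  have "frechet_derivative f (at y) e = frechet_derivative g (at y) e" if "y \<in> S" for y
    using frechet_derivative_cong_open[OF assms(1) that assms(3) esm_differentiable[OF assms(4)]] by simp
  then show "frechet_derivative (\<lambda>y. frechet_derivative f (at y) e) (at x) e = frechet_derivative (\<lambda>y. frechet_derivative g (at y) e) (at x) e"
    using frechet_derivative_cong_open[OF assms(1,2) _ esm_differentiable[OF esm_frechet_derivative[OF assms(4)]]] by metis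
qed

lemma laplace_radial:
  fixes P P' P'' :: "real \<Rightarrow> real"
  assumes P: "\<And>s. (P has_real_derivative P' s) (at s)" "\<And>s. (P' has_real_derivative P'' s) (at s)"
  shows "laplace (\<lambda>x::'a::euclidean_space. P ((norm x)\<^sup>2)) x = 4 * (norm x)\<^sup>2 * P'' ((norm x)\<^sup>2) + 2 * DIM('a) * P' ((norm x)\<^sup>2)"
proof -
  have sq: "((\<lambda>x::'a. (norm x)\<^sup>2) has_derivative (\<lambda>v. 2 * (x \<bullet> v))) (at x)" for x
    unfolding power2_norm_eq_inner by (auto intro!: derivative_eq_intros simp: inner_commute)
  have comp: "((\<lambda>x::'a. F ((norm x)\<^sup>2)) has_derivative (\<lambda>v. F' ((norm x)\<^sup>2) * (2 * (x \<bullet> v)))) (at x)"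
    if "\<And>s. (F has_real_derivative F' s) (at s)" for F F' :: "real \<Rightarrow> real" and x :: 'a
    using has_derivative_compose[OF sq has_field_derivative_imp_has_derivative[OF that]] by simp
  have d1: "frechet_derivative (\<lambda>x::'a. P ((norm x)\<^sup>2)) (at x) = (\<lambda>v. P' ((norm x)\<^sup>2) * (2 * (x \<bullet> v)))" for x
    using frechet_derivative_at[OF comp[OF P(1)]] by simp
  have d2: "frechet_derivative (\<lambda>y::'a. P' ((norm y)\<^sup>2) * (2 * (y \<bullet> e))) (at x) e = 4 * P'' ((norm x)\<^sup>2) * (x \<bullet> e)\<^sup>2 + 2 * P' ((norm x)\<^sup>2)"
    if "e \<in> Basis" for e
  proof -
    have "((\<lambda>y::'a. 2 * (y \<bullet> e)) has_derivative (\<lambda>v. 2 * (v \<bullet> e))) (at x)"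
      by (auto intro!: derivative_eq_intros)
    from frechet_derivative_at[OF has_derivative_mult[OF comp[OF P(2)] this], symmetric] that
    show ?thesis by (simp add: power2_eq_square algebra_simps)
  qed
  have "laplace (\<lambda>x::'a. P ((norm x)\<^sup>2)) x = (\<Sum>e\<in>Basis. 4 * P'' ((norm x)\<^sup>2) * (x \<bullet> e)\<^sup>2 + 2 * P' ((norm x)\<^sup>2))"
    unfolding laplace_def d1 by (intro sum.cong refl d2)
  also have "\<dots> = 4 * P'' ((norm x)\<^sup>2) * (\<Sum>e\<in>Basis. (x \<bullet> e)\<^sup>2) + 2 * DIM('a) * P' ((norm x)\<^sup>2)"
    by (simp add: sum.distrib sum_distrib_left)
  also have "(\<Sum>e\<in>Basis. (x \<bullet> e)\<^sup>2) = (norm x)\<^sup>2"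
    unfolding power2_norm_eq_inner by (subst (2) euclidean_inner) (simp add: power2_eq_square)
  finally show ?thesis by simp
qed

text \<open>The even polynomials of \<open>volterra_poly_approx\<close> are read as functions of x;
  dividing the coefficients inverts the Laplacian term by term, so a single smooth \<open>Q\<close>
  is close to \<phi> and has a Laplacian close to a \<phi>.\<close>

lemma space_approx:
  fixes a \<phi> :: "real \<Rightarrow> real"
  assumes a: "continuous_on UNIV a"
    and \<phi>: "continuous_on UNIV \<phi>" "\<And>r. \<phi> r = 1 + volterra DIM('a::euclidean_space) a \<phi> r"
    and e: "0 < e"
  obtains Q :: "'a::euclidean_space \<Rightarrow> real" where "esm Q" "\<And>x. norm x \<le> L \<Longrightarrow> \<bar>Q x - \<phi> (norm x)\<bar> \<le> e"
    "\<And>x. norm x \<le> L \<Longrightarrow> \<bar>laplace Q x - a (norm x) * \<phi> (norm x)\<bar> \<le> e"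
proof -
  let ?n = "DIM('a)"
  obtain c :: "nat \<Rightarrow> real" and N :: nat where
    1: "\<And>r. 0 \<le> r \<Longrightarrow> r \<le> L \<Longrightarrow> \<bar>(\<Sum>i\<le>N. c i * (r\<^sup>2) ^ i) - a r * \<phi> r\<bar> \<le> e" and
    2: "\<And>r. 0 \<le> r \<Longrightarrow> r \<le> L \<Longrightarrow> \<bar>1 + (\<Sum>i\<le>N. c i / real ((2 * i + 2) * (2 * i + ?n)) * (r\<^sup>2) ^ Suc i) - \<phi> r\<bar> \<le> e"
    by (rule volterra_poly_approx[OF DIM_positive a \<phi> e, of L]) (rule that)
  define d where "d = (\<lambda>i. c i / real ((2 * i + 2) * (2 * i + ?n)))"
  define P where "P = (\<lambda>s::real. 1 + (\<Sum>i\<le>N. d i * s ^ Suc i))"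
  define P' where "P' = (\<lambda>s::real. (\<Sum>i\<le>N. d i * (real (Suc i) * s ^ i)))"
  define P'' where "P'' = (\<lambda>s::real. (\<Sum>i\<le>N. d i * (real (Suc i) * (real i * s ^ (i - 1)))))"
  have dP: "(P has_real_derivative P' s) (at s)" for s
    unfolding P_def P'_def by (auto intro!: derivative_eq_intros sum.cong simp del: power_Suc of_nat_Suc)
  have dP': "(P' has_real_derivative P'' s) (at s)" for s
    unfolding P'_def P''_def by (auto intro!: derivative_eq_intros sum.cong simp del: of_nat_Suc)
  have lap: "4 * s * P'' s + 2 * ?n * P' s = (\<Sum>i\<le>N. c i * s ^ i)" for s
  proof -
    have "4 * s * (d i * (real (Suc i) * (real i * s ^ (i - 1)))) + 2 * ?n * (d i * (real (Suc i) * s ^ i)) = c i * s ^ i" for i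
    proof -
      have "s * (real i * s ^ (i - 1)) = real i * s ^ i" by (cases i) auto
      then have st: "4 * s * (d i * (real (Suc i) * (real i * s ^ (i - 1)))) = 4 * d i * real (Suc i) * (real i * s ^ i)"
        by (metis (no_types, opaque_lifting) mult.assoc mult.left_commute)
      have "4 * s * (d i * (real (Suc i) * (real i * s ^ (i - 1)))) + 2 * ?n * (d i * (real (Suc i) * s ^ i))
          = d i * real (Suc i) * (4 * real i + 2 * ?n) * s ^ i"
        unfolding st by (simp add: algebra_simps)
      also have "d i * real (Suc i) * (4 * real i + 2 * ?n) = c i"
      proof -
        have "real ((2 * i + 2) * (2 * i + ?n)) = real (Suc i) * (4 * real i + 2 * ?n)" by (simp add: algebra_simps)
        moreover have "real (Suc i) * (4 * real i + 2 * ?n) \<noteq> 0" using DIM_positive[where 'a = 'a] by (simp add: add_nonneg_eq_0_iff)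
        ultimately show ?thesis by (simp add: d_def mult.assoc del: of_nat_Suc of_nat_mult)
      qed
      finally show ?thesis .
    qed
    then show ?thesis
      unfolding P'_def P''_def sum_distrib_left by (simp only: sum.distrib[symmetric])
  qed
  show ?thesis
  proof
    show "esm (\<lambda>x::'a. P ((norm x)\<^sup>2))"
      unfolding P_def by (intro esm_add esm_const esm_sum esm_mult esm_power esm_norm_square)
    show "\<bar>P ((norm x)\<^sup>2) - \<phi> (norm x)\<bar> \<le> e" if "norm x \<le> L" for x :: 'a
      using 2[OF norm_ge_zero that] by (simp add: P_def d_def)
    show "\<bar>laplace (\<lambda>x::'a. P ((norm x)\<^sup>2)) x - a (norm x) * \<phi> (norm x)\<bar> \<le> e" if "norm x \<le> L" for x :: 'a
      using 1[OF norm_ge_zero that] unfolding laplace_radial[OF dP dP'] lap by simp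
  qed
qed

text \<open>A polynomial close to \<open>\<theta>'\<close> is integrated backwards from b, so its
  primitive \<open>G\<close> is close to 0 wherever \<open>\<theta>\<close> vanishes. A cutoff equal
  to 1 up to \<open>\<sigma>\<close> then gives compact support: for nonnegative times its
  derivative acts only past \<open>\<sigma>\<close>, where \<open>G\<close> is already
  small.\<close>

lemma time_approx:
  fixes \<theta> \<theta>' :: "real \<Rightarrow> real"
  assumes \<theta>: "\<And>t. (\<theta> has_real_derivative \<theta>' t) (at t)" "continuous_on UNIV \<theta>'" "\<And>t. \<sigma> \<le> t \<Longrightarrow> \<theta> t = 0"
    and \<sigma>: "0 < \<sigma>" "\<sigma> < b" and e: "0 < e"
  obtains \<eta> :: "real \<Rightarrow> real" where "esm \<eta>" "\<And>t. b \<le> \<bar>t\<bar> \<Longrightarrow> \<eta> t = 0"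
    "\<And>t. t \<in> {0..b} \<Longrightarrow> \<bar>\<eta> t - \<theta> t\<bar> \<le> e" "\<And>t. t \<in> {0..b} \<Longrightarrow> \<bar>frechet_derivative \<eta> (at t) 1 - \<theta>' t\<bar> \<le> e"
proof -
  obtain k :: "real \<Rightarrow> real" where k: "esm k" "\<And>x. 0 \<le> k x" "\<And>x. k x \<le> 1"
      "\<And>x. norm x \<le> \<sigma> \<Longrightarrow> k x = 1" "\<And>x. b \<le> norm x \<Longrightarrow> k x = 0"
    using \<sigma> esm_cutoff[OF less_imp_le[OF \<sigma>(1)] \<sigma>(2), where 'a = real] by metis
  define k' where "k' = (\<lambda>t. frechet_derivative k (at t) 1)"
  have dk: "(k has_real_derivative k' t) (at t)" for t unfolding k'_def by (rule esm_deriv[OF k(1)])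
  have ck': "continuous_on UNIV k'" unfolding k'_def by (intro esm_continuous esm_frechet_derivative k)
  have k'0: "k' t = 0" if "b < norm t" for t
    unfolding k'_def by (rule frechet_derivative_eq_0_outside[OF k(5) that])
  obtain K where K: "0 \<le> K" "\<And>t. \<bar>k' t\<bar> \<le> K"
    using continuous_support_bounded[OF ck' k'0] by blast
  have \<theta>'0: "\<theta>' t = 0" if "\<sigma> \<le> t" for t
  proof -
    have "((\<lambda>_. 0) has_real_derivative \<theta>' t) (at t within {t..t+1})"
      by (rule has_field_derivative_transform_within[OF DERIV_subset[OF \<theta>(1) subset_UNIV] zero_less_one]) (use \<theta>(3) that in auto)
    moreover have "((\<lambda>_. 0::real) has_real_derivative 0) (at t within {t..t+1})" by simp
    moreover have "at t within {t..t+1} \<noteq> bot" by (simp add: at_within_Icc_at_right)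
    ultimately show ?thesis
      using has_field_derivative_unique by blast
  qed
  \<comment> \<open>The denominator adds up the three errors: \<open>d\<close> for the derivative,
    \<open>d * b\<close> for the primitive, and \<open>K * (d * b)\<close> for the derivative of the
    cutoff times \<open>G\<close>.\<close>
  define d where "d = e / (1 + b + K * b)"
  have den: "0 < 1 + b + K * b" using \<sigma> K by (simp add: add_pos_nonneg)
  have d0: "0 < d" using e den by (simp add: d_def)
  have d1: "d * b + d + d * (K * b) = e" 
  proof -
    have "d * (1 + b + K * b) = e" using den by (simp add: d_def)
    then show ?thesis by (simp add: algebra_simps)
  qed
  have Kb: "0 \<le> K * b" "0 < b" using K \<sigma> by auto
  obtain g where "real_polynomial_function g" and g: "\<And>t. t \<in> {0..b} \<Longrightarrow> \<bar>\<theta>' t - g t\<bar> < d"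
    using Stone_Weierstrass_real_polynomial_function[OF compact_Icc continuous_on_subset[OF \<theta>(2) subset_UNIV] d0] by blast
  then obtain c N where gc: "g = (\<lambda>x. \<Sum>i\<le>N. c i * x^i)"
    using real_polynomial_function_iff_sum by blast
  define G where "G = (\<lambda>t. \<Sum>i\<le>N. c i / real (Suc i) * (t ^ Suc i - b ^ Suc i))"
  have eG: "esm G" unfolding G_def
    by (intro esm_sum esm_mult esm_const esm_diff esm_power esm_linear bounded_linear_ident)
  have dG: "(G has_real_derivative g t) (at t)" for t
    unfolding G_def gc by (auto intro!: derivative_eq_intros sum.cong simp del: power_Suc of_nat_Suc)
  have Gb: "G b = 0" by (simp add: G_def)
  have close: "\<bar>G t - \<theta> t\<bar> \<le> d * b" if t: "t \<in> {0..b}" for t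
  proof (cases "t = b")
    case True
    then show ?thesis using Gb \<theta>(3)[of b] \<sigma> d0 by simp
  next
    case False
    then have "t < b" using t by auto
    have dd: "((\<lambda>t. G t - \<theta> t) has_real_derivative g x - \<theta>' x) (at x)" for x
      by (intro DERIV_diff dG \<theta>(1))
    obtain z where z: "t < z" "z < b" "(G b - \<theta> b) - (G t - \<theta> t) = (b - t) * (g z - \<theta>' z)"
      using MVT2[OF \<open>t < b\<close> dd] by blast
    have "\<bar>G t - \<theta> t\<bar> = \<bar>(b - t) * (g z - \<theta>' z)\<bar>"
      using z(3) Gb \<theta>(3)[of b] \<sigma> by simp
    also have "\<dots> \<le> b * d"
      unfolding abs_mult using g[of z] z t by (intro mult_mono) auto
    finally show ?thesis by (simp add: mult.commute)
  qed
  show ?thesis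
  proof
    show "esm (\<lambda>t. k t * G t)" by (intro esm_mult k eG)
    show "k t * G t = 0" if "b \<le> \<bar>t\<bar>" for t using k(5)[of t] that by simp
    fix t assume t: "t \<in> {0..b}"
    have fd: "frechet_derivative (\<lambda>t. k t * G t) (at t) 1 = k' t * G t + g t * k t"
      using DERIV_unique[OF esm_deriv[OF esm_mult[OF k(1) eG]] DERIV_mult[OF dk dG]] .
    have c: "\<bar>G t - \<theta> t\<bar> \<le> d * b" by (rule close[OF t])
    have db: "d * b \<le> e" "d * b + d * (K * b) + d = e"
      using d1 d0 mult_nonneg_nonneg[OF less_imp_le[OF d0] Kb(1)] by linarith+
    show "\<bar>k t * G t - \<theta> t\<bar> \<le> e"
    proof (cases "t \<le> \<sigma>")
      case True
      then show ?thesis using k(4)[of t] t c db by simp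
    next
      case False
      then have "\<theta> t = 0" using \<theta>(3)[of t] by simp
      moreover have "\<bar>k t\<bar> * \<bar>G t\<bar> \<le> 1 * (d * b)"
        using c k(2,3)[of t] \<open>\<theta> t = 0\<close> by (intro mult_mono) auto
      ultimately show ?thesis using db by (simp add: abs_mult)
    qed
    show "\<bar>frechet_derivative (\<lambda>t. k t * G t) (at t) 1 - \<theta>' t\<bar> \<le> e"
    proof (cases "t < \<sigma>")
      case True
      have "((\<lambda>_. 1) has_real_derivative k' t) (at t)"
        by (rule has_field_derivative_transform_within_open[OF dk, where S = "{-\<sigma><..<\<sigma>}"]) (use True t k(4) in auto)
      then have "k' t = 0" using DERIV_unique[OF _ DERIV_const] by blast
      moreover have "k t = 1" using k(4)[of t] True t by simp
      moreover have "d \<le> e" using db d0 Kb mult_nonneg_nonneg[OF less_imp_le[OF d0] Kb(1)] mult_pos_pos[OF d0 Kb(2)] by linarith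
      ultimately show ?thesis unfolding fd using g[OF t] by simp
    next
      case False
      then have z: "\<theta> t = 0" "\<theta>' t = 0" using \<theta>(3)[of t] \<theta>'0[of t] by auto
      have "\<bar>k' t * G t + g t * k t\<bar> \<le> \<bar>k' t\<bar> * \<bar>G t\<bar> + \<bar>g t\<bar> * \<bar>k t\<bar>"
        by (metis abs_mult abs_triangle_ineq)
      also have "\<dots> \<le> K * (d * b) + d * 1"
        using c K g[OF t] k(2,3)[of t] z d0 by (intro add_mono mult_mono) auto
      also have "\<dots> \<le> e" using db mult_pos_pos[OF d0 Kb(2)] by (simp add: mult_ac)
      finally show ?thesis unfolding fd z by simp
    qed
  qed
qed

lemma loc_int_dominated:
  assumes F: "loc_int T F" and b: "b < T" and G: "\<And>j. G j \<in> borel_measurable borel" "H \<in> borel_measurable borel"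
    and K: "\<And>j z. \<bar>G j z\<bar> \<le> K" "\<And>j z. b < fst z \<or> L < norm (snd z) \<Longrightarrow> G j z = 0"
    and lim: "\<And>z. 0 < fst z \<Longrightarrow> fst z < T \<Longrightarrow> (\<lambda>j. G j z) \<longlonglongrightarrow> H z"
  shows "(\<lambda>j. LINT z:{0<..<T} \<times> UNIV|lborel. F z * G j z) \<longlonglongrightarrow> (LINT z:{0<..<T} \<times> UNIV|lborel. F z * H z)"
    and "set_integrable lborel ({0<..<T} \<times> UNIV) (\<lambda>z. F z * H z)"
proof -
  define S where "S = {0<..<T} \<times> (UNIV :: 'a set)"
  have i: "integrable lborel (\<lambda>z. indicator ({0<..b} \<times> cball 0 L) z *\<^sub>R F z)"
    using F b by (simp add: loc_int_def set_integrable_def)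
  then have iK: "integrable lborel (\<lambda>z. \<bar>indicator ({0<..b} \<times> cball 0 L) z *\<^sub>R F z\<bar> * \<bar>K\<bar>)"
    by (intro integrable_mult_left integrable_abs)
  have G0: "\<bar>G j z\<bar> \<le> \<bar>K\<bar>" for j z using K(1)[of j z] by linarith
  have H0: "indicator S z *\<^sub>R (F z * H z) = (indicator ({0<..b} \<times> cball 0 L) z *\<^sub>R F z) * H z" for z
  proof (cases "z \<in> S \<and> (b < fst z \<or> L < norm (snd z))")
    case True
    then have "(\<lambda>j. G j z) = (\<lambda>_. 0)" using K(2) by auto
    moreover have "(\<lambda>j. G j z) \<longlonglongrightarrow> H z" using lim True by (auto simp: S_def)
    ultimately have "H z = 0" using LIMSEQ_unique[OF _ tendsto_const] by fastforce
    then show ?thesis by simp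
  next
    case False
    then show ?thesis using b by (cases z) (auto simp: S_def indicator_def)
  qed
  have m: "(\<lambda>z. indicator S z *\<^sub>R (F z * H z)) \<in> borel_measurable lborel"
    unfolding H0 using i G(2) by (intro borel_measurable_times) auto
  have mG: "(\<lambda>z. indicator S z *\<^sub>R (F z * G j z)) \<in> borel_measurable lborel" for j
    using loc_int_mult[OF F b G(1) K(1) K(2)] unfolding set_integrable_def S_def by blast
  have "(\<lambda>j. indicator S z *\<^sub>R (F z * G j z)) \<longlonglongrightarrow> indicator S z *\<^sub>R (F z * H z)" for z
    using lim[of z] by (cases "z \<in> S") (auto simp: S_def intro!: tendsto_intros)
  then have ae1: "AE z in lborel. (\<lambda>j. indicator S z *\<^sub>R (F z * G j z)) \<longlonglongrightarrow> indicator S z *\<^sub>R (F z * H z)"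
    by simp
  have le: "norm (indicator S z *\<^sub>R (F z * G j z)) \<le> \<bar>indicator ({0<..b} \<times> cball 0 L) z *\<^sub>R F z\<bar> * \<bar>K\<bar>" for j z
  proof (cases "z \<in> S \<and> G j z \<noteq> 0")
    case True
    then have "z \<in> {0<..b} \<times> cball 0 L" using K(2)[of z j] by (cases z) (force simp: S_def)
    then show ?thesis using True G0[of j z] by (simp add: abs_mult mult_left_mono)
  qed auto
  then have ae2: "\<And>j. AE z in lborel. norm (indicator S z *\<^sub>R (F z * G j z)) \<le> \<bar>indicator ({0<..b} \<times> cball 0 L) z *\<^sub>R F z\<bar> * \<bar>K\<bar>"
    by simp
  show "(\<lambda>j. LINT z:{0<..<T} \<times> UNIV|lborel. F z * G j z) \<longlonglongrightarrow> (LINT z:{0<..<T} \<times> UNIV|lborel. F z * H z)"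
    unfolding set_lebesgue_integral_def S_def[symmetric]
    by (rule integral_dominated_convergence[OF m mG iK ae1 ae2])
  show "set_integrable lborel ({0<..<T} \<times> UNIV) (\<lambda>z. F z * H z)"
    unfolding set_integrable_def S_def[symmetric]
    by (rule integrable_dominated_convergence[OF m mG iK ae1 ae2])
qed

lemma continuous_bounded_ball:
  fixes f :: "'a::euclidean_space \<Rightarrow> real"
  assumes "continuous_on UNIV f"
  obtains K where "0 \<le> K" "\<And>x. norm x \<le> L \<Longrightarrow> \<bar>f x\<bar> \<le> K"
proof -
  have "compact (f ` cball 0 L)"
    by (intro compact_continuous_image continuous_on_subset[OF assms]) auto
  then obtain K where K: "\<forall>y\<in>f ` cball 0 L. norm y \<le> K"
    using compact_imp_bounded bounded_iff by blast
  then show ?thesis using that[of "max K 0"] by (auto simp: max.coboundedI1)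
qed

lemma tendsto_of_le_inverse:
  fixes f :: "nat \<Rightarrow> real"
  assumes "\<And>j. \<bar>f j - l\<bar> \<le> C * (1 / real (Suc j))"
  shows "f \<longlonglongrightarrow> l"
proof -
  have "(\<lambda>j. C * (1 / real (Suc j))) \<longlonglongrightarrow> C * 0"
    by (intro tendsto_intros LIMSEQ_Suc lim_1_over_n)
  then have lim: "(\<lambda>j. C * (1 / real (Suc j))) \<longlonglongrightarrow> 0" by (simp only: mult_zero_right)
  have "(\<lambda>j. f j - l) \<longlonglongrightarrow> 0"
    by (rule Lim_null_comparison[OF _ lim]) (simp only: real_norm_def assms eventually_True)
  then show ?thesis by (rule LIM_zero_cancel)
qed

lemma continuous_borel_pair:
  fixes f :: "real \<Rightarrow> real" and g :: "'a::euclidean_space \<Rightarrow> real"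
  assumes [measurable]: "f \<in> borel_measurable borel" "g \<in> borel_measurable borel"
  shows "(\<lambda>z. f (fst z) * g (snd z)) \<in> borel_measurable borel"
proof -
  have "(\<lambda>z. f (fst z) * g (snd z)) \<in> borel_measurable (borel \<Otimes>\<^sub>M borel)" by measurable
  then show ?thesis by (simp add: borel_prod)
qed

lemma kernel_measurable:
  fixes f1 f2 f3 :: "real \<Rightarrow> real" and g1 g2 g3 g4 :: "'a::euclidean_space \<Rightarrow> real"
  assumes "f1 \<in> borel_measurable borel" "f2 \<in> borel_measurable borel" "f3 \<in> borel_measurable borel"
    and "g1 \<in> borel_measurable borel" "g2 \<in> borel_measurable borel" "g3 \<in> borel_measurable borel" "g4 \<in> borel_measurable borel"
  shows "(\<lambda>z. - f1 (fst z) * g1 (snd z) + f2 (fst z) * (g2 (snd z) * g1 (snd z)) - f3 (fst z) * (g3 (snd z) - g4 (snd z) * g1 (snd z)))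
    \<in> borel_measurable borel"
  by (rule borel_measurable_diff[OF borel_measurable_add[OF
        continuous_borel_pair[of "\<lambda>t. - f1 t" g1] continuous_borel_pair[of f2 "\<lambda>x. g2 x * g1 x"]]
        continuous_borel_pair[of f3 "\<lambda>x. g3 x - g4 x * g1 x"]])
    (intro borel_measurable_uminus borel_measurable_times borel_measurable_diff assms)+

lemma integral_compact_dominated:
  fixes u :: "'a::euclidean_space \<Rightarrow> real"
  assumes u: "continuous_on UNIV u" "\<And>x. R < norm x \<Longrightarrow> u x = 0"
    and G: "\<And>j. G j \<in> borel_measurable borel" "H \<in> borel_measurable borel"
    and K: "\<And>j x. norm x \<le> R \<Longrightarrow> \<bar>G j x\<bar> \<le> K" and lim: "\<And>x. norm x \<le> R \<Longrightarrow> (\<lambda>j. G j x) \<longlonglongrightarrow> H x"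
  shows "(\<lambda>j. \<integral>x. u x * G j x \<partial>lborel) \<longlonglongrightarrow> (\<integral>x. u x * H x \<partial>lborel)"
proof (rule integral_dominated_convergence)
  have um[measurable]: "u \<in> borel_measurable borel" using u by (auto intro: borel_measurable_continuous_onI)
  show "(\<lambda>x. u x * H x) \<in> borel_measurable lborel" "\<And>j. (\<lambda>x. u x * G j x) \<in> borel_measurable lborel"
    using um G by (auto intro: borel_measurable_times)
  have 1: "is_L2 u" by (rule is_L2_continuous_support[OF u])
  have 2: "is_L2 (\<lambda>x. indicator (cball 0 R) x * K :: real)"
    by (rule is_L2_bounded_support[of _ "\<bar>K\<bar>" R]) (auto simp: indicator_def)
  have "integrable lborel (\<lambda>x. \<bar>u x * (indicator (cball 0 R) x * K)\<bar>)"
    by (intro integrable_abs L2_pairing 1 2)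
  then show "integrable lborel (\<lambda>x. \<bar>u x * (indicator (cball 0 R) x * K)\<bar>)" .
  show "AE x in lborel. (\<lambda>j. u x * G j x) \<longlonglongrightarrow> u x * H x"
  proof (rule AE_I2)
    fix x show "(\<lambda>j. u x * G j x) \<longlonglongrightarrow> u x * H x"
      using lim[of x] u(2)[of x] by (cases "norm x \<le> R") (auto intro!: tendsto_intros)
  qed
  fix j show "AE x in lborel. norm (u x * G j x) \<le> \<bar>u x * (indicator (cball 0 R) x * K)\<bar>"
  proof (rule AE_I2)
    fix x
    have "\<bar>G j x\<bar> \<le> \<bar>K\<bar>" if "norm x \<le> R" using K[OF that, of j] by linarith
    then show "norm (u x * G j x) \<le> \<bar>u x * (indicator (cball 0 R) x * K)\<bar>"
      using u(2)[of x] by (cases "norm x \<le> R") (auto simp: abs_mult mult_left_mono)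
  qed
qed

context weak_wave
begin

lemma wt_cone_AE:
  "AE z in lborel. 0 < fst z \<and> fst z < T \<longrightarrow> fst z + R < norm (snd z) \<longrightarrow> wt (fst z) (snd z) = 0"
proof -
  have [measurable]: "(\<lambda>z. wt (fst z) (snd z)) \<in> borel_measurable (borel \<Otimes>\<^sub>M borel)"
    using wt_meas by (simp add: borel_prod)
  have "AE z in lborel \<Otimes>\<^sub>M lborel. 0 < fst z \<and> fst z < T \<longrightarrow> fst z + R < norm (snd z :: 'a) \<longrightarrow> wt (fst z) (snd z) = 0"
  proof (rule lborel_pair.AE_pair_measure)
    have "{z \<in> space (borel \<Otimes>\<^sub>M borel). 0 < fst z \<and> fst z < T \<longrightarrow> fst z + R < norm (snd z :: 'a) \<longrightarrow> wt (fst z) (snd z) = 0}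
       \<in> sets (borel \<Otimes>\<^sub>M borel)" by measurable
    moreover have "sets (lborel \<Otimes>\<^sub>M lborel) = sets (borel \<Otimes>\<^sub>M borel :: (real \<times> 'a) measure)"
      by (intro sets_pair_measure_cong) auto
    ultimately show "{z \<in> space (lborel \<Otimes>\<^sub>M lborel). 0 < fst z \<and> fst z < T \<longrightarrow> fst z + R < norm (snd z :: 'a) \<longrightarrow> wt (fst z) (snd z) = 0}
       \<in> sets (lborel \<Otimes>\<^sub>M lborel)" by (simp add: space_pair_measure)
    have "AE x in lborel. 0 < t \<and> t < T \<longrightarrow> t + R < norm (x :: 'a) \<longrightarrow> wt t x = 0" for t
      using time_derivative_support[OF C1 supp, of t] by (cases "0 < t \<and> t < T") (auto elim: eventually_mono)
    then show "AE t in lborel. AE x in lborel. 0 < fst (t, x) \<and> fst (t, x) < T \<longrightarrow> fst (t, x) + R < norm (snd (t, x) :: 'a) \<longrightarrow> wt (fst (t, x)) (snd (t, x)) = 0"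
      by simp
  qed
  then show ?thesis unfolding lborel_prod .
qed

text \<open>\<open>product_identity\<close> is applied to smooth approximations and dominated
  convergence carries it over. Derivatives of \<open>\<kappa>\<close> leave no trace because
  \<open>\<kappa>\<close> is 1 near the support of \<open>wt\<close>; in the source term
  \<open>\<kappa>\<close> stays, since the locale records only the sign of \<open>N\<close>. The
  potential drops out of the kernel because a \<phi> - V \<phi> = (1 + D) \<phi>.\<close>

lemma limit_identity:
  fixes a \<phi> \<theta> \<theta>' :: "real \<Rightarrow> real" and \<kappa> :: "'a \<Rightarrow> real"
  assumes a: "continuous_on UNIV a" "\<And>x. a (norm x) = 1 + D x + V x"
    and \<phi>: "continuous_on UNIV \<phi>" "\<And>r. \<phi> r = 1 + volterra DIM('a) a \<phi> r"
    and \<theta>: "\<And>t. (\<theta> has_real_derivative \<theta>' t) (at t)" "continuous_on UNIV \<theta>'" "\<And>t. \<sigma> \<le> t \<Longrightarrow> \<theta> t = 0"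
    and \<sigma>: "0 < \<sigma>" "\<sigma> < b" "b < T"
    and \<kappa>: "esm \<kappa>" "\<And>x. 0 \<le> \<kappa> x" "\<And>x. \<kappa> x \<le> 1" "\<And>x. norm x \<le> T + R + 1 \<Longrightarrow> \<kappa> x = 1" "\<And>x. T + R + 2 \<le> norm x \<Longrightarrow> \<kappa> x = 0"
  shows "\<epsilon> * (\<theta> 0 * (\<integral>x. w1 x * \<phi> (norm x) \<partial>lborel) + tail b \<theta> 0 * (\<integral>x. w0 x * ((1 + D x) * \<phi> (norm x)) \<partial>lborel))
     + (LINT z:{0<..<T} \<times> UNIV|lborel. N (fst z) (snd z) * (\<theta> (fst z) * (\<kappa> (snd z) * \<phi> (norm (snd z)))))
     = (LINT z:{0<..<T} \<times> UNIV|lborel. wt (fst z) (snd z) *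
          (indicator (cball 0 (T + R)) (snd z) * (\<phi> (norm (snd z)) *
          (- \<theta>' (fst z) + \<theta> (fst z) * D (snd z) - tail b \<theta> (fst z) * (1 + D (snd z))))))" (is ?id)
    and "set_integrable lborel ({0<..<T} \<times> UNIV) (\<lambda>z. N (fst z) (snd z) * (\<theta> (fst z) * (\<kappa> (snd z) * \<phi> (norm (snd z)))))" (is ?i1)
    and "set_integrable lborel ({0<..<T} \<times> UNIV) (\<lambda>z. wt (fst z) (snd z) *
          (indicator (cball 0 (T + R)) (snd z) * (\<phi> (norm (snd z)) *
          (- \<theta>' (fst z) + \<theta> (fst z) * D (snd z) - tail b \<theta> (fst z) * (1 + D (snd z))))))" (is ?i2)
proof -
  let ?S = "{0<..<T} \<times> (UNIV :: 'a set)"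
  have b0: "0 \<le> b" using \<sigma> by simp
  have c\<theta>: "continuous_on UNIV \<theta>"
    by (intro continuous_at_imp_continuous_on ballI DERIV_isCont[OF \<theta>(1)])
  have ex\<theta>: "\<exists>\<eta>. esm \<eta> \<and> (\<forall>t. b \<le> \<bar>t\<bar> \<longrightarrow> \<eta> t = 0) \<and> (\<forall>t\<in>{0..b}. \<bar>\<eta> t - \<theta> t\<bar> \<le> 1 / real (Suc j)) \<and>
      (\<forall>t\<in>{0..b}. \<bar>frechet_derivative \<eta> (at t) 1 - \<theta>' t\<bar> \<le> 1 / real (Suc j))" for j :: nat
    using time_approx[OF \<theta> \<sigma>(1,2), of "1 / real (Suc j)"] by (metis of_nat_0_less_iff zero_less_Suc zero_less_divide_1_iff)
  then obtain \<eta> where "\<forall>j. esm (\<eta> j) \<and> (\<forall>t. b \<le> \<bar>t\<bar> \<longrightarrow> \<eta> j t = 0) \<and> (\<forall>t\<in>{0..b}. \<bar>\<eta> j t - \<theta> t\<bar> \<le> 1 / real (Suc j)) \<and>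
      (\<forall>t\<in>{0..b}. \<bar>frechet_derivative (\<eta> j) (at t) 1 - \<theta>' t\<bar> \<le> 1 / real (Suc j))" by metis
  then have \<eta>: "\<And>j. esm (\<eta> j)" "\<And>j t. b \<le> \<bar>t\<bar> \<Longrightarrow> \<eta> j t = 0" "\<And>j t. t \<in> {0..b} \<Longrightarrow> \<bar>\<eta> j t - \<theta> t\<bar> \<le> 1 / real (Suc j)"
     "\<And>j t. t \<in> {0..b} \<Longrightarrow> \<bar>frechet_derivative (\<eta> j) (at t) 1 - \<theta>' t\<bar> \<le> 1 / real (Suc j)" by auto
  let ?L = "T + R + 2"
  have exQ: "\<exists>Q::'a \<Rightarrow> real. esm Q \<and> (\<forall>x. norm x \<le> ?L \<longrightarrow> \<bar>Q x - \<phi> (norm x)\<bar> \<le> 1 / real (Suc j)) \<and>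
    (\<forall>x. norm x \<le> ?L \<longrightarrow> \<bar>laplace Q x - a (norm x) * \<phi> (norm x)\<bar> \<le> 1 / real (Suc j))" for j :: nat
    using space_approx[OF a(1) \<phi>, of "1 / real (Suc j)" ?L] by (metis of_nat_0_less_iff zero_less_Suc zero_less_divide_1_iff)
  then obtain Q where "\<forall>j. esm (Q j :: 'a \<Rightarrow> real) \<and> (\<forall>x. norm x \<le> ?L \<longrightarrow> \<bar>Q j x - \<phi> (norm x)\<bar> \<le> 1 / real (Suc j)) \<and>
    (\<forall>x. norm x \<le> ?L \<longrightarrow> \<bar>laplace (Q j) x - a (norm x) * \<phi> (norm x)\<bar> \<le> 1 / real (Suc j))" by metis
  then have Q: "\<And>j. esm (Q j)" "\<And>j x. norm x \<le> ?L \<Longrightarrow> \<bar>Q j x - \<phi> (norm x)\<bar> \<le> 1 / real (Suc j)"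
    "\<And>j x. norm x \<le> ?L \<Longrightarrow> \<bar>laplace (Q j) x - a (norm x) * \<phi> (norm x)\<bar> \<le> 1 / real (Suc j)" by auto
  define \<zeta> where "\<zeta> = (\<lambda>j x. \<kappa> x * Q j x)"
  have \<zeta>: "esm (\<zeta> j)" "\<And>x. ?L \<le> norm x \<Longrightarrow> \<zeta> j x = 0" "\<And>x. norm x \<le> T + R \<Longrightarrow> \<zeta> j x = Q j x" for j
    using \<kappa> Q(1) by (auto simp: \<zeta>_def intro!: esm_mult)
  have lap: "laplace (\<zeta> j) x = laplace (Q j) x" if "norm x \<le> T + R" for j x
    by (rule laplace_cong_open[of "{y. norm y < T + R + 1}"])
      (use that \<zeta>(1) \<kappa>(4) in \<open>auto simp: \<zeta>_def intro!: open_Collect_less continuous_intros\<close>)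
  define d where "d = (\<lambda>j t. frechet_derivative (\<eta> j) (at t) 1)"
  have d0: "d j t = 0" if "b < t" for j t
    unfolding d_def using that \<eta>(2) frechet_derivative_eq_0_outside[of b "\<eta> j" t 1] by auto
  define \<phi>x where "\<phi>x = (\<lambda>x::'a. \<phi> (norm x))"
  define ax where "ax = (\<lambda>x::'a. a (norm x) * \<phi> (norm x))"
  have c\<phi>x: "continuous_on UNIV \<phi>x" and cax: "continuous_on UNIV ax"
    unfolding \<phi>x_def ax_def
    by (intro continuous_intros continuous_on_compose2[OF \<phi>(1)] continuous_on_compose2[OF a(1)]; simp)+
  note meas = borel_measurable_continuous_onI[OF c\<phi>x] borel_measurable_continuous_onI[OF cax]
    borel_measurable_continuous_onI[OF coeff(1)] borel_measurable_continuous_onI[OF coeff(2)]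
    borel_measurable_continuous_onI[OF c\<theta>] borel_measurable_continuous_onI[OF \<theta>(2)]
  have mj: "\<eta> j \<in> borel_measurable borel" "d j \<in> borel_measurable borel" "Q j \<in> borel_measurable borel"
    "laplace (Q j) \<in> borel_measurable borel" "\<zeta> j \<in> borel_measurable borel" "tail b (\<eta> j) \<in> borel_measurable borel" for j
    unfolding d_def by (intro borel_measurable_continuous_onI esm_continuous esm_frechet_derivative esm_laplace \<eta> Q \<zeta> tail_measurable)+
  have mt: "tail b \<theta> \<in> borel_measurable borel" by (intro tail_measurable c\<theta>)
  have m\<kappa>: "\<kappa> \<in> borel_measurable borel" by (intro borel_measurable_continuous_onI esm_continuous \<kappa>)
  obtain K1 where K1: "0 \<le> K1" "\<And>x. norm x \<le> ?L \<Longrightarrow> \<bar>\<phi>x x\<bar> \<le> K1" by (rule continuous_bounded_ball[OF c\<phi>x, of ?L]) (rule that)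
  obtain K2 where K2: "0 \<le> K2" "\<And>x. norm x \<le> ?L \<Longrightarrow> \<bar>ax x\<bar> \<le> K2" by (rule continuous_bounded_ball[OF cax, of ?L]) (rule that)
  obtain K3 where K3: "0 \<le> K3" "\<And>x. norm x \<le> ?L \<Longrightarrow> \<bar>D x\<bar> \<le> K3" by (rule continuous_bounded_ball[OF coeff(1), of ?L]) (rule that)
  obtain K4 where K4: "0 \<le> K4" "\<And>x. norm x \<le> ?L \<Longrightarrow> \<bar>V x\<bar> \<le> K4" by (rule continuous_bounded_ball[OF coeff(2), of ?L]) (rule that)
  obtain K5 where K5: "0 \<le> K5" "\<And>t. norm t \<le> b \<Longrightarrow> \<bar>\<theta> t\<bar> \<le> K5" by (rule continuous_bounded_ball[OF c\<theta>, of b]) (rule that)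
  obtain K6 where K6: "0 \<le> K6" "\<And>t. norm t \<le> b \<Longrightarrow> \<bar>\<theta>' t\<bar> \<le> K6" by (rule continuous_bounded_ball[OF \<theta>(2), of b]) (rule that)
  have j1: "1 / real (Suc j) \<le> 1" for j by simp
  have bQ: "\<bar>Q j x\<bar> \<le> K1 + 1" if "norm x \<le> ?L" for j x
    using Q(2)[OF that, of j] K1(2)[OF that] j1[of j] unfolding \<phi>x_def by linarith
  have bl: "\<bar>laplace (Q j) x\<bar> \<le> K2 + 1" if "norm x \<le> ?L" for j x
    using Q(3)[OF that, of j] K2(2)[OF that] j1[of j] unfolding ax_def by linarith
  have b\<eta>0: "\<bar>\<eta> j t\<bar> \<le> K5 + 1" and bd0: "\<bar>d j t\<bar> \<le> K6 + 1" if t: "t \<in> {0..b}" for j t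
  proof -
    have "norm t \<le> b" using t by simp
    then show "\<bar>\<eta> j t\<bar> \<le> K5 + 1" "\<bar>d j t\<bar> \<le> K6 + 1"
      unfolding d_def using \<eta>(3,4)[OF t, of j] K5(2) K6(2) j1[of j] by (smt (verit))+
  qed
  have b\<eta>: "\<bar>\<eta> j t\<bar> \<le> K5 + 1" and bd: "\<bar>d j t\<bar> \<le> K6 + 1" if "0 < t" for j t
    using b\<eta>0[of t j] bd0[of t j] \<eta>(2)[of t j] d0[of t j] K5(1) K6(1) that by (cases "t \<le> b"; simp)+
  have c\<eta>: "continuous_on UNIV (\<eta> j)" for j by (intro esm_continuous \<eta>)
  have bt: "\<bar>tail b (\<eta> j) t\<bar> \<le> (K5 + 1) * b" for j t
    by (rule tail_abs_le[OF c\<eta> b0 _ b\<eta>0]) (use K5 in auto)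
  have lt: "(\<lambda>j. tail b (\<eta> j) t) \<longlonglongrightarrow> tail b \<theta> t" for t
    by (rule tendsto_of_le_inverse[where C = b], subst mult.commute, rule tail_diff_le[OF c\<eta> c\<theta> b0])
      (use \<eta>(3) in auto)
  have l\<eta>: "(\<lambda>j. \<eta> j t) \<longlonglongrightarrow> \<theta> t" if "0 \<le> t" for t
  proof (cases "t \<le> b")
    case True
    then show ?thesis using \<eta>(3)[of t] that by (intro tendsto_of_le_inverse[where C = 1]) auto
  next
    case False then show ?thesis using \<eta>(2)[of t] \<theta>(3)[of t] \<sigma> that by simp
  qed
  have \<theta>'0: "\<theta>' t = 0" if "b < t" for t
  proof -
    have "((\<lambda>_. 0) has_real_derivative \<theta>' t) (at t)"
      by (rule has_field_derivative_transform_within_open[OF \<theta>(1), where S = "{\<sigma><..}"]) (use \<theta>(3) that \<sigma> in auto)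
    then show ?thesis using DERIV_unique[OF _ DERIV_const] by blast
  qed
  have ld: "(\<lambda>j. d j t) \<longlonglongrightarrow> \<theta>' t" if "0 \<le> t" for t
  proof (cases "t \<le> b")
    case True
    then show ?thesis using \<eta>(4)[of t] that unfolding d_def by (intro tendsto_of_le_inverse[where C = 1]) auto
  next
    case False then show ?thesis using d0[of t] \<theta>'0[of t] by simp
  qed
  have lQ: "(\<lambda>j. Q j x) \<longlonglongrightarrow> \<phi>x x" if "norm x \<le> ?L" for x
    using Q(2)[OF that] unfolding \<phi>x_def by (intro tendsto_of_le_inverse[where C = 1]) auto
  have ll: "(\<lambda>j. laplace (Q j) x) \<longlonglongrightarrow> ax x" if "norm x \<le> ?L" for x
    using Q(3)[OF that] unfolding ax_def by (intro tendsto_of_le_inverse[where C = 1]) auto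
  have RL: "R \<le> T + R" "T + R \<le> ?L" "norm x \<le> R \<Longrightarrow> norm x \<le> ?L" for x :: 'a using T by auto

  have A: "(\<lambda>j. \<integral>x. w1 x * \<zeta> j x \<partial>lborel) \<longlonglongrightarrow> (\<integral>x. w1 x * \<phi>x x \<partial>lborel)"
  proof (rule integral_compact_dominated[OF data(2,4) mj(5) meas(1), where K = "K1 + 1"])
    fix x :: 'a assume x: "norm x \<le> R"
    then have eq: "\<zeta> j x = Q j x" for j using \<zeta>(3)[of x j] T by auto
    show "\<bar>\<zeta> j x\<bar> \<le> K1 + 1" for j unfolding eq using bQ[of x j] x RL by auto
    show "(\<lambda>j. \<zeta> j x) \<longlonglongrightarrow> \<phi>x x" unfolding eq using lQ[of x] x RL by auto
  qed
  have mlz: "laplace (\<zeta> j) \<in> borel_measurable borel" for j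
    by (intro borel_measurable_continuous_onI esm_continuous esm_laplace \<zeta>)
  have B: "(\<lambda>j. \<integral>x. w0 x * (laplace (\<zeta> j) x - V x * \<zeta> j x) \<partial>lborel) \<longlonglongrightarrow> (\<integral>x. w0 x * (ax x - V x * \<phi>x x) \<partial>lborel)"
  proof (rule integral_compact_dominated[OF data(1,3), where K = "(K2 + 1) + K4 * (K1 + 1)"])
    show "(\<lambda>x. laplace (\<zeta> j) x - V x * \<zeta> j x) \<in> borel_measurable borel" for j
      using meas mj mlz by (intro borel_measurable_diff borel_measurable_times) auto
    show "(\<lambda>x. ax x - V x * \<phi>x x) \<in> borel_measurable borel"
      using meas by (intro borel_measurable_diff borel_measurable_times) auto
    fix x :: 'a assume x: "norm x \<le> R"
    then have eq: "\<zeta> j x = Q j x" "laplace (\<zeta> j) x = laplace (Q j) x" for j using \<zeta>(3)[of x j] lap[of x j] T by auto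
    have xL: "norm x \<le> ?L" using x RL by auto
    show "\<bar>laplace (\<zeta> j) x - V x * \<zeta> j x\<bar> \<le> (K2 + 1) + K4 * (K1 + 1)" for j
    proof -
      have "\<bar>laplace (\<zeta> j) x - V x * \<zeta> j x\<bar> \<le> \<bar>laplace (Q j) x\<bar> + \<bar>V x\<bar> * \<bar>Q j x\<bar>"
        unfolding eq by (metis abs_mult abs_triangle_ineq4)
      also have "\<dots> \<le> (K2 + 1) + K4 * (K1 + 1)"
        by (intro add_mono mult_mono bl bQ K4 xL) auto
      finally show ?thesis .
    qed
    show "(\<lambda>j. laplace (\<zeta> j) x - V x * \<zeta> j x) \<longlonglongrightarrow> ax x - V x * \<phi>x x"
      unfolding eq by (intro tendsto_intros ll lQ xL)
  qed
  have \<kappa>abs: "\<bar>\<kappa> x\<bar> \<le> 1" for x using \<kappa>(2,3)[of x] by simp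
  \<comment> \<open>The approximations in time are controlled only for nonnegative times, whereas
    \<open>loc_int_dominated\<close> asks for bounds everywhere; the indicator removes negative
    times without changing the integral.\<close>
  define GN where "GN = (\<lambda>j (z::real \<times> 'a). indicator {0<..} (fst z) * (\<eta> j (fst z) * \<zeta> j (snd z)))"
  have mi: "(\<lambda>z :: real \<times> 'a. indicator {0<..} (fst z) :: real) \<in> borel_measurable borel"
    using continuous_borel_pair[of "indicator {0<..}" "\<lambda>_::'a. 1"] by simp
  have mic: "(\<lambda>z :: real \<times> 'a. indicator (cball 0 (T + R)) (snd z) :: real) \<in> borel_measurable borel"
    using continuous_borel_pair[of "\<lambda>_. 1" "indicator (cball (0::'a) (T + R))"]
    by (simp add: borel_measurable_indicator)
  have C: "(\<lambda>j. LINT z:?S|lborel. N (fst z) (snd z) * GN j z) \<longlonglongrightarrow>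
      (LINT z:?S|lborel. N (fst z) (snd z) * (\<theta> (fst z) * (\<kappa> (snd z) * \<phi>x (snd z))))"
    and iC: "set_integrable lborel ?S (\<lambda>z. N (fst z) (snd z) * (\<theta> (fst z) * (\<kappa> (snd z) * \<phi>x (snd z))))"
  proof -
    have *: "\<And>j. GN j \<in> borel_measurable borel" "(\<lambda>z. \<theta> (fst z) * (\<kappa> (snd z) * \<phi>x (snd z))) \<in> borel_measurable borel"
      unfolding GN_def
      by (intro borel_measurable_times[OF mi] continuous_borel_pair[where g = "\<lambda>x. \<kappa> x * \<phi>x x"] continuous_borel_pair
          borel_measurable_times meas m\<kappa> mj)+
    have **: "\<bar>GN j z\<bar> \<le> (K5 + 1) * (1 * (K1 + 1))" "b < fst z \<or> ?L < norm (snd z) \<Longrightarrow> GN j z = 0" for j z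
    proof -
      show z: "GN j z = 0" if "b < fst z \<or> ?L < norm (snd z)"
        using that \<eta>(2)[of "fst z" j] \<zeta>(2)[of "snd z" j] by (auto simp: GN_def)
      show "\<bar>GN j z\<bar> \<le> (K5 + 1) * (1 * (K1 + 1))"
      proof (cases "0 < fst z \<and> norm (snd z) \<le> ?L")
        case True
        then have "\<bar>GN j z\<bar> = \<bar>\<eta> j (fst z)\<bar> * (\<bar>\<kappa> (snd z)\<bar> * \<bar>Q j (snd z)\<bar>)" by (simp add: GN_def \<zeta>_def abs_mult)
        also have "\<dots> \<le> (K5 + 1) * (1 * (K1 + 1))"
          using True K5(1) K1(1) by (intro mult_mono b\<eta> \<kappa>abs bQ) auto
        finally show ?thesis .
      next
        case False
        then have "GN j z = 0" using z by (auto simp: GN_def)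
        then show ?thesis using K5(1) K1(1) by simp
      qed
    qed
    have ***: "(\<lambda>j. GN j z) \<longlonglongrightarrow> \<theta> (fst z) * (\<kappa> (snd z) * \<phi>x (snd z))" if "0 < fst z" "fst z < T" for z
    proof (cases "norm (snd z) \<le> ?L")
      case True
      have "(\<lambda>j. \<eta> j (fst z) * (\<kappa> (snd z) * Q j (snd z))) \<longlonglongrightarrow> \<theta> (fst z) * (\<kappa> (snd z) * \<phi>x (snd z))"
        using that by (intro tendsto_intros l\<eta> lQ True) auto
      then show ?thesis using that by (simp add: GN_def \<zeta>_def)
    next
      case False
      then show ?thesis using \<kappa>(5)[of "snd z"] by (simp add: GN_def \<zeta>_def)
    qed
    show "(\<lambda>j. LINT z:?S|lborel. N (fst z) (snd z) * GN j z) \<longlonglongrightarrow>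
      (LINT z:?S|lborel. N (fst z) (snd z) * (\<theta> (fst z) * (\<kappa> (snd z) * \<phi>x (snd z))))"
      "set_integrable lborel ?S (\<lambda>z. N (fst z) (snd z) * (\<theta> (fst z) * (\<kappa> (snd z) * \<phi>x (snd z))))"
      by (rule loc_int_dominated[OF N_loc_int \<sigma>(3) * ** ***]; assumption)+
  qed
  define GW where "GW = (\<lambda>j (z::real \<times> 'a). indicator {0<..} (fst z) * (indicator (cball 0 (T + R)) (snd z) *
     (- d j (fst z) * Q j (snd z) + \<eta> j (fst z) * (D (snd z) * Q j (snd z)) - tail b (\<eta> j) (fst z) * (laplace (Q j) (snd z) - V (snd z) * Q j (snd z)))))"
  define HW where "HW = (\<lambda>z::real \<times> 'a. indicator (cball 0 (T + R)) (snd z) *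
     (- \<theta>' (fst z) * \<phi>x (snd z) + \<theta> (fst z) * (D (snd z) * \<phi>x (snd z)) - tail b \<theta> (fst z) * (ax (snd z) - V (snd z) * \<phi>x (snd z))))"
  have Dl: "(\<lambda>j. LINT z:?S|lborel. wt (fst z) (snd z) * GW j z) \<longlonglongrightarrow> (LINT z:?S|lborel. wt (fst z) (snd z) * HW z)"
    and iD: "set_integrable lborel ?S (\<lambda>z. wt (fst z) (snd z) * HW z)"
  proof -
    have *: "GW j \<in> borel_measurable borel" for j
      unfolding GW_def
      by (rule borel_measurable_times[OF mi borel_measurable_times[OF mic kernel_measurable]]) (rule meas mj)+
    have mHW: "HW \<in> borel_measurable borel"
      unfolding HW_def
      by (rule borel_measurable_times[OF mic kernel_measurable]) (rule meas mt)+
    let ?K = "(K6 + 1) * (K1 + 1) + (K5 + 1) * (K3 * (K1 + 1)) + ((K5 + 1) * b) * ((K2 + 1) + K4 * (K1 + 1))"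
    have K0: "0 \<le> ?K" using K1(1) K2(1) K3(1) K4(1) K5(1) K6(1) b0 by (intro add_nonneg_nonneg mult_nonneg_nonneg) auto
    have **: "\<bar>GW j z\<bar> \<le> ?K" "b < fst z \<or> T + R < norm (snd z) \<Longrightarrow> GW j z = 0" for j z
    proof -
      show z: "GW j z = 0" if "b < fst z \<or> T + R < norm (snd z)"
      proof (cases "b < fst z")
        case True
        then show ?thesis using \<eta>(2)[of "fst z" j] d0[of "fst z" j] tail_eq_0[of b "fst z" "\<eta> j"] \<sigma> by (simp add: GW_def)
      next
        case False
        then show ?thesis using that by (simp add: GW_def)
      qed
      show "\<bar>GW j z\<bar> \<le> ?K"
      proof (cases "0 < fst z \<and> norm (snd z) \<le> T + R")
        case True
        let ?t = "fst z" and ?x = "snd z"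
        have xL: "norm ?x \<le> ?L" using True by auto
        have "\<bar>GW j z\<bar> = \<bar>- d j ?t * Q j ?x + \<eta> j ?t * (D ?x * Q j ?x) - tail b (\<eta> j) ?t * (laplace (Q j) ?x - V ?x * Q j ?x)\<bar>"
          using True by (simp add: GW_def)
        also have "\<dots> \<le> \<bar>d j ?t * Q j ?x\<bar> + \<bar>\<eta> j ?t * (D ?x * Q j ?x)\<bar> + \<bar>tail b (\<eta> j) ?t * (laplace (Q j) ?x - V ?x * Q j ?x)\<bar>"
          by linarith
        also have "\<dots> = \<bar>d j ?t\<bar> * \<bar>Q j ?x\<bar> + \<bar>\<eta> j ?t\<bar> * (\<bar>D ?x\<bar> * \<bar>Q j ?x\<bar>) + \<bar>tail b (\<eta> j) ?t\<bar> * \<bar>laplace (Q j) ?x - V ?x * Q j ?x\<bar>"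
          by (simp only: abs_mult)
        also have "\<dots> \<le> ?K"
        proof (intro add_mono mult_mono bd b\<eta> bt bQ K3 xL)
          have "\<bar>laplace (Q j) ?x - V ?x * Q j ?x\<bar> \<le> \<bar>laplace (Q j) ?x\<bar> + \<bar>V ?x\<bar> * \<bar>Q j ?x\<bar>"
            by (metis abs_mult abs_triangle_ineq4)
          also have "\<dots> \<le> (K2 + 1) + K4 * (K1 + 1)" by (intro add_mono mult_mono bl bQ K4 xL) auto
          finally show "\<bar>laplace (Q j) ?x - V ?x * Q j ?x\<bar> \<le> (K2 + 1) + K4 * (K1 + 1)" .
        qed (use True K1(1) K2(1) K3(1) K4(1) K5(1) K6(1) b0 in auto)
        finally show ?thesis .
      next
        case False
        then have "GW j z = 0" using z by (auto simp: GW_def)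
        then show ?thesis using K0 by simp
      qed
    qed
    have ***: "(\<lambda>j. GW j z) \<longlonglongrightarrow> HW z" if "0 < fst z" "fst z < T" for z
    proof (cases "norm (snd z) \<le> T + R")
      case True
      then have xL: "norm (snd z) \<le> ?L" by simp
      have "(\<lambda>j. - d j (fst z) * Q j (snd z) + \<eta> j (fst z) * (D (snd z) * Q j (snd z)) - tail b (\<eta> j) (fst z) * (laplace (Q j) (snd z) - V (snd z) * Q j (snd z)))
        \<longlonglongrightarrow> - \<theta>' (fst z) * \<phi>x (snd z) + \<theta> (fst z) * (D (snd z) * \<phi>x (snd z)) - tail b \<theta> (fst z) * (ax (snd z) - V (snd z) * \<phi>x (snd z))"
        using that by (intro tendsto_intros ld l\<eta> lt lQ ll xL) auto
      then show ?thesis using that True by (simp add: GW_def HW_def)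
    qed (simp add: GW_def HW_def)
    show "(\<lambda>j. LINT z:?S|lborel. wt (fst z) (snd z) * GW j z) \<longlonglongrightarrow> (LINT z:?S|lborel. wt (fst z) (snd z) * HW z)"
      "set_integrable lborel ?S (\<lambda>z. wt (fst z) (snd z) * HW z)"
      by (rule loc_int_dominated[OF wt_loc_int \<sigma>(3) * mHW ** ***]; assumption)+
  qed
  have pid: "\<epsilon> * (\<eta> j 0 * (\<integral>x. w1 x * \<zeta> j x \<partial>lborel) + tail b (\<eta> j) 0 * (\<integral>x. w0 x * (laplace (\<zeta> j) x - V x * \<zeta> j x) \<partial>lborel))
     + (LINT z:?S|lborel. N (fst z) (snd z) * GN j z) = (LINT z:?S|lborel. wt (fst z) (snd z) * GW j z)" for j
  proof -
    have n: "(LINT z:?S|lborel. N (fst z) (snd z) * GN j z) = (LINT z:?S|lborel. N (fst z) (snd z) * (\<eta> j (fst z) * \<zeta> j (snd z)))"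
      unfolding set_lebesgue_integral_def by (intro Bochner_Integration.integral_cong refl) (auto simp: GN_def indicator_def)
    let ?G = "\<lambda>z. - d j (fst z) * \<zeta> j (snd z) + \<eta> j (fst z) * (D (snd z) * \<zeta> j (snd z)) - tail b (\<eta> j) (fst z) * (laplace (\<zeta> j) (snd z) - V (snd z) * \<zeta> j (snd z))"
    have m1: "?G \<in> borel_measurable borel"
      by (intro kernel_measurable meas mj mlz)
    have m2: "GW j \<in> borel_measurable borel"
      unfolding GW_def
      by (rule borel_measurable_times[OF mi borel_measurable_times[OF mic kernel_measurable]]) (rule meas mj)+
    have mS: "(\<lambda>z. indicator ?S z :: real) \<in> borel_measurable borel"
      by (intro borel_measurable_indicator borel_Times) auto
    \<comment> \<open>Within radius T + R the functions \<open>\<zeta> j\<close> and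
      \<open>Q j\<close> have the same values and Laplacians; outside it \<open>wt\<close> vanishes
      almost everywhere on the strip.\<close>
    have "(LINT z:?S|lborel. wt (fst z) (snd z) * ?G z) = (LINT z:?S|lborel. wt (fst z) (snd z) * GW j z)"
      unfolding set_lebesgue_integral_def
    proof (rule integral_cong_AE)
      show "(\<lambda>z. indicator ?S z *\<^sub>R (wt (fst z) (snd z) * ?G z)) \<in> borel_measurable lborel"
        "(\<lambda>z. indicator ?S z *\<^sub>R (wt (fst z) (snd z) * GW j z)) \<in> borel_measurable lborel"
        using mS wt_meas m1 m2 by (auto intro!: borel_measurable_scaleR borel_measurable_times)
      show "AE z in lborel. indicator ?S z *\<^sub>R (wt (fst z) (snd z) * ?G z) = indicator ?S z *\<^sub>R (wt (fst z) (snd z) * GW j z)"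
        using wt_cone_AE
      proof eventually_elim
        case (elim z)
        show ?case
        proof (cases "z \<in> ?S \<and> norm (snd z) \<le> T + R")
          case True
          then show ?thesis using \<zeta>(3)[of "snd z" j] lap[of "snd z" j] by (cases z) (auto simp: GW_def)
        next
          case False
          then show ?thesis using elim by (cases z) (auto simp: indicator_def)
        qed
      qed
    qed
    then show ?thesis
      using product_identity[where \<theta> = "\<eta> j" and \<zeta> = "\<zeta> j", OF \<eta>(1) b0 \<sigma>(3) \<eta>(2) \<zeta>(1) \<zeta>(2)] unfolding n d_def by simp
  qed
  have "(\<lambda>j. \<epsilon> * (\<eta> j 0 * (\<integral>x. w1 x * \<zeta> j x \<partial>lborel) + tail b (\<eta> j) 0 * (\<integral>x. w0 x * (laplace (\<zeta> j) x - V x * \<zeta> j x) \<partial>lborel))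
     + (LINT z:?S|lborel. N (fst z) (snd z) * GN j z)) \<longlonglongrightarrow>
     \<epsilon> * (\<theta> 0 * (\<integral>x. w1 x * \<phi>x x \<partial>lborel) + tail b \<theta> 0 * (\<integral>x. w0 x * (ax x - V x * \<phi>x x) \<partial>lborel))
     + (LINT z:?S|lborel. N (fst z) (snd z) * (\<theta> (fst z) * (\<kappa> (snd z) * \<phi>x (snd z))))"
    by (intro tendsto_intros l\<eta> lt A B C) simp
  then have lim: "\<epsilon> * (\<theta> 0 * (\<integral>x. w1 x * \<phi>x x \<partial>lborel) + tail b \<theta> 0 * (\<integral>x. w0 x * (ax x - V x * \<phi>x x) \<partial>lborel))
     + (LINT z:?S|lborel. N (fst z) (snd z) * (\<theta> (fst z) * (\<kappa> (snd z) * \<phi>x (snd z)))) = (LINT z:?S|lborel. wt (fst z) (snd z) * HW z)"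
    using Dl unfolding pid by (rule LIMSEQ_unique)
  have ax_eq: "ax x - V x * \<phi>x x = (1 + D x) * \<phi> (norm x)" for x
    unfolding ax_def \<phi>x_def a(2) by (simp add: algebra_simps)
  have HW_eq: "HW z = indicator (cball 0 (T + R)) (snd z) * (\<phi> (norm (snd z)) *
          (- \<theta>' (fst z) + \<theta> (fst z) * D (snd z) - tail b \<theta> (fst z) * (1 + D (snd z))))" for z
    unfolding HW_def ax_eq by (simp add: \<phi>x_def algebra_simps)
  show ?id using lim unfolding HW_eq ax_eq by (simp add: \<phi>x_def)
  show ?i1 using iC by (simp add: \<phi>x_def)
  show ?i2 using iD unfolding HW_eq .
qed

end

section \<open>Cone weight and conclusion\<close>

lemma power_diff_le:
  fixes x y :: real
  assumes "0 \<le> x" "x \<le> y"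
  shows "y ^ k - x ^ k \<le> real k * y ^ (k - 1) * (y - x)"
proof (induction k)
  case (Suc k)
  have "y ^ Suc k - x ^ Suc k = y * (y ^ k - x ^ k) + x ^ k * (y - x)" by (simp add: algebra_simps)
  also have "\<dots> \<le> y * (real k * y ^ (k - 1) * (y - x)) + y ^ k * (y - x)"
    using Suc.IH assms by (intro add_mono mult_left_mono mult_right_mono power_mono) auto
  also have "y * (real k * y ^ (k - 1) * (y - x)) = real k * y ^ k * (y - x)"
    by (cases k) (auto simp: mult_ac)
  finally show ?case by (simp add: algebra_simps)
qed simp

definition expw :: "real \<Rightarrow> 'a::euclidean_space \<Rightarrow> real" where
  "expw s x = (1 + norm x) powr (- s) * exp (norm x)"

lemma expw_pos: "0 < expw s x"
proof -
  have "1 + norm x \<noteq> 0" using norm_ge_zero[of x] by linarith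
  then show ?thesis by (simp add: expw_def)
qed

lemma expw_le: "0 \<le> s \<Longrightarrow> norm x \<le> L \<Longrightarrow> expw s x \<le> exp L"
proof -
  assume s: "0 \<le> s" "norm x \<le> L"
  have "1 + norm x \<noteq> 0" using norm_ge_zero[of x] by linarith
  then have "(1 + norm x) powr (- s) \<le> 1" using powr_mono[of "- s" 0 "1 + norm x"] s by simp
  then have "(1 + norm x) powr (- s) * exp (norm x) \<le> 1 * exp L" using s by (intro mult_mono) auto
  then show ?thesis by (simp add: expw_def)
qed

lemma expw_measurable [measurable]: "expw s \<in> borel_measurable borel"
  unfolding expw_def[abs_def] by measurable

lemma expw_integrable_ball:
  assumes "0 \<le> s"
  shows "integrable lborel (\<lambda>x::'a::euclidean_space. indicator (cball 0 \<rho>) x * expw s x)"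
proof (rule Bochner_Integration.integrable_bound)
  show "integrable lborel (\<lambda>x::'a. indicator (cball (0::'a) \<rho>) x * exp \<rho>)"
    by (intro integrable_mult_left integrable_real_indicator) (auto simp: emeasure_bounded_finite[simplified])
  show "AE x::'a in lborel. norm (indicator (cball 0 \<rho>) x * expw s x) \<le> norm (indicator (cball (0::'a) \<rho>) x * exp \<rho>)"
  proof (rule AE_I2)
    fix x :: 'a
    show "norm (indicator (cball 0 \<rho>) x * expw s x) \<le> norm (indicator (cball (0::'a) \<rho>) x * exp \<rho>)"
      using expw_le[OF assms, of x \<rho>] expw_pos[of s x] by (cases "norm x \<le> \<rho>") auto
  qed
  show "(\<lambda>x::'a. indicator (cball 0 \<rho>) x * expw s x) \<in> borel_measurable lborel"
    using expw_measurable[where 'a = 'a] by (auto intro!: borel_measurable_times borel_measurable_indicator)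
qed

text \<open>Induction over unit shells: the shell between N and N + 1 has volume at most n
  \<open>unit_ball_vol\<close> (1 + N)^(2s), and the weight there is at most (1 + N)^(-s) exp (N +
  1). With the factor exp 1 in \<open>v\<close> it contributes no more than the previous bound, and
  doubling is paid for by 2 \<le> exp 1.\<close>

lemma expw_ball_bound_nat:
  fixes N :: nat
  defines "v \<equiv> unit_ball_vol DIM('a::euclidean_space) * DIM('a) * exp 1" and "s \<equiv> (real DIM('a) - 1) / 2"
  shows "(\<integral>x. indicator (cball (0::'a) (real N)) x * expw s x \<partial>lborel) \<le> v * ((1 + real N) powr s * exp (real N))"
proof (induction N)
  case 0
  have s0: "0 \<le> s" using DIM_positive[where 'a = 'a] by (simp add: s_def)
  have "(\<integral>x. indicator (cball (0::'a) (real 0)) x * expw s x \<partial>lborel) = (\<integral>x. 0 \<partial>(lborel::'a measure))"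
  proof (rule integral_cong_AE)
    show "AE x in lborel. indicator (cball (0::'a) (real 0)) x * expw s x = 0"
      using AE_lborel_singleton[of "0::'a"] by eventually_elim (simp add: indicator_def)
  qed (use expw_integrable_ball[OF s0, of 0, where 'a = 'a] in auto)
  then show ?case by (simp add: v_def unit_ball_vol_nonneg)
next
  case (Suc N)
  let ?n = "DIM('a)"
  have s0: "0 \<le> s" using DIM_positive[where 'a = 'a] by (simp add: s_def)
  have v0: "0 \<le> v" by (simp add: v_def unit_ball_vol_nonneg)
  define A where "A = cball (0::'a) (real (Suc N)) - cball 0 (real N)"
  have sub: "cball (0::'a) (real N) \<subseteq> cball 0 (real (Suc N))" by (intro subset_cball) simp
  have Ames: "A \<in> sets borel" unfolding A_def by auto
  have iA: "integrable lborel (\<lambda>x. indicator A x :: real)"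
    by (intro integrable_real_indicator) (auto simp: A_def intro!: emeasure_bounded_finite[simplified] bounded_diff)
  have "measure lborel A = measure lborel (cball (0::'a) (real (Suc N))) - measure lborel (cball (0::'a) (real N))"
    unfolding A_def by (rule measure_Diff) (use sub emeasure_bounded_finite[of "cball (0::'a) (real (Suc N))"] in auto)
  also have "\<dots> = unit_ball_vol ?n * (real (Suc N) ^ ?n - real N ^ ?n)"
    by (simp add: content_cball algebra_simps)
  also have "\<dots> \<le> unit_ball_vol ?n * (real ?n * real (Suc N) ^ (?n - 1) * (real (Suc N) - real N))"
    by (intro mult_left_mono power_diff_le unit_ball_vol_nonneg) auto
  finally have mA: "measure lborel A \<le> unit_ball_vol ?n * (real ?n * real (Suc N) ^ (?n - 1))" by simp
  have pw: "real (Suc N) ^ (?n - 1) = (1 + real N) powr (2 * s)"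
  proof -
    have "2 * s = real (?n - 1)" using DIM_positive[where 'a = 'a] by (simp add: s_def of_nat_diff Suc_leI field_simps)
    then have "(1 + real N) powr (2 * s) = (1 + real N) powr real (?n - 1)" by simp
    also have "\<dots> = (1 + real N) ^ (?n - 1)" by (rule powr_realpow) simp
    finally show ?thesis by simp
  qed
  have "(\<integral>x. indicator (cball (0::'a) (real (Suc N))) x * expw s x \<partial>lborel) \<le>
      (\<integral>x. indicator (cball (0::'a) (real N)) x * expw s x + indicator A x * ((1 + real N) powr (- s) * exp (real (Suc N))) \<partial>lborel)"
  proof (rule integral_mono)
    fix x :: 'a
    show "indicator (cball 0 (real (Suc N))) x * expw s x \<le> indicator (cball 0 (real N)) x * expw s x + indicator A x * ((1 + real N) powr (- s) * exp (real (Suc N)))"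
    proof (cases "x \<in> A")
      case True
      then have x: "real N < norm x" "norm x \<le> real (Suc N)" by (auto simp: A_def)
      have "expw s x \<le> (1 + real N) powr (- s) * exp (real (Suc N))"
        unfolding expw_def using x s0 by (intro mult_mono powr_mono2') auto
      then show ?thesis using True by (simp add: A_def indicator_def)
    next
      case False
      then have "indicator (cball 0 (real (Suc N))) x = (indicator (cball 0 (real N)) x :: real)"
        using sub by (auto simp: A_def indicator_def)
      then show ?thesis using False by simp
    qed
  qed (intro expw_integrable_ball s0 Bochner_Integration.integrable_add integrable_mult_left iA)+
  also have "\<dots> = (\<integral>x. indicator (cball (0::'a) (real N)) x * expw s x \<partial>lborel) + measure lborel A * ((1 + real N) powr (- s) * exp (real (Suc N)))"
    using iA Ames by (subst Bochner_Integration.integral_add) (auto intro: expw_integrable_ball s0)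
  also have "\<dots> \<le> v * ((1 + real N) powr s * exp (real N)) + v * ((1 + real N) powr s * exp (real N))"
  proof (intro add_mono Suc.IH)
    have "measure lborel A * ((1 + real N) powr (- s) * exp (real (Suc N))) \<le>
       (unit_ball_vol ?n * (real ?n * (1 + real N) powr (2 * s))) * ((1 + real N) powr (- s) * exp (real (Suc N)))"
      using mA unfolding pw by (intro mult_right_mono) auto
    also have "\<dots> = unit_ball_vol ?n * real ?n * ((1 + real N) powr (2 * s) * (1 + real N) powr (- s)) * exp (real (Suc N))"
      by (simp only: mult_ac)
    also have "(1 + real N) powr (2 * s) * (1 + real N) powr (- s) = (1 + real N) powr s"
      by (simp flip: powr_add)
    also have "unit_ball_vol ?n * real ?n * (1 + real N) powr s * exp (real (Suc N)) = v * ((1 + real N) powr s * exp (real N))"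
      by (simp add: v_def exp_add)
    finally show "measure lborel A * ((1 + real N) powr (- s) * exp (real (Suc N))) \<le> v * ((1 + real N) powr s * exp (real N))" .
  qed
  also have "\<dots> = v * ((1 + real N) powr s * (2 * exp (real N)))" by simp
  also have "\<dots> \<le> v * ((1 + real (Suc N)) powr s * exp (real (Suc N)))"
  proof (intro mult_left_mono mult_mono v0)
    show "(1 + real N) powr s \<le> (1 + real (Suc N)) powr s" using s0 by (intro powr_mono2) auto
    show "2 * exp (real N) \<le> exp (real (Suc N))"
      using exp_ge_add_one_self[of 1] by (simp add: exp_add)
  qed auto
  finally show ?case .
qed

lemma expw_ball_bound:
  obtains C where "0 < C" "\<And>\<rho>. 0 \<le> \<rho> \<Longrightarrow>
    (\<integral>x. indicator (cball (0::'a::euclidean_space) \<rho>) x * expw ((real DIM('a) - 1) / 2) x \<partial>lborel) \<le> C * ((1 + \<rho>) powr ((real DIM('a) - 1) / 2) * exp \<rho>)"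
proof -
  define v where "v = unit_ball_vol DIM('a) * DIM('a) * exp 1"
  define s where "s = (real DIM('a) - 1) / 2"
  have s0: "0 \<le> s" using DIM_positive[where 'a = 'a] by (simp add: s_def)
  have v0: "0 \<le> v" by (simp add: v_def unit_ball_vol_nonneg)
  have "(\<integral>x. indicator (cball (0::'a) \<rho>) x * expw s x \<partial>lborel) \<le> (v * 2 powr s * exp 1 + 1) * ((1 + \<rho>) powr s * exp \<rho>)" if \<rho>: "0 \<le> \<rho>" for \<rho>
  proof -
    define N where "N = nat \<lceil>\<rho>\<rceil>"
    have N: "\<rho> \<le> real N" "real N \<le> \<rho> + 1"
      using \<rho> of_nat_ceiling[of \<rho>] ceiling_correct[of \<rho>] by (auto simp: N_def)
    have "(\<integral>x. indicator (cball (0::'a) \<rho>) x * expw s x \<partial>lborel) \<le> (\<integral>x. indicator (cball (0::'a) (real N)) x * expw s x \<partial>lborel)"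
      using N expw_pos[of s] by (intro integral_mono expw_integrable_ball s0) (auto simp: indicator_def less_imp_le[OF expw_pos])
    also have "\<dots> \<le> v * ((1 + real N) powr s * exp (real N))"
      unfolding v_def s_def by (rule expw_ball_bound_nat)
    also have "\<dots> \<le> v * ((2 * (1 + \<rho>)) powr s * exp (\<rho> + 1))"
      using N \<rho> s0 v0 by (intro mult_left_mono mult_mono powr_mono2) auto
    also have "\<dots> = (v * 2 powr s * exp 1) * ((1 + \<rho>) powr s * exp \<rho>)"
      using \<rho> by (subst powr_mult) (auto simp: exp_add)
    also have "\<dots> \<le> (v * 2 powr s * exp 1 + 1) * ((1 + \<rho>) powr s * exp \<rho>)"
      by (intro mult_right_mono) auto
    finally show ?thesis .
  qed
  moreover have "0 < v * 2 powr s * exp 1 + 1" using v0 by (simp add: add_nonneg_pos)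
  ultimately show ?thesis using that unfolding s_def by blast
qed

text \<open>Extension by 0 lets all integrals run over the whole space-time. On the cone |x| - t
  \<le> R, so the decay in time offsets the growth in space and the weight is bounded by exp
  R.\<close>

definition coneW :: "real \<Rightarrow> real \<Rightarrow> real \<Rightarrow> real \<times> 'a::euclidean_space \<Rightarrow> real" where
  "coneW s R T z = (if 0 < fst z \<and> fst z < T \<and> norm (snd z) \<le> fst z + R then expw s (snd z) * exp (- fst z) else 0)"

lemma coneW_nonneg: "0 \<le> coneW s R T z"
  using expw_pos[of s "snd z"] by (simp add: coneW_def)

lemma coneW_le: "0 \<le> s \<Longrightarrow> 0 < R \<Longrightarrow> coneW s R T z \<le> exp R"
  using expw_le[of s "snd z" "fst z + R"] by (auto simp: coneW_def exp_add exp_minus field_simps)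

lemma coneW_measurable: "coneW s R T \<in> borel_measurable borel"
proof -
  have "coneW s R T \<in> borel_measurable (borel \<Otimes>\<^sub>M borel :: (real \<times> 'a) measure)"
    unfolding coneW_def[abs_def] by measurable
  then show ?thesis by (simp add: borel_prod)
qed

text \<open>At time t the factor exp (- t) cancels the exponential growth of the ball integral of
  radius t + R, and 1 + t + R \<le> (1 + R) (1 + t) leaves a multiple of (1 + t)^s. Integration over
  [0, \<sigma>] adds one power.\<close>

lemma coneW_cone_weight:
  fixes R :: real
  assumes R: "0 < R" and n: "2 \<le> DIM('a::euclidean_space)"
  obtains C0 where "1 \<le> C0" "\<And>T. cone_weight (lborel :: (real \<times> 'a) measure) fst (coneW ((real DIM('a) - 1) / 2) R T) ((real DIM('a) - 1) / 2) C0 T"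
proof -
  define s where "s = (real DIM('a) - 1) / 2"
  have s0: "0 < s" using n by (simp add: s_def)
  obtain C where C: "0 < C" "\<And>\<rho>. 0 \<le> \<rho> \<Longrightarrow>
    (\<integral>x. indicator (cball (0::'a) \<rho>) x * expw s x \<partial>lborel) \<le> C * ((1 + \<rho>) powr s * exp \<rho>)"
    using expw_ball_bound[where 'a = 'a] unfolding s_def by metis
  define C0 where "C0 = max 1 (C * (1 + R) powr s * exp R)"
  have meas: "(\<lambda>z :: real \<times> 'a. if fst z < \<sigma> then coneW s R T z * (1 + fst z) powr (- e) else 0) \<in> borel_measurable borel" for \<sigma> T e
  proof -
    have [measurable]: "coneW s R T \<in> borel_measurable (borel \<Otimes>\<^sub>M borel :: (real \<times> 'a) measure)"
      using coneW_measurable[of s R T, where 'a = 'a] by (simp add: borel_prod)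
    have "(\<lambda>z :: real \<times> 'a. if fst z < \<sigma> then coneW s R T z * (1 + fst z) powr (- e) else 0) \<in> borel_measurable (borel \<Otimes>\<^sub>M borel)"
      by measurable
    then show ?thesis by (simp add: borel_prod)
  qed
  have "cone_weight (lborel :: (real \<times> 'a) measure) fst (coneW s R T) s C0 T" for T
  proof
    show "fst \<in> borel_measurable (lborel :: (real \<times> 'a) measure)"
    proof -
      have "(fst :: real \<times> 'a \<Rightarrow> real) \<in> borel_measurable (borel \<Otimes>\<^sub>M borel)" by measurable
      then show ?thesis by (simp add: borel_prod)
    qed
    show "coneW s R T \<in> borel_measurable (lborel :: (real \<times> 'a) measure)" using coneW_measurable by simp
    show "0 \<le> coneW s R T z" for z :: "real \<times> 'a" by (rule coneW_nonneg)
    show "coneW s R T z \<noteq> 0 \<Longrightarrow> 0 \<le> fst z" for z :: "real \<times> 'a" by (auto simp: coneW_def split: if_splits)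
    show "1 \<le> C0" by (simp add: C0_def)
    show "0 < s" by (rule s0)
    fix e \<sigma> :: real assume e: "0 \<le> e" "e \<le> s" and \<sigma>: "1 \<le> \<sigma>" "\<sigma> < T"
    define F where "F = (\<lambda>z :: real \<times> 'a. if fst z < \<sigma> then coneW s R T z * (1 + fst z) powr (- e) else 0)"
    have le: "norm (F z) \<le> norm (indicator ({0..\<sigma>} \<times> cball 0 (\<sigma> + R)) z * exp R :: real)" for z
    proof (cases "0 < fst z \<and> fst z < \<sigma> \<and> norm (snd z) \<le> fst z + R")
      case True
      then have "z \<in> {0..\<sigma>} \<times> cball 0 (\<sigma> + R)" by (cases z) auto
      moreover have "(1 + fst z) powr (- e) \<le> 1" using powr_mono[of "- e" 0 "1 + fst z"] True e by simp
      then have "coneW s R T z * (1 + fst z) powr (- e) \<le> exp R * 1"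
        using coneW_le[OF less_imp_le[OF s0] R, of T z] by (intro mult_mono) (auto simp: coneW_nonneg)
      ultimately show ?thesis using True by (simp add: F_def coneW_nonneg abs_mult)
    next
      case False
      then have "F z = 0" using \<sigma> by (auto simp: F_def coneW_def)
      then show ?thesis by simp
    qed
    have int: "integrable lborel F"
    proof (rule Bochner_Integration.integrable_bound)
      show "integrable lborel (\<lambda>z. indicator ({0..\<sigma>} \<times> cball (0::'a) (\<sigma> + R)) z * exp R :: real)"
        by (intro integrable_mult_left integrable_real_indicator borel_Times)
          (auto simp: borel_Times intro!: emeasure_bounded_finite[simplified] bounded_Times)
      show "AE z in lborel. norm (F z) \<le> norm (indicator ({0..\<sigma>} \<times> cball 0 (\<sigma> + R)) z * exp R :: real)"
        using le by simp
    qed (use meas in \<open>simp add: F_def\<close>)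
    then show "integrable lborel (\<lambda>z :: real \<times> 'a. if fst z < \<sigma> then coneW s R T z * (1 + fst z) powr (- e) else 0)"
      by (simp add: F_def)
    have intp: "integrable (lborel \<Otimes>\<^sub>M lborel) F" using int unfolding lborel_prod .
    have "(\<integral>z. F z \<partial>lborel) = (\<integral>t. \<integral>x. F (t, x) \<partial>lborel \<partial>lborel)"
      using lborel_pair.integral_fst'[OF intp] by (simp add: lborel_prod)
    also have "\<dots> \<le> (\<integral>t. indicator {0..\<sigma>} t * (C0 * (1 + \<sigma>) powr (s - e)) \<partial>lborel)"
    proof (rule integral_mono)
      show "integrable lborel (\<lambda>t. \<integral>x. F (t, x) \<partial>lborel)" using lborel_pair.integrable_fst'[OF intp] .
      show "integrable lborel (\<lambda>t. indicator {0..\<sigma>} t * (C0 * (1 + \<sigma>) powr (s - e)) :: real)"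
        by (intro integrable_mult_left integrable_real_indicator) (auto intro: emeasure_bounded_finite[simplified])
      fix t :: real
      show "(\<integral>x. F (t, x) \<partial>lborel) \<le> indicator {0..\<sigma>} t * (C0 * (1 + \<sigma>) powr (s - e))"
      proof (cases "0 < t \<and> t < \<sigma>")
        case True
        have "(\<integral>x. F (t, x) \<partial>lborel) = (\<integral>x. (exp (- t) * (1 + t) powr (- e)) * (indicator (cball (0::'a) (t + R)) x * expw s x) \<partial>lborel)"
          using True \<sigma> by (intro Bochner_Integration.integral_cong refl) (auto simp: F_def coneW_def indicator_def)
        also have "\<dots> = (exp (- t) * (1 + t) powr (- e)) * (\<integral>x. indicator (cball (0::'a) (t + R)) x * expw s x \<partial>lborel)"
          by (rule integral_mult_right_zero)
        also have "\<dots> \<le> (exp (- t) * (1 + t) powr (- e)) * (C * ((1 + (t + R)) powr s * exp (t + R)))"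
          using True R by (intro mult_left_mono C) auto
        also have "\<dots> \<le> (exp (- t) * (1 + t) powr (- e)) * (C * (((1 + R) * (1 + t)) powr s * exp (t + R)))"
          using True R C s0 by (intro mult_left_mono mult_right_mono powr_mono2) (auto simp: algebra_simps)
        also have "\<dots> = (C * (1 + R) powr s * exp R) * ((1 + t) powr s * (1 + t) powr (- e))"
          using True R by (subst powr_mult) (auto simp: exp_add exp_minus)
        also have "\<dots> = (C * (1 + R) powr s * exp R) * (1 + t) powr (s - e)"
          by (simp flip: powr_add)
        also have "\<dots> \<le> C0 * (1 + \<sigma>) powr (s - e)"
          using True e by (intro mult_mono powr_mono2) (auto simp: C0_def)
        finally show ?thesis using True by simp
      next
        case False
        then have "(\<lambda>x. F (t, x)) = (\<lambda>_. 0)" by (auto simp: F_def coneW_def)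
        then show ?thesis by (simp add: C0_def)
      qed
    qed
    also have "\<dots> = \<sigma> * (C0 * (1 + \<sigma>) powr (s - e))" using \<sigma> by simp
    also have "\<dots> \<le> (1 + \<sigma>) * (C0 * (1 + \<sigma>) powr (s - e))"
      by (intro mult_right_mono) (auto simp: C0_def)
    also have "\<dots> = C0 * (1 + \<sigma>) powr (s + 1 - e)"
      using \<sigma> powr_add[of "1 + \<sigma>" "s - e" 1] by (simp add: algebra_simps)
    finally show "(\<integral>z. (if fst z < \<sigma> then coneW s R T z * (1 + fst z) powr (- e) else 0) \<partial>(lborel :: (real \<times> 'a) measure)) \<le> C0 * (1 + \<sigma>) powr (s + 1 - e)"
      by (simp add: F_def)
  qed
  then show ?thesis using that[of C0] unfolding s_def by (simp add: C0_def)
qed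

section \<open>The time profile\<close>

lemma DERIV_pos_part_power:
  fixes y :: real
  assumes "2 \<le> k"
  shows "((\<lambda>y. max 0 y ^ k) has_real_derivative real k * max 0 y ^ (k - 1)) (at y)"
proof -
  consider "y > 0" | "y < 0" | "y = 0" by linarith
  then show ?thesis
  proof cases
    case 1
    have "((\<lambda>y. y ^ k) has_real_derivative real k * max 0 y ^ (k - 1)) (at y)"
      using 1 DERIV_pow[of k y] by simp
    then show ?thesis
      by (rule has_field_derivative_transform_within_open[where S = "{0<..}"]) (use 1 in auto)
  next
    case 2
    have "((\<lambda>y. 0) has_real_derivative real k * max 0 y ^ (k - 1)) (at y)"
      using 2 assms by (simp add: power_0_left)
    then show ?thesis
      by (rule has_field_derivative_transform_within_open[where S = "{..<0}"]) (use 2 assms in auto)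
  next
    case 3
    have "((\<lambda>h. \<bar>h\<bar> ^ (k - 1)) \<longlongrightarrow> \<bar>0::real\<bar> ^ (k - 1)) (at 0)" by (intro tendsto_intros)
    then have lim: "((\<lambda>h. \<bar>h\<bar> ^ (k - 1)) \<longlongrightarrow> (0::real)) (at 0)" using assms by (simp add: power_0_left)
    have "((\<lambda>h. (max 0 (0 + h) ^ k - max 0 0 ^ k) / h) \<longlongrightarrow> (0::real)) (at 0)"
    proof (rule Lim_null_comparison[OF _ lim])
      have "norm ((max 0 (0 + h) ^ k - max 0 0 ^ k) / h) \<le> \<bar>h\<bar> ^ (k - 1)" for h :: real
        using assms by (cases k) (auto simp: max_def)
      then show "\<forall>\<^sub>F h in at 0. norm ((max 0 (0 + h) ^ k - max 0 0 ^ k) / h) \<le> \<bar>h :: real\<bar> ^ (k - 1)" by simp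
    qed
    then show ?thesis unfolding 3 DERIV_def using assms by (simp add: power_0_left)
  qed
qed

definition ramp :: "real \<Rightarrow> real \<Rightarrow> real" where "ramp \<sigma> t = max 0 ((\<sigma> - t) / (1 + \<sigma>))"

definition prof :: "nat \<Rightarrow> real \<Rightarrow> real \<Rightarrow> real" where "prof k \<sigma> t = ramp \<sigma> t ^ k * exp (- t)"

text \<open>The part of \<open>- prof'\<close> that comes from the polynomial factor, namely -
  \<eta>' exp (- t) with \<eta> the k-th power of \<open>ramp\<close>.\<close>

definition slope :: "nat \<Rightarrow> real \<Rightarrow> real \<Rightarrow> real" where
  "slope k \<sigma> t = real k / (1 + \<sigma>) * ramp \<sigma> t ^ (k - 1) * exp (- t)"

lemma ramp_nonneg: "0 \<le> ramp \<sigma> t" by (simp add: ramp_def)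

lemma continuous_ramp: "continuous_on UNIV (ramp \<sigma>)"
  unfolding ramp_def[abs_def] divide_inverse by (intro continuous_intros)

lemma DERIV_prof:
  assumes "2 \<le> k" "1 \<le> \<sigma>"
  shows "(prof k \<sigma> has_real_derivative - slope k \<sigma> t - prof k \<sigma> t) (at t)"
proof -
  have "((\<lambda>t. (\<sigma> - t) / (1 + \<sigma>)) has_real_derivative (- 1) / (1 + \<sigma>)) (at t)"
    by (rule DERIV_cdivide) (auto intro!: derivative_eq_intros)
  from DERIV_chain2[OF DERIV_pos_part_power[OF assms(1)] this]
  have "((\<lambda>t. ramp \<sigma> t ^ k) has_real_derivative real k * ramp \<sigma> t ^ (k - 1) * ((- 1) / (1 + \<sigma>))) (at t)"
    by (simp add: ramp_def)
  moreover have "((\<lambda>t. exp (- t)) has_real_derivative exp (- t) * - 1) (at t)"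
    by (intro DERIV_fun_exp derivative_eq_intros) auto
  ultimately have "((\<lambda>t. ramp \<sigma> t ^ k * exp (- t)) has_real_derivative
      real k * ramp \<sigma> t ^ (k - 1) * ((- 1) / (1 + \<sigma>)) * exp (- t) + exp (- t) * - 1 * ramp \<sigma> t ^ k) (at t)"
    by (rule DERIV_mult)
  then show ?thesis
    unfolding prof_def[abs_def] slope_def by (rule DERIV_cong) (simp add: algebra_simps)
qed

text \<open>As \<open>prof\<close> vanishes at b > \<sigma>, its value at t is the integral of
  \<open>slope + prof\<close> over [t, b]; the difference is therefore the integral of
  \<open>slope\<close>. The polynomial factor of \<open>slope\<close> is nonincreasing, so it may be
  frozen at t, and the remaining integral of exp (- s) is at most exp (- t).\<close>

lemma prof_minus_tail:
  assumes k: "2 \<le> k" and \<sigma>: "1 \<le> \<sigma>" "\<sigma> < b" and t: "0 \<le> t"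
  shows "0 \<le> prof k \<sigma> t - tail b (prof k \<sigma>) t" "prof k \<sigma> t - tail b (prof k \<sigma>) t \<le> slope k \<sigma> t"
proof -
  have r0: "ramp \<sigma> t = 0" if "\<sigma> \<le> t" for t using that \<sigma> by (auto simp: ramp_def divide_le_0_iff intro!: max_absorb1)
  have p0: "prof k \<sigma> t = 0" "slope k \<sigma> t = 0" if "\<sigma> \<le> t" for t using r0[OF that] k by (auto simp: prof_def slope_def power_0_left)
  have cs: "continuous_on S (slope k \<sigma>)" and cp: "continuous_on S (prof k \<sigma>)" for S
    unfolding slope_def[abs_def] prof_def[abs_def]
    by (intro continuous_intros continuous_on_subset[OF continuous_ramp]; simp)+
  have "0 \<le> prof k \<sigma> t - tail b (prof k \<sigma>) t \<and> prof k \<sigma> t - tail b (prof k \<sigma>) t \<le> slope k \<sigma> t"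
  proof (cases "t \<le> b")
    case True
    have "((\<lambda>s. - slope k \<sigma> s - prof k \<sigma> s) has_integral prof k \<sigma> b - prof k \<sigma> t) {t..b}"
      using DERIV_prof[OF k \<sigma>(1)] True
      by (intro fundamental_theorem_of_calculus) (auto simp flip: has_real_derivative_iff_has_vector_derivative intro: DERIV_subset)
    from has_integral_neg[OF this] have "((\<lambda>s. slope k \<sigma> s + prof k \<sigma> s) has_integral prof k \<sigma> t) {t..b}"
      using p0(1)[of b] \<sigma> by (simp add: add.commute)
    then have "integral {t..b} (\<lambda>s. slope k \<sigma> s + prof k \<sigma> s) = prof k \<sigma> t" by (rule integral_unique)
    then have eq: "prof k \<sigma> t - tail b (prof k \<sigma>) t = integral {t..b} (slope k \<sigma>)"
      using True t integral_add[OF integrable_continuous_real[OF cs] integrable_continuous_real[OF cp], of t b] by (simp add: tail_def)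
    have s0: "0 \<le> slope k \<sigma> s" for s using \<sigma> by (simp add: slope_def ramp_nonneg)
    have nn: "0 \<le> integral {t..b} (slope k \<sigma>)" by (intro integral_nonneg integrable_continuous_real cs s0)
    have "integral {t..b} (slope k \<sigma>) \<le> integral {t..b} (\<lambda>s. real k / (1 + \<sigma>) * ramp \<sigma> t ^ (k - 1) * exp (- s))"
    proof (rule integral_le)
      show "(\<lambda>s. real k / (1 + \<sigma>) * ramp \<sigma> t ^ (k - 1) * exp (- s)) integrable_on {t..b}"
        by (intro integrable_continuous_real continuous_intros)
      fix s assume s: "s \<in> {t..b}"
      then have "ramp \<sigma> s \<le> ramp \<sigma> t" unfolding ramp_def using \<sigma> by (intro max.mono order_refl divide_right_mono) auto
      then show "slope k \<sigma> s \<le> real k / (1 + \<sigma>) * ramp \<sigma> t ^ (k - 1) * exp (- s)"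
        unfolding slope_def using \<sigma> by (intro mult_right_mono mult_left_mono power_mono ramp_nonneg) auto
    qed (intro integrable_continuous_real cs)
    also have "integral {t..b} (\<lambda>s. real k / (1 + \<sigma>) * ramp \<sigma> t ^ (k - 1) * exp (- s)) = real k / (1 + \<sigma>) * ramp \<sigma> t ^ (k - 1) * (exp (- t) - exp (- b))"
    proof -
      have "((\<lambda>s. exp (- s)) has_integral (- exp (- b)) - (- exp (- t))) {t..b}"
        using True by (intro fundamental_theorem_of_calculus)
          (auto simp flip: has_real_derivative_iff_has_vector_derivative intro!: derivative_eq_intros)
      from integral_unique[OF this] have "integral {t..b} (\<lambda>s. exp (- s)) = exp (- t) - exp (- b)" by simp
      then show ?thesis by (subst integral_mult_right) (simp only:)
    qed
    also have "\<dots> \<le> slope k \<sigma> t"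
      unfolding slope_def using \<sigma> by (intro mult_left_mono mult_nonneg_nonneg) (auto simp: ramp_nonneg)
    finally show ?thesis using eq nn by simp
  next
    case False
    then show ?thesis using p0[of t] \<sigma> tail_eq_0[of b t] by simp
  qed
  then show "0 \<le> prof k \<sigma> t - tail b (prof k \<sigma>) t" "prof k \<sigma> t - tail b (prof k \<sigma>) t \<le> slope k \<sigma> t" by auto
qed

text \<open>The data term must not degenerate as \<sigma> grows. On [0, 1/2] the ramp is at least
  1/4, with equality for \<sigma> = 1 and t = 1/2, and exp (- 1) bounds the exponential crudely; the
  division by 2 is the length of that interval.\<close>

lemma prof_0_ge:
  assumes \<sigma>: "1 \<le> \<sigma>" "\<sigma> < b"
  shows "(1 / 4) ^ k * exp (- 1) / 2 \<le> prof k \<sigma> 0" "(1 / 4) ^ k * exp (- 1) / 2 \<le> tail b (prof k \<sigma>) 0"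
proof -
  have ge: "(1 / 4) ^ k * exp (- 1) \<le> prof k \<sigma> t" if "0 \<le> t" "t \<le> 1/2" for t
  proof -
    have "1 / 4 \<le> ramp \<sigma> t" using that \<sigma> by (auto simp: ramp_def field_simps max_def)
    then show ?thesis unfolding prof_def using that by (intro mult_mono power_mono) auto
  qed
  have c: "continuous_on S (prof k \<sigma>)" for S
    unfolding prof_def[abs_def] by (intro continuous_intros continuous_on_subset[OF continuous_ramp]; simp)
  have "(1 / 4) ^ k * exp (- 1 :: real) / 2 \<le> (1 / 4) ^ k * exp (- 1)" by simp
  then show "(1 / 4) ^ k * exp (- 1) / 2 \<le> prof k \<sigma> 0" using ge[of 0] by linarith
  have "(1 / 4) ^ k * exp (- 1 :: real) / 2 = integral {0..1/2::real} (\<lambda>_. (1 / 4) ^ k * exp (- 1))" by simp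
  also have "\<dots> \<le> integral {0..1/2} (prof k \<sigma>)"
    by (intro integral_le integrable_continuous_real c continuous_intros) (use ge in auto)
  also have "\<dots> \<le> integral {0..b} (prof k \<sigma>)"
    using \<sigma> by (intro integral_subset_le integrable_continuous_real c) (auto simp: prof_def ramp_nonneg)
  also have "\<dots> = tail b (prof k \<sigma>) 0" using \<sigma> by (simp add: tail_def)
  finally show "(1 / 4) ^ k * exp (- 1) / 2 \<le> tail b (prof k \<sigma>) 0" .
qed

context weak_wave
begin

text \<open>With \<theta> = \<open>prof k \<sigma>\<close> the kernel equals \<open>slope\<close>
  plus (1 + D) (\<theta> - tail), so it lies between 0 and (2 + \<alpha>) \<open>slope\<close>, and
  \<open>slope\<close> carries the factor k / (1 + \<sigma>). The source is bounded below through
  \<open>c1\<close>, the kernel term above through \<open>C1\<close>.\<close>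

lemma cone_inequality:
  fixes a \<phi> :: "real \<Rightarrow> real" and k :: nat
  assumes a: "continuous_on UNIV a" "\<And>x. a (norm x) = 1 + D x + V x"
    and \<phi>: "continuous_on UNIV \<phi>" "\<And>r. \<phi> r = 1 + volterra DIM('a) a \<phi> r" "\<And>r. 1 \<le> \<phi> r"
    and c1: "0 < c1" "\<And>x. c1 * expw s x \<le> \<phi> (norm (x::'a))" and C1: "0 < C1" "\<And>x. \<phi> (norm (x::'a)) \<le> C1 * expw s x"
    and s: "0 \<le> s"
    and D: "\<And>x. 0 \<le> D x" "\<And>x. D x \<le> \<alpha>"
    and w: "\<And>x. 0 \<le> w0 x" "\<And>x. 0 \<le> w1 x" and \<epsilon>: "0 < \<epsilon>"
    and k: "2 \<le> k" and \<sigma>: "1 \<le> \<sigma>" "\<sigma> < T"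
  shows "((1 / 4) ^ k * exp (- 1) / 2 * ((\<integral>x. w1 x * \<phi> (norm x) \<partial>lborel) + (\<integral>x. w0 x * \<phi> (norm x) \<partial>lborel))) * \<epsilon>
     + c1 * (\<integral>z. N (fst z) (snd z) * coneW s R T z * ramp \<sigma> (fst z) ^ k \<partial>lborel)
     \<le> ((2 + \<alpha>) * C1 * real k) / (1 + \<sigma>) * (\<integral>z. \<bar>wt (fst z) (snd z)\<bar> * coneW s R T z * ramp \<sigma> (fst z) ^ (k - 1) \<partial>lborel)"
proof -
  let ?S = "{0<..<T} \<times> (UNIV :: 'a set)"
  define b where "b = (\<sigma> + T) / 2"
  have b: "\<sigma> < b" "b < T" "0 < \<sigma>" using \<sigma> by (auto simp: b_def)
  have L: "0 \<le> T + R + 1" "T + R + 1 < T + R + 2" using T R by auto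
  obtain \<kappa> :: "'a \<Rightarrow> real" where \<kappa>: "esm \<kappa>" "\<And>x. 0 \<le> \<kappa> x" "\<And>x. \<kappa> x \<le> 1" "\<And>x. norm x \<le> T + R + 1 \<Longrightarrow> \<kappa> x = 1" "\<And>x. T + R + 2 \<le> norm x \<Longrightarrow> \<kappa> x = 0"
    by (rule esm_cutoff[OF L, where 'a = 'a]) (rule that)
  define \<theta> where "\<theta> = prof k \<sigma>"
  define \<theta>' where "\<theta>' = (\<lambda>t. - slope k \<sigma> t - prof k \<sigma> t)"
  have d\<theta>: "(\<theta> has_real_derivative \<theta>' t) (at t)" for t unfolding \<theta>_def \<theta>'_def by (rule DERIV_prof[OF k \<sigma>(1)])
  have c\<theta>': "continuous_on UNIV \<theta>'"
    unfolding \<theta>'_def slope_def prof_def by (intro continuous_intros continuous_ramp)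
  have \<theta>0: "\<theta> t = 0" if "\<sigma> \<le> t" for t
  proof -
    have "ramp \<sigma> t = 0" using that \<sigma> by (auto simp: ramp_def divide_le_0_iff intro!: max_absorb1)
    then show ?thesis using k by (simp add: \<theta>_def prof_def power_0_left)
  qed
  note lid = limit_identity[OF a \<phi>(1,2) d\<theta> c\<theta>' \<theta>0 b(3,1,2) \<kappa>]
  let ?N = "\<lambda>z :: real \<times> 'a. N (fst z) (snd z)" and ?w = "\<lambda>z :: real \<times> 'a. wt (fst z) (snd z)"
  let ?ker = "\<lambda>z :: real \<times> 'a. - \<theta>' (fst z) + \<theta> (fst z) * D (snd z) - tail b \<theta> (fst z) * (1 + D (snd z))"
  have \<phi>0: "0 \<le> \<phi> r" for r using \<phi>(3)[of r] by simp
  have \<alpha>0: "0 \<le> \<alpha>" using D(1)[of 0] D(2)[of 0] by linarith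
  have sl0: "0 \<le> slope k \<sigma> t" for t using \<sigma> by (simp add: slope_def ramp_nonneg)
  have ker: "\<bar>?ker z\<bar> \<le> (2 + \<alpha>) * slope k \<sigma> (fst z)" if "0 < fst z" for z
  proof -
    have pt: "0 \<le> \<theta> (fst z) - tail b \<theta> (fst z)" "\<theta> (fst z) - tail b \<theta> (fst z) \<le> slope k \<sigma> (fst z)"
      unfolding \<theta>_def using prof_minus_tail[OF k \<sigma>(1) b(1), of "fst z"] that by auto
    have eq: "?ker z = slope k \<sigma> (fst z) + (1 + D (snd z)) * (\<theta> (fst z) - tail b \<theta> (fst z))"
      unfolding \<theta>'_def \<theta>_def by (simp add: algebra_simps)
    have "(1 + D (snd z)) * (\<theta> (fst z) - tail b \<theta> (fst z)) \<le> (1 + \<alpha>) * slope k \<sigma> (fst z)"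
      using pt D[of "snd z"] by (intro mult_mono) auto
    moreover have "0 \<le> (1 + D (snd z)) * (\<theta> (fst z) - tail b \<theta> (fst z))" using pt D[of "snd z"] by (intro mult_nonneg_nonneg) auto
    ultimately show ?thesis unfolding eq using sl0[of "fst z"] by (simp add: algebra_simps)
  qed
  have mr: "(\<lambda>z :: real \<times> 'a. ramp \<sigma> (fst z) ^ j) \<in> borel_measurable borel" for j
    using continuous_borel_pair[of "\<lambda>t. ramp \<sigma> t ^ j" "\<lambda>_::'a. 1"]
    by (simp add: borel_measurable_continuous_onI continuous_ramp continuous_on_power)
  have r1: "ramp \<sigma> t \<le> 1" if "0 < t" for t using that \<sigma> by (auto simp: ramp_def)
  have r0: "ramp \<sigma> t = 0" if "\<sigma> < t" for t using that \<sigma> by (auto simp: ramp_def divide_le_0_iff intro!: max_absorb1)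
  have G: "(\<lambda>z :: real \<times> 'a. coneW s R T z * ramp \<sigma> (fst z) ^ j) \<in> borel_measurable borel"
     "\<bar>coneW s R T z * ramp \<sigma> (fst z) ^ j\<bar> \<le> exp R" "\<sigma> < fst z \<or> T + R < norm (snd z) \<Longrightarrow> coneW s R T z * ramp \<sigma> (fst z) ^ j = 0"
    if "1 \<le> j" for j and z :: "real \<times> 'a"
  proof -
    show "(\<lambda>z :: real \<times> 'a. coneW s R T z * ramp \<sigma> (fst z) ^ j) \<in> borel_measurable borel"
      by (intro borel_measurable_times coneW_measurable mr)
    show "\<bar>coneW s R T z * ramp \<sigma> (fst z) ^ j\<bar> \<le> exp R"
    proof (cases "0 < fst z")
      case True
      have "coneW s R T z * ramp \<sigma> (fst z) ^ j \<le> exp R * 1"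
        using coneW_le[OF s R, of T z] coneW_nonneg[of s R T z] ramp_nonneg[of \<sigma> "fst z"] r1[OF True]
        by (intro mult_mono power_le_one) auto
      then show ?thesis using coneW_nonneg[of s R T z] ramp_nonneg[of \<sigma> "fst z"] by simp
    qed (simp add: coneW_def)
    show "coneW s R T z * ramp \<sigma> (fst z) ^ j = 0" if "\<sigma> < fst z \<or> T + R < norm (snd z)"
      using that r0[of "fst z"] \<open>1 \<le> j\<close> by (auto simp: coneW_def power_0_left)
  qed
  have strip: "(\<lambda>z. indicator ?S z *\<^sub>R (f z * (coneW s R T z * ramp \<sigma> (fst z) ^ j))) = (\<lambda>z. f z * coneW s R T z * ramp \<sigma> (fst z) ^ j)" for f j
    by (auto simp: coneW_def indicator_def fun_eq_iff)
  have kk: "1 \<le> k" "1 \<le> k - 1" using k by auto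
  have iN: "integrable lborel (\<lambda>z. ?N z * coneW s R T z * ramp \<sigma> (fst z) ^ k)"
  proof -
    have "set_integrable lborel ?S (\<lambda>z. ?N z * (coneW s R T z * ramp \<sigma> (fst z) ^ k))"
      by (rule loc_int_mult[OF N_loc_int \<sigma>(2) G(1)[OF kk(1)] G(2)[OF kk(1)] G(3)[OF kk(1)]])
    then show ?thesis unfolding set_integrable_def strip .
  qed
  have "integrable lborel (\<lambda>z. ?w z * coneW s R T z * ramp \<sigma> (fst z) ^ (k - 1))"
  proof -
    have "set_integrable lborel ?S (\<lambda>z. ?w z * (coneW s R T z * ramp \<sigma> (fst z) ^ (k - 1)))"
      by (rule loc_int_mult[OF wt_loc_int \<sigma>(2) G(1)[OF kk(2)] G(2)[OF kk(2)] G(3)[OF kk(2)]])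
    then show ?thesis unfolding set_integrable_def strip .
  qed
  from integrable_abs[OF this] have iw: "integrable lborel (\<lambda>z. \<bar>?w z\<bar> * coneW s R T z * ramp \<sigma> (fst z) ^ (k - 1))"
    by (simp add: abs_mult abs_of_nonneg[OF coneW_nonneg] ramp_nonneg)

  have lower: "c1 * (\<integral>z. ?N z * coneW s R T z * ramp \<sigma> (fst z) ^ k \<partial>lborel) \<le>
      (LINT z:?S|lborel. ?N z * (\<theta> (fst z) * (\<kappa> (snd z) * \<phi> (norm (snd z)))))"
    unfolding set_lebesgue_integral_def integral_mult_right_zero[symmetric]
  proof (rule integral_mono)
    show "integrable lborel (\<lambda>z. c1 * (?N z * coneW s R T z * ramp \<sigma> (fst z) ^ k))" using iN by simp
    show "integrable lborel (\<lambda>z. indicator ?S z *\<^sub>R (?N z * (\<theta> (fst z) * (\<kappa> (snd z) * \<phi> (norm (snd z))))))"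
      using lid(2) by (simp add: set_integrable_def)
    fix z :: "real \<times> 'a"
    have \<theta>nn: "0 \<le> \<theta> (fst z)" by (simp add: \<theta>_def prof_def ramp_nonneg)
    show "c1 * (?N z * coneW s R T z * ramp \<sigma> (fst z) ^ k) \<le> indicator ?S z *\<^sub>R (?N z * (\<theta> (fst z) * (\<kappa> (snd z) * \<phi> (norm (snd z)))))"
    proof (cases "0 < fst z \<and> fst z < T \<and> norm (snd z) \<le> fst z + R")
      case True
      then have "\<kappa> (snd z) = 1" using \<kappa>(4) by auto
      moreover have "z \<in> ?S" using True by (cases z) auto
      moreover have "(?N z * \<theta> (fst z)) * (c1 * expw s (snd z)) \<le> (?N z * \<theta> (fst z)) * \<phi> (norm (snd z))"
        using N_nonneg \<theta>nn by (intro mult_left_mono c1) auto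
      ultimately show ?thesis using True by (simp add: coneW_def \<theta>_def prof_def mult_ac)
    next
      case False
      then have "coneW s R T z = 0" by (auto simp: coneW_def)
      then show ?thesis using N_nonneg \<theta>nn \<kappa>(2) \<phi>0 by simp
    qed
  qed
  have upper: "(LINT z:?S|lborel. ?w z * (indicator (cball 0 (T + R)) (snd z) * (\<phi> (norm (snd z)) * ?ker z)))
     \<le> ((2 + \<alpha>) * C1 * real k) / (1 + \<sigma>) * (\<integral>z. \<bar>?w z\<bar> * coneW s R T z * ramp \<sigma> (fst z) ^ (k - 1) \<partial>lborel)"
    unfolding set_lebesgue_integral_def integral_mult_right_zero[symmetric]
  proof (rule integral_mono_AE)
    show "integrable lborel (\<lambda>z. ((2 + \<alpha>) * C1 * real k) / (1 + \<sigma>) * (\<bar>?w z\<bar> * coneW s R T z * ramp \<sigma> (fst z) ^ (k - 1)))"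
      using iw by (rule integrable_mult_right)
    show "integrable lborel (\<lambda>z. indicator ?S z *\<^sub>R (?w z * (indicator (cball 0 (T + R)) (snd z) * (\<phi> (norm (snd z)) * ?ker z))))"
      using lid(3) by (simp add: set_integrable_def)
    show "AE z in lborel. indicator ?S z *\<^sub>R (?w z * (indicator (cball 0 (T + R)) (snd z) * (\<phi> (norm (snd z)) * ?ker z)))
        \<le> ((2 + \<alpha>) * C1 * real k) / (1 + \<sigma>) * (\<bar>?w z\<bar> * coneW s R T z * ramp \<sigma> (fst z) ^ (k - 1))"
      using wt_cone_AE
    proof eventually_elim
      case (elim z)
      have rhs0: "0 \<le> ((2 + \<alpha>) * C1 * real k) / (1 + \<sigma>) * (\<bar>?w z\<bar> * coneW s R T z * ramp \<sigma> (fst z) ^ (k - 1))"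
        using \<alpha>0 C1 \<sigma> coneW_nonneg[of s R T z] ramp_nonneg[of \<sigma> "fst z"] by (intro mult_nonneg_nonneg divide_nonneg_nonneg) auto
      show ?case
      proof (cases "z \<in> ?S \<and> norm (snd z) \<le> fst z + R")
        case True
        then have t: "0 < fst z" "fst z < T" by (cases z; auto)+
        have "?w z * (\<phi> (norm (snd z)) * ?ker z) \<le> \<bar>?w z\<bar> * (\<bar>\<phi> (norm (snd z))\<bar> * \<bar>?ker z\<bar>)"
          by (metis abs_ge_self abs_mult)
        also have "\<dots> \<le> \<bar>?w z\<bar> * ((C1 * expw s (snd z)) * ((2 + \<alpha>) * slope k \<sigma> (fst z)))"
          using C1(2)[of "snd z"] \<phi>0[of "norm (snd z)"] ker[OF t(1)] by (intro mult_left_mono mult_mono) auto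
        also have "\<dots> = ((2 + \<alpha>) * C1 * real k) / (1 + \<sigma>) * (\<bar>?w z\<bar> * coneW s R T z * ramp \<sigma> (fst z) ^ (k - 1))"
          using True t by (simp add: coneW_def slope_def)
        finally show ?thesis using True t by simp
      next
        case False
        then have "indicator ?S z *\<^sub>R (?w z * (indicator (cball 0 (T + R)) (snd z) * (\<phi> (norm (snd z)) * ?ker z))) = 0"
          using elim by (cases z) (auto simp: indicator_def)
        then show ?thesis using rhs0 by (simp only:)
      qed
    qed
  qed
  define ck where "ck = (1 / 4 :: real) ^ k * exp (- 1) / 2"
  have init: "ck * ((\<integral>x. w1 x * \<phi> (norm x) \<partial>lborel) + (\<integral>x. w0 x * \<phi> (norm x) \<partial>lborel)) \<le>
     \<theta> 0 * (\<integral>x. w1 x * \<phi> (norm x) \<partial>lborel) + tail b \<theta> 0 * (\<integral>x. w0 x * ((1 + D x) * \<phi> (norm x)) \<partial>lborel)"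
  proof -
    have ck: "0 \<le> ck" "ck \<le> \<theta> 0" "ck \<le> tail b \<theta> 0"
      unfolding ck_def \<theta>_def using prof_0_ge[OF \<sigma>(1) b(1)] by auto
    have c\<phi>: "continuous_on UNIV (\<lambda>x::'a. \<phi> (norm x))" by (rule continuous_on_compose2[OF \<phi>(1)]) (auto intro: continuous_intros)
    have I1: "0 \<le> (\<integral>x. w1 x * \<phi> (norm x) \<partial>lborel)" using w \<phi>0 by (intro Bochner_Integration.integral_nonneg) auto
    have I0: "0 \<le> (\<integral>x. w0 x * \<phi> (norm x) \<partial>lborel)" using w \<phi>0 by (intro Bochner_Integration.integral_nonneg) auto
    have int: "integrable lborel (\<lambda>x. w0 x * h x)" if hc: "continuous_on UNIV h" for h
    proof -
      obtain K where K: "0 \<le> K" "\<And>x. norm x \<le> R \<Longrightarrow> \<bar>h x\<bar> \<le> K" by (rule continuous_bounded_ball[OF hc, of R]) (rule that)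
      have "is_L2 (\<lambda>x. indicator (cball 0 R) x * h x)"
      proof (rule is_L2_bounded_support[of _ K R])
        show "(\<lambda>x. indicator (cball 0 R) x * h x) \<in> borel_measurable borel"
          using borel_measurable_continuous_onI[OF hc] by (intro borel_measurable_times borel_measurable_indicator) auto
      qed (use K in \<open>auto simp: indicator_def\<close>)
      moreover have "is_L2 w0" by (rule is_L2_continuous_support[OF data(1,3)])
      ultimately have "integrable lborel (\<lambda>x. w0 x * (indicator (cball 0 R) x * h x))" by (intro L2_pairing)
      moreover have "w0 x * (indicator (cball 0 R) x * h x) = w0 x * h x" for x
        using data(3)[of x] by (cases "norm x \<le> R") auto
      ultimately show ?thesis by simp
    qed
    have "(\<integral>x. w0 x * \<phi> (norm x) \<partial>lborel) \<le> (\<integral>x. w0 x * ((1 + D x) * \<phi> (norm x)) \<partial>lborel)"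
    proof (rule integral_mono)
      show "integrable lborel (\<lambda>x. w0 x * \<phi> (norm x))" by (intro int c\<phi>)
      show "integrable lborel (\<lambda>x. w0 x * ((1 + D x) * \<phi> (norm x)))" by (intro int continuous_intros c\<phi> coeff)
      show "w0 x * \<phi> (norm x) \<le> w0 x * ((1 + D x) * \<phi> (norm x))" for x
        using w(1)[of x] D(1)[of x] \<phi>0[of "norm x"] by (intro mult_left_mono) (auto simp: algebra_simps)
    qed
    then have "ck * (\<integral>x. w0 x * \<phi> (norm x) \<partial>lborel) \<le> tail b \<theta> 0 * (\<integral>x. w0 x * ((1 + D x) * \<phi> (norm x)) \<partial>lborel)"
      using ck I0 by (intro mult_mono) auto
    moreover have "ck * (\<integral>x. w1 x * \<phi> (norm x) \<partial>lborel) \<le> \<theta> 0 * (\<integral>x. w1 x * \<phi> (norm x) \<partial>lborel)"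
      using ck I1 by (intro mult_right_mono) auto
    ultimately show ?thesis by (simp add: distrib_left)
  qed
  note e = mult_left_mono[OF init less_imp_le[OF \<epsilon>]]
  show ?thesis
    unfolding ck_def[symmetric] mult.commute[of _ \<epsilon>] using e lower upper lid(1) by linarith
qed

end

section \<open>Assembling the estimates for the system\<close>

lemma smooth_fun_continuous: "smooth_fun f \<Longrightarrow> continuous_on UNIV f"
proof -
  assume "smooth_fun f"
  then have "f differentiable (at x)" for x
    unfolding smooth_fun_def by (metis iter_dd.simps(1))
  then show ?thesis
    by (simp add: continuous_at_imp_continuous_on differentiable_imp_continuous_within)
qed

lemma integral_pos_of_continuous:
  fixes f :: "'a::euclidean_space \<Rightarrow> real"
  assumes f: "continuous_on UNIV f" "\<And>x. 0 \<le> f x" "f x0 \<noteq> 0" "\<And>x. R < norm x \<Longrightarrow> f x = 0"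
    and g: "continuous_on UNIV g" "\<And>x. 1 \<le> g x"
  shows "0 < (\<integral>x. f x * g x \<partial>lborel)"
proof -
  define h where "h = (\<lambda>x. f x * g x)"
  have ch: "continuous_on UNIV h" unfolding h_def by (intro continuous_intros f g)
  have h0: "0 \<le> h x" for x using f(2)[of x] g(2)[of x] by (simp add: h_def)
  have hx: "0 < h x0" using f(2)[of x0] f(3) g(2)[of x0] by (simp add: h_def order_less_le)
  have int: "integrable lborel h"
  proof -
    obtain K where K: "0 \<le> K" "\<And>x. \<bar>h x\<bar> \<le> K"
      by (rule continuous_support_bounded[OF ch, of R]) (use f(4) in \<open>auto simp: h_def\<close>)
    show ?thesis
    proof (rule Bochner_Integration.integrable_bound)
      show "integrable lborel (\<lambda>x. indicator (cball (0::'a) R) x * K)"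
        by (intro integrable_mult_left integrable_real_indicator) (auto simp: emeasure_bounded_finite[simplified])
      show "AE x in lborel. norm (h x) \<le> norm (indicator (cball (0::'a) R) x * K)"
      proof (rule AE_I2)
        fix x show "norm (h x) \<le> norm (indicator (cball (0::'a) R) x * K)"
          using K(1) K(2)[of x] f(4)[of x] by (cases "norm x \<le> R") (auto simp: h_def)
      qed
    qed (use borel_measurable_continuous_onI[OF ch] in simp)
  qed
  have "\<not> (AE x in lborel. h x = 0)"
  proof
    assume ae: "AE x in lborel. h x = 0"
    have "open {x. 0 < h x}" using ch by (intro open_Collect_less continuous_on_const)
    then have "\<exists>e>0. ball x0 e \<subseteq> {x. 0 < h x}"
      unfolding open_contains_ball by (rule bspec) (use hx in simp)
    then obtain e where e: "0 < e" "ball x0 e \<subseteq> {x. 0 < h x}" by (elim exE conjE)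
    from ae have "AE x in lborel. x \<notin> ball x0 e"
      by eventually_elim (use e in auto)
    then have "emeasure lborel (ball x0 e) = 0" by (subst (asm) AE_iff_measurable[OF _ refl]) (auto simp: ball_def)
    moreover have "0 < unit_ball_vol (real DIM('a)) * e ^ DIM('a)"
      using e(1) by (intro mult_pos_pos unit_ball_vol_pos) auto
    ultimately show False using emeasure_ball[of e x0] e(1) by (simp add: ennreal_eq_0_iff)
  qed
  then have "(\<integral>x. h x \<partial>lborel) \<noteq> 0" using integral_nonneg_eq_0_iff_AE[OF int] h0 by auto
  moreover have "0 \<le> (\<integral>x. h x \<partial>lborel)" using h0 by (intro Bochner_Integration.integral_nonneg) auto
  ultimately show ?thesis by (simp add: h_def)
qed

lemma wave_profile:
  fixes D V :: "'a::euclidean_space \<Rightarrow> real"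
  assumes n: "3 \<le> DIM('a)" and c: "\<alpha>1 \<ge> 0" "\<alpha>2 \<ge> 0" "\<beta> > 1" "\<omega> > 2"
    and reg: "continuous_on UNIV D" "continuous_on UNIV V" "radial D" "radial V"
    and D: "\<forall>x. 0 \<le> D x \<and> D x \<le> \<alpha>1 * (1 + norm x) powr (- \<beta>)"
    and V: "\<forall>x. 0 \<le> V x \<and> V x \<le> \<alpha>2 * (1 + norm x) powr (- \<omega>)"
  obtains a \<phi> :: "real \<Rightarrow> real" and c1 C1 :: real where "continuous_on UNIV a" "\<And>x::'a. a (norm x) = 1 + D x + V x"
    "continuous_on UNIV \<phi>" "\<And>r. \<phi> r = 1 + volterra DIM('a) a \<phi> r" "\<And>r. 1 \<le> \<phi> r"
    "0 < c1" "\<And>x::'a. c1 * expw ((real DIM('a) - 1) / 2) x \<le> \<phi> (norm x)"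
    "0 < C1" "\<And>x::'a. \<phi> (norm x) \<le> C1 * expw ((real DIM('a) - 1) / 2) x"
proof -
  obtain e :: 'a where "e \<in> Basis" using nonempty_Basis by blast
  then have e: "norm e = 1" by simp
  define a where "a = (\<lambda>r. 1 + D (r *\<^sub>R e) + V (r *\<^sub>R e))"
  have ca: "continuous_on UNIV a"
    unfolding a_def by (intro continuous_intros continuous_on_compose2[OF reg(1)] continuous_on_compose2[OF reg(2)]) auto
  have a_eq: "a (norm x) = 1 + D x + V x" for x
  proof -
    have "norm (norm x *\<^sub>R e) = norm x" by (simp add: e)
    then show ?thesis using reg(3,4) unfolding a_def radial_def by metis
  qed
  have a1: "1 \<le> a r" for r using D V by (simp add: a_def)
  \<comment> \<open>Both decay rates dominate this one, since \<omega> > 2; capping it at 2 is what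
    \<open>volterra_bounds\<close> asks for.\<close>
  define \<gamma> where "\<gamma> = min \<beta> 2"
  have \<gamma>: "1 < \<gamma>" "\<gamma> \<le> 2" using c by (auto simp: \<gamma>_def)
  have aK: "a r \<le> 1 + (\<alpha>1 + \<alpha>2) * r powr (- \<gamma>)" if r: "1 \<le> r" for r
  proof -
    have p: "(1 + r) powr (- \<delta>) \<le> r powr (- \<gamma>)" if "\<gamma> \<le> \<delta>" for \<delta>
    proof -
      have "(1 + r) powr (- \<delta>) \<le> r powr (- \<delta>)" using r that \<gamma> by (intro powr_mono2') auto
      also have "\<dots> \<le> r powr (- \<gamma>)" using r that by (intro powr_mono) auto
      finally show ?thesis .
    qed
    have nr: "norm (r *\<^sub>R e) = r" using r e by simp
    have "D (r *\<^sub>R e) \<le> \<alpha>1 * (1 + r) powr (- \<beta>)" using D[rule_format, of "r *\<^sub>R e"] nr by simp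
    also have "\<dots> \<le> \<alpha>1 * r powr (- \<gamma>)" using c by (intro mult_left_mono p) (auto simp: \<gamma>_def)
    finally have 1: "D (r *\<^sub>R e) \<le> \<alpha>1 * r powr (- \<gamma>)" .
    have "V (r *\<^sub>R e) \<le> \<alpha>2 * (1 + r) powr (- \<omega>)" using V[rule_format, of "r *\<^sub>R e"] nr by simp
    also have "\<dots> \<le> \<alpha>2 * r powr (- \<gamma>)" using c by (intro mult_left_mono p) (auto simp: \<gamma>_def)
    finally show ?thesis using 1 by (simp add: a_def algebra_simps)
  qed
  obtain \<phi> where \<phi>: "continuous_on UNIV \<phi>" "\<And>r. 1 \<le> \<phi> r" "\<And>r. \<phi> r = 1 + volterra DIM('a) a \<phi> r"
  proof (rule volterra_solution[OF ca])
    show "0 \<le> a r" for r using a1[of r] by simp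
  qed (rule that)
  obtain c1 C1 where "0 < c1" "0 < C1" and b: "\<And>r. 0 \<le> r \<Longrightarrow> c1 * ((1 + r) powr (- ((real DIM('a) - 1) / 2)) * exp r) \<le> \<phi> r"
    "\<And>r. 0 \<le> r \<Longrightarrow> \<phi> r \<le> C1 * ((1 + r) powr (- ((real DIM('a) - 1) / 2)) * exp r)"
    using volterra_bounds[OF n ca a1 \<gamma> _ aK \<phi>] c by (metis add_nonneg_nonneg)
  show ?thesis
    by (rule that[OF ca a_eq \<phi>(1,3,2) \<open>0 < c1\<close> _ \<open>0 < C1\<close>]) (use b in \<open>auto simp: expw_def\<close>)
qed

text \<open>The order of quantifiers is the point: \<open>c0\<close> and \<open>C\<close> depend on
  the coefficients, the data, R and k, and are chosen before T, \<epsilon>, \<sigma> and the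
  solution. Nontrivial data and \<phi> \<ge> 1 make \<open>c0\<close> positive.\<close>

lemma component_inequality:
  fixes D V w0 w1 :: "'a::euclidean_space \<Rightarrow> real"
  assumes n: "3 \<le> DIM('a)" and c: "\<alpha>1 \<ge> 0" "\<alpha>2 \<ge> 0" "\<beta> > 1" "\<omega> > 2"
    and reg: "continuous_on UNIV D" "continuous_on UNIV V" "radial D" "radial V"
    and D: "\<forall>x. 0 \<le> D x \<and> D x \<le> \<alpha>1 * (1 + norm x) powr (- \<beta>)"
    and V: "\<forall>x. 0 \<le> V x \<and> V x \<le> \<alpha>2 * (1 + norm x) powr (- \<omega>)"
    and w: "continuous_on UNIV w0" "continuous_on UNIV w1" "\<And>x. 0 \<le> w0 x" "\<And>x. 0 \<le> w1 x"
      "\<And>x. norm x > R \<Longrightarrow> w0 x = 0" "\<And>x. norm x > R \<Longrightarrow> w1 x = 0"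
    and nontriv: "(\<exists>x. w0 x \<noteq> 0) \<or> (\<exists>x. w1 x \<noteq> 0)" and k: "2 \<le> k"
  obtains c0 C :: real where "0 < c0" "0 < C"
    "\<And>T \<epsilon> N w wt gw \<sigma>. weak_wave T \<epsilon> R D V w0 w1 N w wt gw \<Longrightarrow> 0 < \<epsilon> \<Longrightarrow> 1 \<le> \<sigma> \<Longrightarrow> \<sigma> < T \<Longrightarrow>
      c0 * \<epsilon> + (\<integral>z. N (fst z) (snd z) * coneW ((real DIM('a) - 1) / 2) R T z * ramp \<sigma> (fst z) ^ k \<partial>lborel)
      \<le> C / (1 + \<sigma>) * (\<integral>z. \<bar>wt (fst z) (snd z)\<bar> * coneW ((real DIM('a) - 1) / 2) R T z * ramp \<sigma> (fst z) ^ (k - 1) \<partial>lborel)"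
proof -
  define s where "s = (real DIM('a) - 1) / 2"
  have s0: "0 \<le> s" using n by (simp add: s_def)
  obtain a \<phi> :: "real \<Rightarrow> real" and c1 C1 :: real where a: "continuous_on UNIV a" "\<And>x::'a. a (norm x) = 1 + D x + V x"
    and \<phi>: "continuous_on UNIV \<phi>" "\<And>r. \<phi> r = 1 + volterra DIM('a) a \<phi> r" "\<And>r. 1 \<le> \<phi> r"
    and c1: "0 < c1" "\<And>x::'a. c1 * expw s x \<le> \<phi> (norm x)"
    and C1u: "0 < C1" "\<And>x::'a. \<phi> (norm x) \<le> C1 * expw s x"
    by (rule wave_profile[OF n c reg D V, folded s_def]) (rule that)
  define I where "I = (\<integral>x. w1 x * \<phi> (norm x) \<partial>lborel) + (\<integral>x. w0 x * \<phi> (norm x) \<partial>lborel)"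
  have c\<phi>: "continuous_on UNIV (\<lambda>x::'a. \<phi> (norm x))" by (rule continuous_on_compose2[OF \<phi>(1)]) (auto intro: continuous_intros)
  have \<phi>0: "0 \<le> \<phi> r" for r using \<phi>(3)[of r] by simp
  have nn: "0 \<le> (\<integral>x. w1 x * \<phi> (norm x) \<partial>lborel)" "0 \<le> (\<integral>x. w0 x * \<phi> (norm x) \<partial>lborel)"
    using w \<phi>0 by (auto intro!: Bochner_Integration.integral_nonneg)
  have I: "0 < I"
    using nontriv
  proof
    assume "\<exists>x. w0 x \<noteq> 0"
    then obtain x0 where "w0 x0 \<noteq> 0" by blast
    then have "0 < (\<integral>x. w0 x * \<phi> (norm x) \<partial>lborel)"
      by (rule integral_pos_of_continuous[OF w(1,3) _ w(5) c\<phi> \<phi>(3)])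
    then show ?thesis using nn by (simp add: I_def)
  next
    assume "\<exists>x. w1 x \<noteq> 0"
    then obtain x0 where "w1 x0 \<noteq> 0" by blast
    then have "0 < (\<integral>x. w1 x * \<phi> (norm x) \<partial>lborel)"
      by (rule integral_pos_of_continuous[OF w(2,4) _ w(6) c\<phi> \<phi>(3)])
    then show ?thesis using nn by (simp add: I_def)
  qed
  have D\<alpha>: "D x \<le> \<alpha>1" for x
  proof -
    have "1 + norm x \<noteq> 0" using norm_ge_zero[of x] by linarith
    then have "(1 + norm x) powr (- \<beta>) \<le> 1" using powr_mono[of "- \<beta>" 0 "1 + norm x"] c by simp
    then show ?thesis using D[rule_format, of x] c mult_left_mono[of "(1 + norm x) powr (- \<beta>)" 1 \<alpha>1] by simp
  qed
  show ?thesis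
  proof (rule that[of "(1 / 4) ^ k * exp (- 1) / 2 * I / c1" "(2 + \<alpha>1) * C1 * real k / c1"])
    show "0 < (1 / 4) ^ k * exp (- 1) / 2 * I / c1" using I c1 by simp
    show "0 < (2 + \<alpha>1) * C1 * real k / c1" using c C1u c1 k by simp
    fix T \<epsilon> N w wt gw \<sigma>
    assume ww: "weak_wave T \<epsilon> R D V w0 w1 N w wt gw" and \<epsilon>: "0 < \<epsilon>" and \<sigma>: "1 \<le> \<sigma>" "\<sigma> < T"
    interpret weak_wave T \<epsilon> R D V w0 w1 N w wt gw by (rule ww)
    have "((1 / 4) ^ k * exp (- 1) / 2 * I) * \<epsilon>
     + c1 * (\<integral>z. N (fst z) (snd z) * coneW s R T z * ramp \<sigma> (fst z) ^ k \<partial>lborel)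
     \<le> ((2 + \<alpha>1) * C1 * real k) / (1 + \<sigma>) * (\<integral>z. \<bar>wt (fst z) (snd z)\<bar> * coneW s R T z * ramp \<sigma> (fst z) ^ (k - 1) \<partial>lborel)"
      (is "?A * \<epsilon> + c1 * ?X \<le> ?B / (1 + \<sigma>) * ?Y")
      unfolding I_def
      by (rule cone_inequality[OF a \<phi> c1 C1u s0 _ D\<alpha> _ _ \<epsilon> k \<sigma>]) (use D \<open>\<And>x. 0 \<le> w0 x\<close> \<open>\<And>x. 0 \<le> w1 x\<close> in auto)
    from divide_right_mono[OF this, of c1] c1
    have "?A / c1 * \<epsilon> + ?X \<le> ?B / c1 / (1 + \<sigma>) * ?Y"
      by (simp add: add_divide_distrib mult_ac)
    then show "?A / c1 * \<epsilon> + (\<integral>z. N (fst z) (snd z) * coneW ((real DIM('a) - 1) / 2) R T z * ramp \<sigma> (fst z) ^ k \<partial>lborel)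
      \<le> ?B / c1 / (1 + \<sigma>) * (\<integral>z. \<bar>wt (fst z) (snd z)\<bar> * coneW ((real DIM('a) - 1) / 2) R T z * ramp \<sigma> (fst z) ^ (k - 1) \<partial>lborel)"
      unfolding s_def .
  qed
qed

text \<open>The power of \<open>v\<close> is the source in the equation for \<open>w\<close>, so
  \<open>N_loc_int\<close> for that equation supplies its integrability down to time 0.\<close>

lemma weak_wave_admissible:
  fixes v :: "real \<Rightarrow> 'a::euclidean_space \<Rightarrow> real"
  assumes ww: "weak_wave T \<epsilon> R D V w0 w1 (\<lambda>t x. \<bar>v t x\<bar> powr p) w wt gw"
    and v: "(\<lambda>z. v (fst z) (snd z)) \<in> borel_measurable borel"
    and cw: "cone_weight (lborel :: (real \<times> 'a) measure) fst (coneW s R T) s C0 T"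
  shows "cone_weight.admissible lborel fst (coneW s R T) T p (\<lambda>z. \<bar>v (fst z) (snd z)\<bar>)"
proof -
  interpret weak_wave T \<epsilon> R D V w0 w1 "\<lambda>t x. \<bar>v t x\<bar> powr p" w wt gw by (rule ww)
  interpret cw: cone_weight "lborel :: (real \<times> 'a) measure" fst "coneW s R T" s C0 T by (rule cw)
  have s0: "0 \<le> s" using cw.s_pos by simp
  show ?thesis
    unfolding cw.admissible_def
  proof (intro conjI allI impI)
    show "(\<lambda>z. \<bar>v (fst z) (snd z)\<bar>) \<in> borel_measurable lborel" using v by auto
    fix \<sigma> :: real assume \<sigma>: "1 \<le> \<sigma>" "\<sigma> < T"
    have "set_integrable lborel ({0<..<T} \<times> UNIV) (\<lambda>z. \<bar>v (fst z) (snd z)\<bar> powr p * (if fst z < \<sigma> then coneW s R T z else 0))"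
    proof (rule loc_int_mult[OF N_loc_int \<sigma>(2), where K = "exp R" and L = "T + R"])
      have [measurable]: "coneW s R T \<in> borel_measurable (borel \<Otimes>\<^sub>M borel :: (real \<times> 'a) measure)"
        using coneW_measurable[of s R T, where 'a = 'a] by (simp add: borel_prod)
      have "(\<lambda>z :: real \<times> 'a. if fst z < \<sigma> then coneW s R T z else 0) \<in> borel_measurable (borel \<Otimes>\<^sub>M borel)" by measurable
      then show "(\<lambda>z :: real \<times> 'a. if fst z < \<sigma> then coneW s R T z else 0) \<in> borel_measurable borel" by (simp add: borel_prod)
      show "\<bar>if fst z < \<sigma> then coneW s R T z else 0\<bar> \<le> exp R" for z :: "real \<times> 'a"
        using coneW_le[OF s0 R, of T z] coneW_nonneg[of s R T z] by auto
      show "(if fst z < \<sigma> then coneW s R T z else 0) = 0" if "\<sigma> < fst z \<or> T + R < norm (snd z)" for z :: "real \<times> 'a"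
        using that by (auto simp: coneW_def)
    qed
    moreover have "indicator ({0<..<T} \<times> UNIV) z *\<^sub>R (\<bar>v (fst z) (snd z)\<bar> powr p * (if fst z < \<sigma> then coneW s R T z else 0)) =
      (if fst z < \<sigma> then \<bar>v (fst z) (snd z)\<bar> powr p * coneW s R T z else 0)" for z
      by (cases z) (auto simp: coneW_def indicator_def)
    ultimately show "integrable lborel (\<lambda>z. if fst z < \<sigma> then \<bar>v (fst z) (snd z)\<bar> powr p * coneW s R T z else 0)"
      by (simp add: set_integrable_def)
  qed auto
qed

text \<open>For p > 1 the condition k / p \<le> k - 1 says k \<ge> p / (p - 1).\<close>

lemma exists_exponent:
  fixes p q :: real
  assumes "1 < p" "1 < q"
  obtains k :: nat where "2 \<le> k" "real k / p \<le> real (k - 1)" "real k / q \<le> real (k - 1)"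
proof -
  define k where "k = nat \<lceil>max (p / (p - 1)) (q / (q - 1))\<rceil> + 2"
  have "max (p / (p - 1)) (q / (q - 1)) \<le> real k" unfolding k_def by linarith
  then have "p / (p - 1) \<le> real k" "q / (q - 1) \<le> real k" by auto
  then have "real k / p \<le> real (k - 1)" "real k / q \<le> real (k - 1)"
    using assms by (auto simp: k_def field_simps)
  then show ?thesis by (intro that[of k]) (auto simp: k_def)
qed

lemma GammaGG_eq_Gam: "q \<le> p \<Longrightarrow> 1 < q \<Longrightarrow> GammaGG n p q = Gam ((real n - 1) / 2) p q"
proof -
  assume "q \<le> p" "1 < q"
  then have "(q + 1) / (p * q - 1) \<le> (p + 1) / (p * q - 1)"
    using less_1_mult[of p q] by (intro divide_right_mono) auto
  then show ?thesis by (simp add: GammaGG_def Gam_def)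
qed

lemma GammaGG_commute: "GammaGG n p q = GammaGG n q p"
  by (simp add: GammaGG_def max.commute mult.commute)

theorem theorem1p2:
  fixes D1 D2 V1 V2 u0 u1 v0 v1 :: "'a::euclidean_space \<Rightarrow> real"
    and p q R \<alpha>1 \<alpha>2 \<beta> \<omega> :: real
  assumes n3: "DIM('a) \<ge> 3"
    and pq: "p > 1" "q > 1"
    and const_asm: "\<alpha>1 \<ge> 0" "\<alpha>2 \<ge> 0" "\<beta> > 1" "\<omega> > 2"
    and coeff_reg: "\<forall>f\<in>{D1, D2, V1, V2}. continuous_on UNIV f \<and> (\<exists>\<delta>>0. hoelder_ball \<delta> f) \<and> radial f"
    and D_bd: "\<forall>x. 0 \<le> D1 x \<and> D1 x \<le> \<alpha>1 * (1 + norm x) powr (- \<beta>)"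
              "\<forall>x. 0 \<le> D2 x \<and> D2 x \<le> \<alpha>1 * (1 + norm x) powr (- \<beta>)"
    and V_bd: "\<forall>x. 0 \<le> V1 x \<and> V1 x \<le> \<alpha>2 * (1 + norm x) powr (- \<omega>)"
              "\<forall>x. 0 \<le> V2 x \<and> V2 x \<le> \<alpha>2 * (1 + norm x) powr (- \<omega>)"
    and R: "R > 0"
    and data: "\<forall>f\<in>{u0, u1, v0, v1}. smooth_fun f \<and> (\<forall>x. 0 \<le> f x) \<and> (\<forall>x. norm x > R \<longrightarrow> f x = 0)"
    and nontriv: "(\<exists>x. u0 x \<noteq> 0) \<or> (\<exists>x. u1 x \<noteq> 0)" "(\<exists>x. v0 x \<noteq> 0) \<or> (\<exists>x. v1 x \<noteq> 0)"
    and Gamma: "GammaGG DIM('a) p q \<ge> 0"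
  shows "(\<forall>\<epsilon>>0. lifespan p q D1 D2 V1 V2 u0 u1 v0 v1 R \<epsilon> < \<infinity>) \<and>
    (\<exists>\<epsilon>0>0. \<exists>C>0. \<forall>\<epsilon>. 0 < \<epsilon> \<and> \<epsilon> < \<epsilon>0 \<longrightarrow>
       lifespan p q D1 D2 V1 V2 u0 u1 v0 v1 R \<epsilon> \<le> ereal
        (if GammaGG DIM('a) p q > 0 then C * \<epsilon> powr (- (1 / GammaGG DIM('a) p q))
         else if p \<noteq> q then exp (C * \<epsilon> powr (- (p * q - 1)))
         else exp (C * \<epsilon> powr (- (p - 1)))))"
proof -
  define s where "s = (real DIM('a) - 1) / 2"
  have s0: "0 < s" using n3 by (simp add: s_def)
  obtain k :: nat where k: "2 \<le> k" "real k / p \<le> real (k - 1)" "real k / q \<le> real (k - 1)"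
    by (rule exists_exponent[OF pq]) (rule that)
  have reg: "continuous_on UNIV D1" "continuous_on UNIV V1" "radial D1" "radial V1"
    "continuous_on UNIV D2" "continuous_on UNIV V2" "radial D2" "radial V2" using coeff_reg by auto
  have dat: "continuous_on UNIV u0" "continuous_on UNIV u1" "continuous_on UNIV v0" "continuous_on UNIV v1"
    using data by (auto intro: smooth_fun_continuous)
  have nonneg: "0 \<le> u0 x" "0 \<le> u1 x" "0 \<le> v0 x" "0 \<le> v1 x" for x using data by auto
  have sup: "u0 x = 0" "u1 x = 0" "v0 x = 0" "v1 x = 0" if "R < norm x" for x using data that by auto
  obtain cu Cu where cu: "0 < cu" "0 < Cu"
    "\<And>T \<epsilon> N w wt gw \<sigma>. weak_wave T \<epsilon> R D1 V1 u0 u1 N w wt gw \<Longrightarrow> 0 < \<epsilon> \<Longrightarrow> 1 \<le> \<sigma> \<Longrightarrow> \<sigma> < T \<Longrightarrow>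
      cu * \<epsilon> + (\<integral>z. N (fst z) (snd z) * coneW s R T z * ramp \<sigma> (fst z) ^ k \<partial>lborel)
      \<le> Cu / (1 + \<sigma>) * (\<integral>z. \<bar>wt (fst z) (snd z)\<bar> * coneW s R T z * ramp \<sigma> (fst z) ^ (k - 1) \<partial>lborel)"
    by (rule component_inequality[where R = R, OF n3 const_asm reg(1-4) D_bd(1) V_bd(1) dat(1,2) nonneg(1,2) sup(1,2) nontriv(1) k(1), folded s_def]) (assumption, assumption, rule that)
  obtain cv Cv where cv: "0 < cv" "0 < Cv"
    "\<And>T \<epsilon> N w wt gw \<sigma>. weak_wave T \<epsilon> R D2 V2 v0 v1 N w wt gw \<Longrightarrow> 0 < \<epsilon> \<Longrightarrow> 1 \<le> \<sigma> \<Longrightarrow> \<sigma> < T \<Longrightarrow>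
      cv * \<epsilon> + (\<integral>z. N (fst z) (snd z) * coneW s R T z * ramp \<sigma> (fst z) ^ k \<partial>lborel)
      \<le> Cv / (1 + \<sigma>) * (\<integral>z. \<bar>wt (fst z) (snd z)\<bar> * coneW s R T z * ramp \<sigma> (fst z) ^ (k - 1) \<partial>lborel)"
    by (rule component_inequality[where R = R, OF n3 const_asm reg(5-8) D_bd(2) V_bd(2) dat(3,4) nonneg(3,4) sup(3,4) nontriv(2) k(1), folded s_def]) (assumption, assumption, rule that)
  \<comment> \<open>The two components come with different constants; the smaller data constant and
    the larger factor serve both.\<close>
  define c where "c = min cu cv"
  define C where "C = max Cu Cv"
  have c: "0 < c" and C: "0 < C" using cu cv by (auto simp: c_def C_def)
  have n2: "2 \<le> DIM('a)" using n3 by simp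
  obtain C0 where C0: "1 \<le> C0" "\<And>T. cone_weight (lborel :: (real \<times> 'a) measure) fst (coneW s R T) s C0 T"
    by (rule coneW_cone_weight[OF R n2, folded s_def]) (rule that)

  \<comment> \<open>The source for u is a power of |v_t|, hence \<open>f\<close> is built from
    \<open>vt\<close> and \<open>g\<close> from \<open>ut\<close>.\<close>
  have coupled: "\<exists>f g. cone_weight.coupled lborel fst (coneW s R T) T k p (c * \<epsilon>) q C f (g :: real \<times> 'a \<Rightarrow> real) \<and>
      cone_weight.coupled lborel fst (coneW s R T) T k q (c * \<epsilon>) p C g f"
    if \<epsilon>: "0 < \<epsilon>" and sol: "weak_solution p q D1 D2 V1 V2 u0 u1 v0 v1 \<epsilon> T u ut gu v vt gv" and cone: "supp_in_cone R T u v"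
    for \<epsilon> T u ut gu v vt gv
  proof -
    have sol': "0 < T" "C_H1 T u gu" "C1_L2 T u ut" "C_H1 T v gv" "C1_L2 T v vt"
      "(\<lambda>z. ut (fst z) (snd z)) \<in> borel_measurable borel" "(\<lambda>z. vt (fst z) (snd z)) \<in> borel_measurable borel"
      "AE x in lborel. u 0 x = \<epsilon> * u0 x" "AE x in lborel. v 0 x = \<epsilon> * v0 x"
      "weak_eq T \<epsilon> D1 V1 u0 u1 (\<lambda>t x. \<bar>vt t x\<bar> powr p) u ut gu"
      "weak_eq T \<epsilon> D2 V2 v0 v1 (\<lambda>t x. \<bar>ut t x\<bar> powr q) v vt gv"
      using sol by (auto simp: weak_solution_def Lp_loc_def)
    have sup': "AE x in lborel. t + R < norm x \<longrightarrow> u t x = 0" "AE x in lborel. t + R < norm x \<longrightarrow> v t x = 0" if "t \<in> {0..<T}" for t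
    proof -
      have "AE x in lborel. t + R < norm x \<longrightarrow> u t x = 0 \<and> v t x = 0" using cone that by (auto simp: supp_in_cone_def)
      then show "AE x in lborel. t + R < norm x \<longrightarrow> u t x = 0" "AE x in lborel. t + R < norm x \<longrightarrow> v t x = 0"
        by (auto elim: eventually_mono)
    qed
    have wu: "weak_wave T \<epsilon> R D1 V1 u0 u1 (\<lambda>t x. \<bar>vt t x\<bar> powr p) u ut gu"
      by unfold_locales (use sol' sup' R reg dat sup in auto)
    have wv: "weak_wave T \<epsilon> R D2 V2 v0 v1 (\<lambda>t x. \<bar>ut t x\<bar> powr q) v vt gv"
      by unfold_locales (use sol' sup' R reg dat sup in auto)
    interpret cw: cone_weight "lborel :: (real \<times> 'a) measure" fst "coneW s R T" s C0 T by (rule C0(2))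
    define f where "f = (\<lambda>z :: real \<times> 'a. \<bar>vt (fst z) (snd z)\<bar>)"
    define g where "g = (\<lambda>z :: real \<times> 'a. \<bar>ut (fst z) (snd z)\<bar>)"
    have hat: "cw.hat \<sigma> z = ramp \<sigma> (fst z)" for \<sigma> z by (simp add: cw.hat_def ramp_def)
    have adm: "cw.admissible p f" "cw.admissible q g"
      unfolding f_def g_def by (rule weak_wave_admissible[OF wu sol'(7) C0(2)], rule weak_wave_admissible[OF wv sol'(6) C0(2)])
    have weaken: "c * \<epsilon> + X \<le> C / (1 + \<sigma>) * Y" if "c' * \<epsilon> + X \<le> C' / (1 + \<sigma>) * Y" "c \<le> c'" "C' \<le> C" "0 \<le> Y" "1 \<le> \<sigma>" for c' C' X Y \<sigma>
    proof -
      have "c * \<epsilon> \<le> c' * \<epsilon>" using that \<epsilon> by (intro mult_right_mono) auto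
      moreover have "C' / (1 + \<sigma>) * Y \<le> C / (1 + \<sigma>) * Y" using that by (intro mult_right_mono divide_right_mono) auto
      ultimately show ?thesis using that(1) by linarith
    qed
    have nn: "0 \<le> (\<integral>z. h z * coneW s R T z * ramp \<sigma> (fst z) ^ (k - 1) \<partial>lborel)" if "\<And>z. 0 \<le> h z" for h :: "real \<times> 'a \<Rightarrow> real" and \<sigma>
      using that by (intro Bochner_Integration.integral_nonneg mult_nonneg_nonneg coneW_nonneg zero_le_power ramp_nonneg)
    have "cw.coupled k p (c * \<epsilon>) q C f g"
      unfolding cw.coupled_def cw.X_def hat
    proof (intro conjI adm allI impI)
      fix \<sigma> assume \<sigma>: "1 \<le> \<sigma>" "\<sigma> < T"
      show "c * \<epsilon> + (\<integral>z. f z powr p * coneW s R T z * ramp \<sigma> (fst z) ^ k \<partial>lborel) \<le> C / (1 + \<sigma>) * (\<integral>z. g z * coneW s R T z * ramp \<sigma> (fst z) ^ (k - 1) \<partial>lborel)"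
        unfolding f_def g_def by (rule weaken[OF cu(3)[OF wu \<epsilon> \<sigma>] _ _ nn \<sigma>(1)]) (auto simp: c_def C_def)
    qed
    moreover have "cw.coupled k q (c * \<epsilon>) p C g f"
      unfolding cw.coupled_def cw.X_def hat
    proof (intro conjI adm allI impI)
      fix \<sigma> assume \<sigma>: "1 \<le> \<sigma>" "\<sigma> < T"
      show "c * \<epsilon> + (\<integral>z. g z powr q * coneW s R T z * ramp \<sigma> (fst z) ^ k \<partial>lborel) \<le> C / (1 + \<sigma>) * (\<integral>z. f z * coneW s R T z * ramp \<sigma> (fst z) ^ (k - 1) \<partial>lborel)"
        unfolding f_def g_def by (rule weaken[OF cv(3)[OF wv \<epsilon> \<sigma>] _ _ nn \<sigma>(1)]) (auto simp: c_def C_def)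
    qed
    ultimately show ?thesis by blast
  qed

  let ?\<Gamma> = "GammaGG DIM('a) p q"
  define bd where "bd = (\<lambda>K \<epsilon>. if ?\<Gamma> > 0 then 1 + K * \<epsilon> powr (- (1 / ?\<Gamma>))
      else if p \<noteq> q then exp (K * (1 + \<epsilon> powr (- (p * q - 1)))) else exp (K * (1 + \<epsilon> powr (- (p - 1)))))"
  have "\<exists>K>0. \<forall>T \<epsilon> f g. 0 < \<epsilon> \<longrightarrow> cone_weight.coupled lborel fst (coneW s R T) T k p (c * \<epsilon>) q C f (g :: real \<times> 'a \<Rightarrow> real) \<longrightarrow>
      cone_weight.coupled lborel fst (coneW s R T) T k q (c * \<epsilon>) p C g f \<longrightarrow> T \<le> bd K \<epsilon>"
  \<comment> \<open>\<open>coupled_lifespan\<close> takes the larger exponent in first place; in the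
    other case u and v exchange roles, under which \<open>GammaGG\<close> is symmetric.\<close>
  proof (cases "q \<le> p")
    case True
    have \<Gamma>: "?\<Gamma> = Gam s p q" using GammaGG_eq_Gam[OF True pq(2)] by (simp add: s_def)
    obtain K where K: "0 < K" "\<And>(M :: (real \<times> 'a) measure) tt W T f g \<epsilon>. cone_weight M tt W s C0 T \<Longrightarrow> 0 < \<epsilon> \<Longrightarrow>
      cone_weight.coupled M tt W T k p (c * \<epsilon>) q C f g \<Longrightarrow> cone_weight.coupled M tt W T k q (c * \<epsilon>) p C g f \<Longrightarrow>
      T \<le> (if 0 < Gam s p q then 1 + K * \<epsilon> powr (- (1 / Gam s p q))
           else if p \<noteq> q then exp (K * (1 + \<epsilon> powr (- (p * q - 1))))
           else exp (K * (1 + \<epsilon> powr (- (p - 1)))))"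
      by (rule coupled_lifespan[OF pq(2) True s0 Gamma[unfolded \<Gamma>] c C C0(1) k, where 'b = "real \<times> 'a"]) (rule that)
    show ?thesis
      unfolding bd_def \<Gamma> using K(1) K(2)[OF C0(2)] by blast
  next
    case False
    then have le: "p \<le> q" and ne: "p \<noteq> q" "q \<noteq> p" by auto
    have \<Gamma>: "?\<Gamma> = Gam s q p" using GammaGG_eq_Gam[OF le pq(1)] by (simp add: s_def GammaGG_commute)
    obtain K where K: "0 < K" "\<And>(M :: (real \<times> 'a) measure) tt W T f g \<epsilon>. cone_weight M tt W s C0 T \<Longrightarrow> 0 < \<epsilon> \<Longrightarrow>
      cone_weight.coupled M tt W T k q (c * \<epsilon>) p C f g \<Longrightarrow> cone_weight.coupled M tt W T k p (c * \<epsilon>) q C g f \<Longrightarrow>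
      T \<le> (if 0 < Gam s q p then 1 + K * \<epsilon> powr (- (1 / Gam s q p))
           else if q \<noteq> p then exp (K * (1 + \<epsilon> powr (- (q * p - 1))))
           else exp (K * (1 + \<epsilon> powr (- (q - 1)))))"
      by (rule coupled_lifespan[OF pq(1) le s0 Gamma[unfolded \<Gamma>] c C C0(1) k(1,3,2), where 'b = "real \<times> 'a"]) (rule that)
    have bd: "bd K \<epsilon> = (if 0 < Gam s q p then 1 + K * \<epsilon> powr (- (1 / Gam s q p))
           else if q \<noteq> p then exp (K * (1 + \<epsilon> powr (- (q * p - 1))))
           else exp (K * (1 + \<epsilon> powr (- (q - 1)))))" for \<epsilon>
      using ne by (simp add: bd_def \<Gamma> mult.commute)
    show ?thesis
      by (intro exI[of _ K] conjI K(1) allI impI, unfold bd) (rule K(2)[OF C0(2)])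
  qed
  then obtain K where K: "0 < K" and T_le: "\<And>T \<epsilon> f g. 0 < \<epsilon> \<Longrightarrow> cone_weight.coupled lborel fst (coneW s R T) T k p (c * \<epsilon>) q C f (g :: real \<times> 'a \<Rightarrow> real) \<Longrightarrow>
      cone_weight.coupled lborel fst (coneW s R T) T k q (c * \<epsilon>) p C g f \<Longrightarrow> T \<le> bd K \<epsilon>" by blast
  have life: "lifespan p q D1 D2 V1 V2 u0 u1 v0 v1 R \<epsilon> \<le> ereal (bd K \<epsilon>)" if "0 < \<epsilon>" for \<epsilon>
    unfolding lifespan_def
  proof (rule SUP_least)
    fix T assume "T \<in> {T. \<exists>(u::real \<Rightarrow> 'a \<Rightarrow> real) ut gu v vt gv. weak_solution p q D1 D2 V1 V2 u0 u1 v0 v1 \<epsilon> T u ut gu v vt gv \<and> supp_in_cone R T u v}"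
    then obtain u ut gu v vt gv where sol: "weak_solution p q D1 D2 V1 V2 u0 u1 v0 v1 \<epsilon> T u ut gu v vt gv" "supp_in_cone R T u v"
      by blast
    from coupled[OF that sol] show "ereal T \<le> ereal (bd K \<epsilon>)" using T_le[OF that] by auto
  qed
  have fin: "\<forall>\<epsilon>>0. lifespan p q D1 D2 V1 V2 u0 u1 v0 v1 R \<epsilon> < \<infinity>"
  proof (intro allI impI)
    fix \<epsilon> :: real assume "0 < \<epsilon>"
    show "lifespan p q D1 D2 V1 V2 u0 u1 v0 v1 R \<epsilon> < \<infinity>"
      by (rule le_less_trans[OF life[OF \<open>0 < \<epsilon>\<close>]]) simp
  qed
  have small: "\<forall>\<epsilon>. 0 < \<epsilon> \<and> \<epsilon> < 1 \<longrightarrow> lifespan p q D1 D2 V1 V2 u0 u1 v0 v1 R \<epsilon> \<le> ereal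
        (if ?\<Gamma> > 0 then (2 * K + 1) * \<epsilon> powr (- (1 / ?\<Gamma>))
         else if p \<noteq> q then exp ((2 * K + 1) * \<epsilon> powr (- (p * q - 1)))
         else exp ((2 * K + 1) * \<epsilon> powr (- (p - 1))))"
  proof (intro allI impI)
    fix \<epsilon> :: real assume \<epsilon>: "0 < \<epsilon> \<and> \<epsilon> < 1"
    have ge1: "1 \<le> \<epsilon> powr (- e)" if "0 \<le> e" for e
      using \<epsilon> that powr_mono'[of "- e" 0 \<epsilon>] by simp
    \<comment> \<open>For \<epsilon> < 1 the powers of \<epsilon> are at least 1 and absorb the
      additive 1; the constant 2 K + 1 fits both the algebraic and the exponential form.\<close>
    have lin: "1 + K * x \<le> (2 * K + 1) * x" "K * (1 + x) \<le> (2 * K + 1) * x" if "1 \<le> x" for x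
    proof -
      have "K \<le> K * x" using K that by (simp add: mult_le_cancel_left1)
      moreover have "(2 * K + 1) * x = K * x + K * x + x" "K * (1 + x) = K + K * x" by (simp_all add: algebra_simps)
      ultimately show "1 + K * x \<le> (2 * K + 1) * x" "K * (1 + x) \<le> (2 * K + 1) * x" using that K by linarith+
    qed
    have "bd K \<epsilon> \<le> (if ?\<Gamma> > 0 then (2 * K + 1) * \<epsilon> powr (- (1 / ?\<Gamma>))
         else if p \<noteq> q then exp ((2 * K + 1) * \<epsilon> powr (- (p * q - 1)))
         else exp ((2 * K + 1) * \<epsilon> powr (- (p - 1))))"
      unfolding bd_def using Gamma pq less_1_mult[OF pq] by (auto simp del: minus_diff_eq intro!: lin ge1)
    then show "lifespan p q D1 D2 V1 V2 u0 u1 v0 v1 R \<epsilon> \<le> ereal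
        (if ?\<Gamma> > 0 then (2 * K + 1) * \<epsilon> powr (- (1 / ?\<Gamma>))
         else if p \<noteq> q then exp ((2 * K + 1) * \<epsilon> powr (- (p * q - 1)))
         else exp ((2 * K + 1) * \<epsilon> powr (- (p - 1))))"
      by (intro order_trans[OF life]) (use \<epsilon> in auto)
  qed
  have "0 < 2 * K + 1" using K by simp
  with small have "\<exists>C>0. \<forall>\<epsilon>. 0 < \<epsilon> \<and> \<epsilon> < 1 \<longrightarrow> lifespan p q D1 D2 V1 V2 u0 u1 v0 v1 R \<epsilon> \<le> ereal
        (if ?\<Gamma> > 0 then C * \<epsilon> powr (- (1 / ?\<Gamma>))
         else if p \<noteq> q then exp (C * \<epsilon> powr (- (p * q - 1)))
         else exp (C * \<epsilon> powr (- (p - 1))))"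
    by (intro exI[of _ "2 * K + 1"] conjI)
  note ex = this
  show ?thesis
    by (rule conjI[OF fin], rule exI[of _ 1], rule conjI[OF zero_less_one]) (rule ex)
qed

end
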